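(* Let $\Gamma$ be an atomic graph and $G=G(\Gamma)$. Let $\operatorname{Comm}(G)$ denote the commensurator of $G$ and $\operatorname{QI}(G)$ its quasi-isometry group. Then both of the canonical homomorphisms $$\operatorname{Aut}(G)\to\operatorname{Comm}(G),\qquad \operatorname{Comm}(G)\to\operatorname{QI}(G)$$ are injective, and have infinite index images.
   Context: A finite simplicial graph $\Gamma$ is atomic if (1) it is connected and has no vertex of valence $<2$; (2) it contains no cycles of length $<5$; (3) it has no separating closed vertex stars (the closed star of a vertex $v$ is the union of all closed edges containing $v$; it is separating if its complement in $\Gamma$ is disconnected). The right-angled Artin group $G(\Gamma)$ has one generator for each vertex and one commutation relation for each edge of $\Gamma$. $\operatorname{Comm}(G)$ is the group of equivalence classes of isomorphisms $G_1\to G_2$ between finite index subgroups of $G$, two being equivalent if they agree on a finite index subgroup. $\operatorname{QI}(G)$ is the group of self-quasi-isometries of $G$ (with a word metric) modulo the relation of being at bounded distance. The canonical maps send an automorphism to its class in $\operatorname{Comm}(G)$, and an isomorphism between finite index subgroups to the class of the quasi-isometry of $G$ it induces. *)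

theory Defs
  imports
    "HOL-Algebra.Bij"
    "HOL-Algebra.Generated_Groups"
    "HOL-Analysis.Abstract_Metric_Spaces"
    "HOL-Analysis.Function_Topology"
    "Graph_Theory.Graph_Theory"
begin


section \<open>Atomic graphs\<close>

text \<open>
  A finite simplicial graph is a \<^locale>\<open>pair_graph\<close>: finite, loop-free, symmetric, arcs given by
  pairs of vertices.  Its geometric realization lives in the real functions on the vertices, in
  barycentric coordinates.
\<close>

definition closed_cell :: "'v set \<Rightarrow> ('v \<Rightarrow> real) set" where
  "closed_cell \<sigma> = {x. (\<forall>a. 0 \<le> x a) \<and> (\<forall>a. a \<notin> \<sigma> \<longrightarrow> x a = 0) \<and> sum x \<sigma> = 1}"

definition realization :: "'v pair_pre_digraph \<Rightarrow> ('v \<Rightarrow> real) set" where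
  "realization \<Gamma> = (\<Union>v\<in>pverts \<Gamma>. closed_cell {v}) \<union> (\<Union>(u, w)\<in>parcs \<Gamma>. closed_cell {u, w})"

definition closed_star :: "'v pair_pre_digraph \<Rightarrow> 'v \<Rightarrow> ('v \<Rightarrow> real) set" where
  "closed_star \<Gamma> v = (\<Union>(u, w)\<in>{e \<in> parcs \<Gamma>. v = fst e \<or> v = snd e}. closed_cell {u, w})"

definition separating_star :: "'v pair_pre_digraph \<Rightarrow> 'v \<Rightarrow> bool" where
  "separating_star \<Gamma> v \<longleftrightarrow>
     \<not> connectedin (powertop_real UNIV) (realization \<Gamma> - closed_star \<Gamma> v)"

text \<open>
  In a symmetric digraph, \<^const>\<open>pre_digraph.cycle\<close> also holds of an edge traversed back and
  forth; the cycles of the undirected graph are those with at least three arcs.  The valence of a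
  vertex is its out-degree.  \<^const>\<open>Digraph_Component.connected\<close> includes non-emptiness.
\<close>

definition atomic_graph :: "'v pair_pre_digraph \<Rightarrow> bool" where
  "atomic_graph \<Gamma> \<longleftrightarrow>
     pair_graph \<Gamma> \<and>
     Digraph_Component.connected (with_proj \<Gamma>) \<and>
     (\<forall>v\<in>pverts \<Gamma>. \<not> out_degree (with_proj \<Gamma>) v < 2) \<and>
     (\<forall>p. pre_digraph.cycle (with_proj \<Gamma>) p \<and> 3 \<le> length p \<longrightarrow> \<not> length p < 5) \<and>
     (\<forall>v\<in>pverts \<Gamma>. \<not> separating_star \<Gamma> v)"


section \<open>Quotient groups modulo an equivalence relation\<close>

definition quotient_monoid :: "'a set \<Rightarrow> ('a \<times> 'a) set \<Rightarrow> ('a \<Rightarrow> 'a \<Rightarrow> 'a) \<Rightarrow> 'a \<Rightarrow> 'a set monoid" where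
  "quotient_monoid X R f e =
    \<lparr>carrier = X // R, Group.monoid.mult = (\<lambda>A B. \<Union>x\<in>A. \<Union>y\<in>B. R `` {f x y}), one = R `` {e}\<rparr>"


section \<open>Right-angled Artin groups\<close>

text \<open>
  Words are lists of letters; \<^term>\<open>(v, True)\<close> stands for the generator of the vertex
  \<^term>\<open>v\<close>, and \<^term>\<open>(v, False)\<close> for its inverse.
\<close>

definition raag_words :: "'v pair_pre_digraph \<Rightarrow> ('v \<times> bool) list set" where
  "raag_words \<Gamma> = lists (pverts \<Gamma> \<times> UNIV)"

inductive_set raag_rel :: "'v pair_pre_digraph \<Rightarrow> (('v \<times> bool) list \<times> ('v \<times> bool) list) set"
  for \<Gamma> where
  raag_refl: "xs \<in> raag_words \<Gamma> \<Longrightarrow> (xs, xs) \<in> raag_rel \<Gamma>"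
| raag_sym: "(xs, ys) \<in> raag_rel \<Gamma> \<Longrightarrow> (ys, xs) \<in> raag_rel \<Gamma>"
| raag_trans: "(xs, ys) \<in> raag_rel \<Gamma> \<Longrightarrow> (ys, zs) \<in> raag_rel \<Gamma> \<Longrightarrow> (xs, zs) \<in> raag_rel \<Gamma>"
| raag_cancel: "xs \<in> raag_words \<Gamma> \<Longrightarrow> ys \<in> raag_words \<Gamma> \<Longrightarrow> v \<in> pverts \<Gamma> \<Longrightarrow>
    (xs @ [(v, b), (v, \<not> b)] @ ys, xs @ ys) \<in> raag_rel \<Gamma>"
| raag_commute: "xs \<in> raag_words \<Gamma> \<Longrightarrow> ys \<in> raag_words \<Gamma> \<Longrightarrow>
    u \<in> pverts \<Gamma> \<Longrightarrow> w \<in> pverts \<Gamma> \<Longrightarrow> (u, w) \<in> parcs \<Gamma> \<Longrightarrow>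
    (xs @ [(u, True), (w, True)] @ ys, xs @ [(w, True), (u, True)] @ ys) \<in> raag_rel \<Gamma>"

definition raag :: "'v pair_pre_digraph \<Rightarrow> ('v \<times> bool) list set monoid" where
  "raag \<Gamma> = quotient_monoid (raag_words \<Gamma>) (raag_rel \<Gamma>) (@) []"


section \<open>The commensurator\<close>

definition finite_index_subgroup :: "'a set \<Rightarrow> ('a, 'm) monoid_scheme \<Rightarrow> bool" where
  "finite_index_subgroup H G \<longleftrightarrow> subgroup H G \<and> finite (rcosets\<^bsub>G\<^esub> H)"

text \<open>
  An isomorphism between finite index subgroups is recorded as its domain together with an
  extensional function on it; its codomain is the image.
\<close>

definition partial_isos :: "('a, 'm) monoid_scheme \<Rightarrow> ('a set \<times> ('a \<Rightarrow> 'a)) set" where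
  "partial_isos G = {(H, \<phi>). finite_index_subgroup H G \<and> finite_index_subgroup (\<phi> ` H) G \<and>
     \<phi> \<in> extensional H \<and> \<phi> \<in> iso (G\<lparr>carrier := H\<rparr>) (G\<lparr>carrier := \<phi> ` H\<rparr>)}"

definition commensurate :: "('a, 'm) monoid_scheme \<Rightarrow>
    (('a set \<times> ('a \<Rightarrow> 'a)) \<times> ('a set \<times> ('a \<Rightarrow> 'a))) set" where
  "commensurate G = {((H, \<phi>), (K, \<psi>)). (H, \<phi>) \<in> partial_isos G \<and> (K, \<psi>) \<in> partial_isos G \<and>
     (\<exists>L. finite_index_subgroup L G \<and> L \<subseteq> H \<inter> K \<and> (\<forall>x\<in>L. \<phi> x = \<psi> x))}"

fun partial_comp :: "'a set \<times> ('a \<Rightarrow> 'a) \<Rightarrow> 'a set \<times> ('a \<Rightarrow> 'a) \<Rightarrow> 'a set \<times> ('a \<Rightarrow> 'a)" where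
  "partial_comp (K, \<psi>) (H, \<phi>) =
     ({x \<in> H. \<phi> x \<in> K}, restrict (\<lambda>x. \<psi> (\<phi> x)) {x \<in> H. \<phi> x \<in> K})"

definition Comm :: "('a, 'm) monoid_scheme \<Rightarrow> ('a set \<times> ('a \<Rightarrow> 'a)) set monoid" where
  "Comm G =
     quotient_monoid (partial_isos G) (commensurate G) partial_comp (carrier G, \<lambda>x\<in>carrier G. x)"

definition Aut_to_Comm :: "('a, 'm) monoid_scheme \<Rightarrow> ('a \<Rightarrow> 'a) \<Rightarrow> ('a set \<times> ('a \<Rightarrow> 'a)) set" where
  "Aut_to_Comm G \<alpha> = commensurate G `` {(carrier G, \<alpha>)}"


section \<open>The quasi-isometry group\<close>

definition quasi_isometry ::
    "'a set \<Rightarrow> ('a \<Rightarrow> 'a \<Rightarrow> real) \<Rightarrow> 'b set \<Rightarrow> ('b \<Rightarrow> 'b \<Rightarrow> real) \<Rightarrow> ('a \<Rightarrow> 'b) \<Rightarrow> bool" where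
  "quasi_isometry M d N e f \<longleftrightarrow> f ` M \<subseteq> N \<and>
     (\<exists>L\<ge>1. \<exists>C\<ge>0.
        (\<forall>x\<in>M. \<forall>y\<in>M. d x y / L - C \<le> e (f x) (f y) \<and> e (f x) (f y) \<le> L * d x y + C) \<and>
        (\<forall>z\<in>N. \<exists>x\<in>M. e z (f x) \<le> C))"

definition self_QIs :: "'a set \<Rightarrow> ('a \<Rightarrow> 'a \<Rightarrow> real) \<Rightarrow> ('a \<Rightarrow> 'a) set" where
  "self_QIs M d = {f \<in> extensional M. quasi_isometry M d M d f}"

definition bounded_dist :: "'a set \<Rightarrow> ('a \<Rightarrow> 'a \<Rightarrow> real) \<Rightarrow> (('a \<Rightarrow> 'a) \<times> ('a \<Rightarrow> 'a)) set" where
  "bounded_dist M d = {(f, g). f \<in> self_QIs M d \<and> g \<in> self_QIs M d \<and>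
     (\<exists>C. \<forall>x\<in>M. d (f x) (g x) \<le> C)}"

definition QI :: "'a set \<Rightarrow> ('a \<Rightarrow> 'a \<Rightarrow> real) \<Rightarrow> ('a \<Rightarrow> 'a) set monoid" where
  "QI M d = quotient_monoid (self_QIs M d) (bounded_dist M d) (compose M) (\<lambda>x\<in>M. x)"

definition word_length :: "('a, 'm) monoid_scheme \<Rightarrow> 'a set \<Rightarrow> 'a \<Rightarrow> nat" where
  "word_length G S g = (LEAST n. \<exists>xs. length xs = n \<and> set xs \<subseteq> S \<union> m_inv G ` S \<and>
     foldr (\<otimes>\<^bsub>G\<^esub>) xs \<one>\<^bsub>G\<^esub> = g)"

definition word_metric :: "('a, 'm) monoid_scheme \<Rightarrow> 'a set \<Rightarrow> 'a \<Rightarrow> 'a \<Rightarrow> real" where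
  "word_metric G S x y =
     (if x \<in> carrier G \<and> y \<in> carrier G then real (word_length G S (inv\<^bsub>G\<^esub> x \<otimes>\<^bsub>G\<^esub> y)) else 0)"

text \<open>
  An isomorphism \<open>\<phi>\<close> from \<open>H\<close> onto a finite index subgroup induces the quasi-isometry
  \<open>\<phi> \<circ> r\<close>, where \<open>r\<close> is a quasi-inverse of the inclusion of \<open>H\<close> into \<open>G\<close>, that is, a map into
  \<open>H\<close> at bounded distance from the identity.  All choices of \<open>(H, \<phi>)\<close> in a class and of \<open>r\<close> give
  the same class, so that the union below is a single class.
\<close>

definition coarse_retractions ::
    "('a, 'm) monoid_scheme \<Rightarrow> 'a set \<Rightarrow> 'a set \<Rightarrow> ('a \<Rightarrow> 'a) set" where
  "coarse_retractions G S H = {r. r ` carrier G \<subseteq> H \<and>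
     (\<exists>C. \<forall>x\<in>carrier G. word_metric G S x (r x) \<le> C)}"

definition Comm_to_QI :: "('a, 'm) monoid_scheme \<Rightarrow> 'a set \<Rightarrow>
    ('a set \<times> ('a \<Rightarrow> 'a)) set \<Rightarrow> ('a \<Rightarrow> 'a) set" where
  "Comm_to_QI G S A = (\<Union>(H, \<phi>)\<in>A. \<Union>r\<in>coarse_retractions G S H.
     bounded_dist (carrier G) (word_metric G S) `` {\<lambda>x\<in>carrier G. \<phi> (r x)})"


section \<open>The quotients are groups\<close>

lemma quotient_monoid_mult:
  assumes R: "equiv X R"
    and cong: "\<And>x x' y y'. (x, x') \<in> R \<Longrightarrow> (y, y') \<in> R \<Longrightarrow> (f x y, f x' y') \<in> R"
    and xy: "x \<in> X" "y \<in> X"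
  shows "R `` {x} \<otimes>\<^bsub>quotient_monoid X R f e\<^esub> R `` {y} = R `` {f x y}"
proof -
  have eq: "R `` {f x' y'} = R `` {f x y}" if "x' \<in> R `` {x}" "y' \<in> R `` {y}" for x' y'
    using equiv_class_eq[OF R cong[of x x' y y']] that by simp
  have "(\<Union>x'\<in>R `` {x}. \<Union>y'\<in>R `` {y}. R `` {f x' y'}) = (\<Union>x'\<in>R `` {x}. \<Union>y'\<in>R `` {y}. R `` {f x y})"
    by (intro SUP_cong refl eq)
  also have "\<dots> = R `` {f x y}"
    using equiv_class_self[OF R xy(1)] equiv_class_self[OF R xy(2)] by blast
  finally show ?thesis
    by (simp add: quotient_monoid_def)
qed

lemma group_quotient_monoid:
  assumes R: "equiv X R"
    and closed: "\<And>x y. x \<in> X \<Longrightarrow> y \<in> X \<Longrightarrow> f x y \<in> X"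
    and cong: "\<And>x x' y y'. (x, x') \<in> R \<Longrightarrow> (y, y') \<in> R \<Longrightarrow> (f x y, f x' y') \<in> R"
    and e: "e \<in> X"
    and assoc: "\<And>x y z. x \<in> X \<Longrightarrow> y \<in> X \<Longrightarrow> z \<in> X \<Longrightarrow> (f (f x y) z, f x (f y z)) \<in> R"
    and unit: "\<And>x. x \<in> X \<Longrightarrow> (f e x, x) \<in> R"
    and inv: "\<And>x. x \<in> X \<Longrightarrow> \<exists>y\<in>X. (f y x, e) \<in> R"
  shows "group (quotient_monoid X R f e)" (is "group ?Q")
proof -
  have carr: "carrier ?Q = X // R" and one: "\<one>\<^bsub>?Q\<^esub> = R `` {e}"
    by (simp_all add: quotient_monoid_def)
  have mult: "R `` {x} \<otimes>\<^bsub>?Q\<^esub> R `` {y} = R `` {f x y}" if "x \<in> X" "y \<in> X" for x y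
    using quotient_monoid_mult[OF R cong that] .
  have obt: "\<exists>x\<in>X. A = R `` {x}" if "A \<in> carrier ?Q" for A
    using that by (auto simp: carr quotient_def)
  have cls: "R `` {x} \<in> carrier ?Q" if "x \<in> X" for x
    using that by (auto simp: carr quotient_def)
  show ?thesis
  proof (rule groupI)
    show "A \<otimes>\<^bsub>?Q\<^esub> B \<in> carrier ?Q" if "A \<in> carrier ?Q" "B \<in> carrier ?Q" for A B
      using obt[OF that(1)] obt[OF that(2)] by (auto simp: mult intro!: cls closed)
    show "\<one>\<^bsub>?Q\<^esub> \<in> carrier ?Q"
      using e by (simp add: one cls)
    show "A \<otimes>\<^bsub>?Q\<^esub> B \<otimes>\<^bsub>?Q\<^esub> C = A \<otimes>\<^bsub>?Q\<^esub> (B \<otimes>\<^bsub>?Q\<^esub> C)"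
      if ABC: "A \<in> carrier ?Q" "B \<in> carrier ?Q" "C \<in> carrier ?Q" for A B C
    proof -
      obtain x y z where xyz: "x \<in> X" "A = R `` {x}" "y \<in> X" "B = R `` {y}" "z \<in> X" "C = R `` {z}"
        using obt[OF ABC(1)] obt[OF ABC(2)] obt[OF ABC(3)] by blast
      show ?thesis
        using equiv_class_eq[OF R assoc[OF xyz(1,3,5)]] xyz by (simp add: mult closed)
    qed
    show "\<one>\<^bsub>?Q\<^esub> \<otimes>\<^bsub>?Q\<^esub> A = A" if "A \<in> carrier ?Q" for A
    proof -
      obtain x where "x \<in> X" "A = R `` {x}" using obt[OF \<open>A \<in> carrier ?Q\<close>] by auto
      then show ?thesis using equiv_class_eq[OF R unit] e by (simp add: mult one)
    qed
    show "\<exists>B\<in>carrier ?Q. B \<otimes>\<^bsub>?Q\<^esub> A = \<one>\<^bsub>?Q\<^esub>" if "A \<in> carrier ?Q" for A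
    proof -
      obtain x where x: "x \<in> X" "A = R `` {x}" using obt[OF \<open>A \<in> carrier ?Q\<close>] by auto
      obtain y where y: "y \<in> X" "(f y x, e) \<in> R" using inv[OF x(1)] by auto
      have "R `` {y} \<otimes>\<^bsub>?Q\<^esub> A = \<one>\<^bsub>?Q\<^esub>"
        using x y by (simp add: mult one equiv_class_eq[OF R])
      then show ?thesis using cls y by blast
    qed
  qed
qed

lemma raag_rel_words: "(xs, ys) \<in> raag_rel \<Gamma> \<Longrightarrow> xs \<in> raag_words \<Gamma> \<and> ys \<in> raag_words \<Gamma>"
  by (induction rule: raag_rel.induct) (auto simp: raag_words_def)

lemma equiv_raag_rel: "equiv (raag_words \<Gamma>) (raag_rel \<Gamma>)"
proof (rule equivI)
  show "raag_rel \<Gamma> \<subseteq> raag_words \<Gamma> \<times> raag_words \<Gamma>"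
    by (auto dest: raag_rel_words)
  show "refl_on (raag_words \<Gamma>) (raag_rel \<Gamma>)"
    by (rule refl_onI) (rule raag_rel.raag_refl)
  show "sym (raag_rel \<Gamma>)"
    by (rule symI) (rule raag_rel.raag_sym)
  show "trans (raag_rel \<Gamma>)"
    by (rule transI) (rule raag_rel.raag_trans)
qed

lemma raag_rel_append:
  assumes "(xs, ys) \<in> raag_rel \<Gamma>" "us \<in> raag_words \<Gamma>" "vs \<in> raag_words \<Gamma>"
  shows "(us @ xs @ vs, us @ ys @ vs) \<in> raag_rel \<Gamma>"
  using assms
proof (induction rule: raag_rel.induct)
  case (raag_refl xs)
  then show ?case by (intro raag_rel.raag_refl) (auto simp: raag_words_def)
next
  case (raag_sym xs ys)
  then show ?case by (simp add: raag_rel.raag_sym)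
next
  case (raag_trans xs ys zs)
  then show ?case by (metis raag_rel.raag_trans)
next
  case (raag_cancel xs ys v b)
  then have "us @ xs \<in> raag_words \<Gamma>" "ys @ vs \<in> raag_words \<Gamma>" by (auto simp: raag_words_def)
  from raag_rel.raag_cancel[OF this raag_cancel(3), of b] show ?case by simp
next
  case (raag_commute xs ys u w)
  then have "us @ xs \<in> raag_words \<Gamma>" "ys @ vs \<in> raag_words \<Gamma>" by (auto simp: raag_words_def)
  from raag_rel.raag_commute[OF this raag_commute(3-5)] show ?case by simp
qed

lemma raag_rel_inverse:
  assumes "xs \<in> raag_words \<Gamma>"
  shows "(map (map_prod id Not) (rev xs) @ xs, []) \<in> raag_rel \<Gamma>"
  using assms
proof (induction xs)
  case Nil
  then show ?case by (simp add: raag_words_def raag_rel.raag_refl)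
next
  case (Cons a xs)
  let ?i = "map (map_prod id Not) (rev xs)"
  obtain v b where a: "a = (v, b)" by (cases a)
  have v: "v \<in> pverts \<Gamma>" and xs: "xs \<in> raag_words \<Gamma>" "?i \<in> raag_words \<Gamma>"
    using Cons.prems a by (auto simp: raag_words_def in_lists_conv_set)
  show ?case
    using raag_rel.raag_trans[OF raag_rel.raag_cancel[OF xs(2,1) v, of "\<not> b"] Cons.IH[OF xs(1)]] a
    by (simp add: id_def)
qed

lemma group_raag: "group (raag \<Gamma>)"
  unfolding raag_def
proof (rule group_quotient_monoid[OF equiv_raag_rel])
  fix x x' y y' assume "(x, x') \<in> raag_rel \<Gamma>" "(y, y') \<in> raag_rel \<Gamma>"
  then have "(x @ y, x' @ y) \<in> raag_rel \<Gamma>" "(x' @ y, x' @ y') \<in> raag_rel \<Gamma>"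
    using raag_rel_append[of x x' \<Gamma> "[]" y] raag_rel_append[of y y' \<Gamma> x' "[]"] raag_rel_words
    by (force simp: raag_words_def)+
  then show "(x @ y, x' @ y') \<in> raag_rel \<Gamma>" by (rule raag_rel.raag_trans)
next
  fix xs assume xs: "xs \<in> raag_words \<Gamma>"
  then have "map (map_prod id Not) (rev xs) \<in> raag_words \<Gamma>"
    by (auto simp: raag_words_def in_lists_conv_set)
  then show "\<exists>ys\<in>raag_words \<Gamma>. (ys @ xs, []) \<in> raag_rel \<Gamma>"
    using raag_rel_inverse[OF xs] by blast
qed (auto simp: raag_words_def intro: raag_rel.raag_refl)

context group
begin

lemma finite_index_subgroup_iff_cover:
  "finite_index_subgroup H G \<longleftrightarrow>
     subgroup H G \<and> (\<exists>F. finite F \<and> F \<subseteq> carrier G \<and> carrier G \<subseteq> (\<Union>f\<in>F. H #> f))"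
proof (cases "subgroup H G")
  case True
  have rc: "rcosets H = (\<lambda>a. H #> a) ` carrier G" by (auto simp: RCOSETS_def)
  have self: "a \<in> H #> a" if "a \<in> carrier G" for a by (rule rcos_self[OF that True])
  have "\<exists>F. finite F \<and> F \<subseteq> carrier G \<and> carrier G \<subseteq> (\<Union>f\<in>F. H #> f)" if fin: "finite (rcosets H)"
  proof -
    obtain F where F: "F \<subseteq> carrier G" "finite F" "rcosets H = (\<lambda>a. H #> a) ` F"
      using finite_subset_image[OF fin, of "\<lambda>a. H #> a" "carrier G"] rc by auto
    have "\<exists>f\<in>F. a \<in> H #> f" if "a \<in> carrier G" for a
    proof -
      have "H #> a \<in> (\<lambda>a. H #> a) ` F" using F(3) rc that by blast
      then show ?thesis using self[OF that] by auto
    qed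
    then show ?thesis using F by (intro exI[of _ F]) auto
  qed
  moreover have "finite (rcosets H)"
    if F: "finite F" "F \<subseteq> carrier G" "carrier G \<subseteq> (\<Union>f\<in>F. H #> f)" for F
  proof (rule finite_subset)
    show "rcosets H \<subseteq> (\<lambda>a. H #> a) ` F"
    proof
      fix A assume "A \<in> rcosets H"
      then obtain a where a: "a \<in> carrier G" "A = H #> a" using rc by auto
      then obtain f where "f \<in> F" "a \<in> H #> f" using F(3) by blast
      then have "A = H #> f" using repr_independence[OF _ _ True, of a f] a F(2) by auto
      then show "A \<in> (\<lambda>a. H #> a) ` F" using \<open>f \<in> F\<close> by auto
    qed
  qed (use F in simp)
  ultimately show ?thesis using True unfolding finite_index_subgroup_def by blast
qed (simp add: finite_index_subgroup_def)

lemma finite_index_carrier: "finite_index_subgroup (carrier G) G"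
proof -
  have "a \<in> carrier G #> \<one>" if "a \<in> carrier G" for a
    using that coset_mult_one[of "carrier G"] by simp
  then show ?thesis
    unfolding finite_index_subgroup_iff_cover
    by (intro conjI exI[of _ "{\<one>}"]) (auto intro: subgroup_self)
qed

lemma finite_index_Int:
  assumes H: "finite_index_subgroup H G" and K: "finite_index_subgroup K G"
  shows "finite_index_subgroup (H \<inter> K) G"
proof -
  have sH: "subgroup H G" and sK: "subgroup K G"
    using assms by (auto simp: finite_index_subgroup_def)
  let ?p = "\<lambda>a. (H #> a, K #> a)"
  have "?p ` carrier G \<subseteq> (rcosets H) \<times> (rcosets K)"
    by (auto simp: RCOSETS_def)
  then have "finite (?p ` carrier G)"
    using assms by (auto simp: finite_index_subgroup_def intro: finite_subset)
  then obtain F where F: "F \<subseteq> carrier G" "finite F" "?p ` carrier G = ?p ` F"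
    using finite_subset_image[of "?p ` carrier G" ?p "carrier G"] by auto
  have "\<exists>f\<in>F. a \<in> H \<inter> K #> f" if a: "a \<in> carrier G" for a
  proof -
    have "?p a \<in> ?p ` F" using F(3) a by blast
    then obtain f where f: "f \<in> F" "H #> a = H #> f" "K #> a = K #> f" by auto
    then have fc: "f \<in> carrier G" using F(1) by blast
    have "a \<in> H #> f" "a \<in> K #> f"
      using rcos_self[OF a sH] rcos_self[OF a sK] f by auto
    then obtain h k where hk: "h \<in> H" "a = h \<otimes> f" "k \<in> K" "a = k \<otimes> f"
      by (auto simp: r_coset_def)
    moreover have "h = k"
      using hk fc subgroup.mem_carrier[OF sH] subgroup.mem_carrier[OF sK] by (metis right_cancel)
    ultimately show ?thesis using f(1) by (auto simp: r_coset_def)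
  qed
  then have "carrier G \<subseteq> (\<Union>f\<in>F. H \<inter> K #> f)" by blast
  then show ?thesis
    unfolding finite_index_subgroup_iff_cover
    using F(1,2) subgroups_Inter_pair[OF sH sK] by (intro conjI exI[of _ F]) simp_all
qed

lemma partial_isos_iff:
  "(H, \<phi>) \<in> partial_isos G \<longleftrightarrow> finite_index_subgroup H G \<and> finite_index_subgroup (\<phi> ` H) G \<and>
     \<phi> \<in> extensional H \<and> inj_on \<phi> H \<and> (\<forall>x\<in>H. \<forall>y\<in>H. \<phi> (x \<otimes> y) = \<phi> x \<otimes> \<phi> y)"
  by (auto simp: partial_isos_def iso_def hom_def bij_betw_def)

lemma partial_iso_closed:
  assumes "(H, \<phi>) \<in> partial_isos G" "x \<in> H"
  shows "x \<in> carrier G" "\<phi> x \<in> carrier G"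
proof -
  have "subgroup H G" "subgroup (\<phi> ` H) G"
    using assms(1) by (auto simp: partial_isos_iff finite_index_subgroup_def)
  then show "x \<in> carrier G" "\<phi> x \<in> carrier G"
    using assms(2) by (auto dest: subgroup.mem_carrier)
qed

lemma partial_iso_image:
  assumes p: "(H, \<phi>) \<in> partial_isos G" and L: "finite_index_subgroup L G" "L \<subseteq> H"
  shows "finite_index_subgroup (\<phi> ` L) G"
proof -
  have sH: "subgroup H G" and sL: "subgroup L G" and sI: "subgroup (\<phi> ` H) G"
    and m: "\<And>x y. x \<in> H \<Longrightarrow> y \<in> H \<Longrightarrow> \<phi> (x \<otimes> y) = \<phi> x \<otimes> \<phi> y"
    using p L by (auto simp: partial_isos_iff finite_index_subgroup_def)
  interpret h: group_hom "G\<lparr>carrier := H\<rparr>" G \<phi>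
    using p partial_iso_closed[OF p] subgroup.subgroup_is_group[OF sH is_group] is_group m
    by (intro group_hom.intro group_hom_axioms.intro) (auto simp: hom_def)
  have sub: "subgroup (\<phi> ` L) G"
    using h.subgroup_img_is_subgroup[of L] subgroup_incl[OF sL sH L(2)] by simp
  obtain E where E: "finite E" "E \<subseteq> carrier G" "carrier G \<subseteq> (\<Union>g\<in>E. \<phi> ` H #> g)"
    using p unfolding partial_isos_iff finite_index_subgroup_iff_cover by blast
  have "(\<lambda>a. L #> a) ` H \<subseteq> rcosets L"
    using subgroup.mem_carrier[OF sH] by (auto simp: RCOSETS_def)
  then have "finite ((\<lambda>a. L #> a) ` H)"
    using L(1) by (auto simp: finite_index_subgroup_def intro: finite_subset)
  then obtain F where F: "F \<subseteq> H" "finite F" "(\<lambda>a. L #> a) ` H = (\<lambda>a. L #> a) ` F"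
    using finite_subset_image[of "(\<lambda>a. L #> a) ` H" "\<lambda>a. L #> a" H] by auto
  have "\<exists>f\<in>F. \<exists>g\<in>E. a \<in> \<phi> ` L #> (\<phi> f \<otimes> g)" if "a \<in> carrier G" for a
  proof -
    have "a \<in> (\<Union>g\<in>E. \<phi> ` H #> g)" using E(3) that by blast
    then obtain g x where gx: "g \<in> E" "x \<in> H" "a = \<phi> x \<otimes> g"
      by (auto simp: r_coset_def)
    have "L #> x \<in> (\<lambda>a. L #> a) ` F" using F(3) gx(2) by blast
    then obtain f where f: "f \<in> F" "L #> x = L #> f" by auto
    have "x \<in> L #> f" using rcos_self[OF partial_iso_closed(1)[OF p gx(2)] sL] f(2) by simp
    then obtain l where l: "l \<in> L" "x = l \<otimes> f" by (auto simp: r_coset_def)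
    have lf: "l \<in> H" "f \<in> H" using l L(2) f F(1) by auto
    have "a = \<phi> l \<otimes> (\<phi> f \<otimes> g)"
      using gx l m[OF lf] partial_iso_closed(2)[OF p] lf E(2) by (auto simp: m_assoc)
    then show ?thesis using f(1) gx(1) l(1) by (auto simp: r_coset_def)
  qed
  then have cover: "carrier G \<subseteq> (\<Union>k\<in>(\<lambda>(f, g). \<phi> f \<otimes> g) ` (F \<times> E). \<phi> ` L #> k)"
    by fast
  have "\<phi> f \<otimes> g \<in> carrier G" if "f \<in> F" "g \<in> E" for f g
    using partial_iso_closed(2)[OF p subsetD[OF F(1) that(1)]] subsetD[OF E(2) that(2)] by simp
  then have "(\<lambda>(f, g). \<phi> f \<otimes> g) ` (F \<times> E) \<subseteq> carrier G"
    by auto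
  then show ?thesis
    unfolding finite_index_subgroup_iff_cover using sub cover F(2) E(1)
    by (metis finite_cartesian_product finite_imageI)
qed

lemma partial_iso_inverse:
  assumes p: "(H, \<phi>) \<in> partial_isos G"
  shows "(\<phi> ` H, restrict (inv_into H \<phi>) (\<phi> ` H)) \<in> partial_isos G"
proof -
  have inj: "inj_on \<phi> H" and m: "\<And>x y. x \<in> H \<Longrightarrow> y \<in> H \<Longrightarrow> \<phi> x \<otimes> \<phi> y = \<phi> (x \<otimes> y)"
    and sH: "subgroup H G" and sI: "subgroup (\<phi> ` H) G"
    using p by (auto simp: partial_isos_iff finite_index_subgroup_def)
  have im: "restrict (inv_into H \<phi>) (\<phi> ` H) ` (\<phi> ` H) = H"
    using inj by (force simp: image_image)
  have mult: "restrict (inv_into H \<phi>) (\<phi> ` H) (\<phi> x \<otimes> \<phi> y) = x \<otimes> y" if "x \<in> H" "y \<in> H" for x y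
    using inj subgroup.m_closed[OF sH that] m[OF that] by (simp add: inv_into_f_f)
  have "inj_on (restrict (inv_into H \<phi>) (\<phi> ` H)) (\<phi> ` H)"
    using inj by (auto simp: inj_on_def)
  then show ?thesis
    using p mult inj unfolding partial_isos_iff im by auto
qed

lemma partial_iso_vimage:
  assumes p: "(H, \<phi>) \<in> partial_isos G" and A: "finite_index_subgroup A G"
  shows "finite_index_subgroup {x \<in> H. \<phi> x \<in> A} G"
proof -
  have inj: "inj_on \<phi> H" and fi: "finite_index_subgroup (\<phi> ` H) G"
    using p by (auto simp: partial_isos_iff)
  have "restrict (inv_into H \<phi>) (\<phi> ` H) ` (A \<inter> \<phi> ` H) = {x \<in> H. \<phi> x \<in> A}"
    using inj by (force simp: image_iff)
  then show ?thesis
    using partial_iso_image[OF partial_iso_inverse[OF p] finite_index_Int[OF A fi]] by simp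
qed

lemma partial_comp_closed:
  assumes p: "p \<in> partial_isos G" and q: "q \<in> partial_isos G"
  shows "partial_comp p q \<in> partial_isos G"
proof -
  obtain K \<psi> H \<phi> where pq: "p = (K, \<psi>)" "q = (H, \<phi>)" by (cases p, cases q)
  note p = p[unfolded pq] and q = q[unfolded pq]
  let ?L = "{x \<in> H. \<phi> x \<in> K}"
  have K: "finite_index_subgroup K G" and H: "finite_index_subgroup H G"
    using p q by (auto simp: partial_isos_iff)
  have L: "finite_index_subgroup ?L G" by (rule partial_iso_vimage[OF q K])
  then have sL: "subgroup ?L G" by (simp add: finite_index_subgroup_def)
  have "finite_index_subgroup (\<psi> ` (\<phi> ` ?L)) G"
    using partial_iso_image[OF p partial_iso_image[OF q L]] by auto
  moreover have "(\<lambda>x\<in>?L. \<psi> (\<phi> x)) ` ?L = \<psi> ` (\<phi> ` ?L)" by (auto simp: image_iff)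
  moreover have "inj_on (\<lambda>x\<in>?L. \<psi> (\<phi> x)) ?L"
    using p q by (auto simp: partial_isos_iff inj_on_def)
  moreover have "(\<lambda>x\<in>?L. \<psi> (\<phi> x)) (x \<otimes> y) = (\<lambda>x\<in>?L. \<psi> (\<phi> x)) x \<otimes> (\<lambda>x\<in>?L. \<psi> (\<phi> x)) y"
    if "x \<in> ?L" "y \<in> ?L" for x y
    using subgroup.m_closed[OF sL that] that p q by (auto simp: partial_isos_iff)
  ultimately show ?thesis
    using L by (simp add: pq partial_isos_iff)
qed

lemma equiv_commensurate: "equiv (partial_isos G) (commensurate G)"
proof (rule equivI)
  show "commensurate G \<subseteq> partial_isos G \<times> partial_isos G"
    by (auto simp: commensurate_def)
  show "refl_on (partial_isos G) (commensurate G)"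
    by (rule refl_onI) (auto simp: commensurate_def partial_isos_iff)
  show "sym (commensurate G)"
    by (rule symI) (force simp: commensurate_def)
  show "trans (commensurate G)"
  proof (rule transI, clarify)
    fix H \<phi> K \<psi> M \<theta>
    assume a: "((H, \<phi>), (K, \<psi>)) \<in> commensurate G" "((K, \<psi>), (M, \<theta>)) \<in> commensurate G"
    obtain A where A: "finite_index_subgroup A G" "A \<subseteq> H \<inter> K" "\<forall>x\<in>A. \<phi> x = \<psi> x"
      using a(1) by (auto simp: commensurate_def)
    obtain B where B: "finite_index_subgroup B G" "B \<subseteq> K \<inter> M" "\<forall>x\<in>B. \<psi> x = \<theta> x"
      using a(2) by (auto simp: commensurate_def)
    have "A \<inter> B \<subseteq> H \<inter> M" "\<forall>x\<in>A \<inter> B. \<phi> x = \<theta> x" using A B by auto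
    then show "((H, \<phi>), (M, \<theta>)) \<in> commensurate G"
      using a finite_index_Int[OF A(1) B(1)] unfolding commensurate_def by blast
  qed
qed

lemma commensurateI:
  assumes "p \<in> partial_isos G" "q \<in> partial_isos G" "finite_index_subgroup L G"
    "L \<subseteq> fst p \<inter> fst q" "\<And>x. x \<in> L \<Longrightarrow> snd p x = snd q x"
  shows "(p, q) \<in> commensurate G"
  using assms by (cases p, cases q) (auto simp: commensurate_def)

lemma group_Comm: "group (Comm G)"
  unfolding Comm_def
proof (rule group_quotient_monoid[OF equiv_commensurate])
  show id: "(carrier G, \<lambda>x\<in>carrier G. x) \<in> partial_isos G"
    using finite_index_carrier by (auto simp: partial_isos_iff inj_on_def)
  show "partial_comp p q \<in> partial_isos G" if "p \<in> partial_isos G" "q \<in> partial_isos G" for p q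
    by (rule partial_comp_closed[OF that])
  have fst: "finite_index_subgroup (fst p) G" if "p \<in> partial_isos G" for p
    using that by (cases p) (auto simp: partial_isos_iff)
  show "(partial_comp (partial_comp p q) r, partial_comp p (partial_comp q r)) \<in> commensurate G"
    if "p \<in> partial_isos G" "q \<in> partial_isos G" "r \<in> partial_isos G" for p q r
  proof (rule commensurateI[where L = "fst (partial_comp (partial_comp p q) r)"])
    show "finite_index_subgroup (fst (partial_comp (partial_comp p q) r)) G"
      by (intro fst partial_comp_closed that)
  qed (auto intro!: partial_comp_closed that, (cases p, cases q, cases r, auto)+)
  show "(partial_comp (carrier G, \<lambda>x\<in>carrier G. x) p, p) \<in> commensurate G"
    if "p \<in> partial_isos G" for p
  proof (rule commensurateI[where L = "fst p"])
    show "fst p \<subseteq> fst (partial_comp (carrier G, \<lambda>x\<in>carrier G. x) p) \<inter> fst p"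
      using that partial_iso_closed(2) by (cases p) auto
    show "snd (partial_comp (carrier G, \<lambda>x\<in>carrier G. x) p) x = snd p x" if "x \<in> fst p" for x
      using that \<open>p \<in> partial_isos G\<close> partial_iso_closed(2) by (cases p) auto
  qed (use that id fst partial_comp_closed in auto)
  show "\<exists>q\<in>partial_isos G. (partial_comp q p, (carrier G, \<lambda>x\<in>carrier G. x)) \<in> commensurate G"
    if p: "p \<in> partial_isos G" for p
  proof -
    obtain H \<phi> where [simp]: "p = (H, \<phi>)" by (cases p)
    let ?q = "(\<phi> ` H, restrict (inv_into H \<phi>) (\<phi> ` H))"
    have q: "?q \<in> partial_isos G" using partial_iso_inverse p by simp
    have "(partial_comp ?q p, (carrier G, \<lambda>x\<in>carrier G. x)) \<in> commensurate G"
    proof (rule commensurateI[where L = H])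
      show "partial_comp ?q p \<in> partial_isos G" by (rule partial_comp_closed[OF q p])
      show "H \<subseteq> fst (partial_comp ?q p) \<inter> fst (carrier G, \<lambda>x\<in>carrier G. x)"
        using p partial_iso_closed(1) by auto
      show "snd (partial_comp ?q p) x = snd (carrier G, \<lambda>x\<in>carrier G. x) x" if "x \<in> H" for x
        using p that partial_iso_closed(1)[of H \<phi> x] by (auto simp: partial_isos_iff)
    qed (use id fst[OF p] in auto)
    then show ?thesis using q by blast
  qed
  fix p p' q q' assume pp: "(p, p') \<in> commensurate G" and qq: "(q, q') \<in> commensurate G"
  obtain K \<psi> K' \<psi>' H \<phi> H' \<phi>' where [simp]: "p = (K, \<psi>)" "p' = (K', \<psi>')" "q = (H, \<phi>)" "q' = (H', \<phi>')"
    by (cases p, cases p', cases q, cases q')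
  have mem: "p \<in> partial_isos G" "p' \<in> partial_isos G" "q \<in> partial_isos G" "q' \<in> partial_isos G"
    using pp qq by (auto simp: commensurate_def)
  obtain A where A: "finite_index_subgroup A G" "A \<subseteq> K \<inter> K'" "\<forall>x\<in>A. \<psi> x = \<psi>' x"
    using pp by (auto simp: commensurate_def)
  obtain B where B: "finite_index_subgroup B G" "B \<subseteq> H \<inter> H'" "\<forall>x\<in>B. \<phi> x = \<phi>' x"
    using qq by (auto simp: commensurate_def)
  show "(partial_comp p q, partial_comp p' q') \<in> commensurate G"
  proof (rule commensurateI[where L = "B \<inter> {x \<in> H. \<phi> x \<in> A}"])
    show "finite_index_subgroup (B \<inter> {x \<in> H. \<phi> x \<in> A}) G"
      using finite_index_Int[OF B(1) partial_iso_vimage[OF _ A(1)]] mem by simp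
  qed (use A B mem partial_comp_closed in auto)
qed

end

lemma self_QIs_iff: "f \<in> self_QIs M d \<longleftrightarrow> f \<in> extensional M \<and> f ` M \<subseteq> M \<and> 
     (\<exists>L\<ge>1. \<exists>C\<ge>0.
        (\<forall>x\<in>M. \<forall>y\<in>M. d x y / L - C \<le> d (f x) (f y) \<and> d (f x) (f y) \<le> L * d x y + C) \<and>
        (\<forall>z\<in>M. \<exists>x\<in>M. d z (f x) \<le> C))"
  by (auto simp: self_QIs_def quasi_isometry_def)

lemma self_QIsI:
  assumes "f \<in> extensional M" "\<And>x. x \<in> M \<Longrightarrow> f x \<in> M" "L \<ge> 1" "C \<ge> 0"
    "\<And>x y. x \<in> M \<Longrightarrow> y \<in> M \<Longrightarrow> d x y / L - C \<le> d (f x) (f y) \<and> d (f x) (f y) \<le> L * d x y + C"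
    "\<And>z. z \<in> M \<Longrightarrow> \<exists>x\<in>M. d z (f x) \<le> C"
  shows "f \<in> self_QIs M d"
  unfolding self_QIs_iff using assms by blast

lemma self_QI_compose:
  assumes "Metric_space M d" "f \<in> self_QIs M d" "g \<in> self_QIs M d"
  shows "compose M f g \<in> self_QIs M d"
proof -
  obtain L C where f: "f ` M \<subseteq> M" "L \<ge> 1" "C \<ge> 0"
    "\<And>x y. x \<in> M \<Longrightarrow> y \<in> M \<Longrightarrow> d x y / L - C \<le> d (f x) (f y) \<and> d (f x) (f y) \<le> L * d x y + C"
    "\<And>z. z \<in> M \<Longrightarrow> \<exists>x\<in>M. d z (f x) \<le> C"
    using assms(2) unfolding self_QIs_iff by blast
  obtain K D where g: "g ` M \<subseteq> M" "K \<ge> 1" "D \<ge> 0"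
    "\<And>x y. x \<in> M \<Longrightarrow> y \<in> M \<Longrightarrow> d x y / K - D \<le> d (g x) (g y) \<and> d (g x) (g y) \<le> K * d x y + D"
    "\<And>z. z \<in> M \<Longrightarrow> \<exists>x\<in>M. d z (g x) \<le> D"
    using assms(3) unfolding self_QIs_iff by blast
  have fM: "f x \<in> M" if "x \<in> M" for x using f(1) that by blast
  have gM: "g x \<in> M" if "x \<in> M" for x using g(1) that by blast
  let ?E = "L * D + 2 * C + D"
  have LD: "D \<le> L * D" "0 \<le> L * D" using f g mult_right_mono[of 1 L D] by auto
  have 1: "d x y / (L * K) - ?E \<le> d (f (g x)) (f (g y)) \<and> d (f (g x)) (f (g y)) \<le> (L * K) * d x y + ?E"
    if "x \<in> M" "y \<in> M" for x y
  proof
    have "(d x y / K - D) / L - C \<le> d (g x) (g y) / L - C" 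
      using g(4)[OF that] f(2) by (intro diff_right_mono divide_right_mono) auto
    also have "\<dots> \<le> d (f (g x)) (f (g y))" using f(4) gM that by auto
    finally have "d x y / (L * K) - D / L - C \<le> d (f (g x)) (f (g y))"
      by (simp add: diff_divide_distrib mult.commute)
    moreover have "D / L \<le> D" using f(2) g(3) divide_left_mono[of 1 L D] by simp
    ultimately show "d x y / (L * K) - ?E \<le> d (f (g x)) (f (g y))"
      using LD f(3) g(3) by linarith
    have "d (f (g x)) (f (g y)) \<le> L * d (g x) (g y) + C" using f(4) gM that by auto
    also have "\<dots> \<le> L * (K * d x y + D) + C"
      using g(4)[OF that] f(2) by (intro add_right_mono mult_left_mono) auto
    finally show "d (f (g x)) (f (g y)) \<le> (L * K) * d x y + ?E"
      using LD f(3) g(3) by (simp add: algebra_simps)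
  qed
  have 2: "\<exists>x\<in>M. d z (f (g x)) \<le> ?E" if z: "z \<in> M" for z
  proof -
    obtain y where y: "y \<in> M" "d z (f y) \<le> C" using f(5)[OF z] by blast
    obtain x where x: "x \<in> M" "d y (g x) \<le> D" using g(5)[OF y(1)] by blast
    have "d z (f (g x)) \<le> d z (f y) + d (f y) (f (g x))"
      using Metric_space.triangle[OF assms(1)] z x y fM gM by blast
    also have "d (f y) (f (g x)) \<le> L * d y (g x) + C" using f(4) y x gM by auto
    also have "L * d y (g x) \<le> L * D" using x(2) f(2) by (intro mult_left_mono) auto
    finally show ?thesis using y(2) x(1) f(3) g(3) by (intro bexI[of _ x]) auto
  qed
  have "L * K \<ge> 1" using f(2) g(2) mult_mono[of 1 L 1 K] by auto
  moreover have "?E \<ge> 0" using LD f g by auto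
  ultimately show ?thesis
    using 1 2 fM gM by (intro self_QIsI[of _ _ "L * K" ?E]) (auto simp: compose_def)
qed

lemma QI_inverse:
  assumes P: "Metric_space M d" and f: "f \<in> self_QIs M d"
  shows "\<exists>g\<in>self_QIs M d. \<exists>C. \<forall>x\<in>M. d (g (f x)) x \<le> C"
proof -
  obtain L C where f: "f ` M \<subseteq> M" "L \<ge> 1" "C \<ge> 0"
    "\<And>x y. x \<in> M \<Longrightarrow> y \<in> M \<Longrightarrow> d x y / L - C \<le> d (f x) (f y) \<and> d (f x) (f y) \<le> L * d x y + C"
    "\<And>z. z \<in> M \<Longrightarrow> \<exists>x\<in>M. d z (f x) \<le> C"
    using assms(2) unfolding self_QIs_iff by blast
  have fM: "f x \<in> M" if "x \<in> M" for x using f(1) that by blast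
  obtain g0 where g0: "\<And>z. z \<in> M \<Longrightarrow> g0 z \<in> M \<and> d z (f (g0 z)) \<le> C"
    using f(5) by metis
  define g where "g = restrict g0 M"
  have g: "g z \<in> M" "d z (f (g z)) \<le> C" "d (f (g z)) z \<le> C" if "z \<in> M" for z
    using g0[OF that] that Metric_space.commute[OF P, of z] by (auto simp: g_def)
  have tri: "d x z \<le> d x y + d y z" if "x\<in>M" "y\<in>M" "z\<in>M" for x y z
    using Metric_space.triangle[OF P] that by blast
  have inv: "d (g (f x)) x \<le> L * (2 * C)" if "x \<in> M" for x
  proof -
    have "d (g (f x)) x / L - C \<le> d (f (g (f x))) (f x)" using f(4) g fM that by auto
    also have "\<dots> \<le> C" using g fM that by auto
    finally show ?thesis using f(2) by (simp add: field_simps)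
  qed
  let ?E = "L * (3 * C)"
  have LC: "C \<le> L * C" "0 \<le> L * C" using f mult_right_mono[of 1 L C] by auto
  have 1: "d x y / L - ?E \<le> d (g x) (g y) \<and> d (g x) (g y) \<le> L * d x y + ?E"
    if "x \<in> M" "y \<in> M" for x y
  proof
    have a: "d x y \<le> d x (f (g x)) + d (f (g x)) (f (g y)) + d (f (g y)) y"
      using tri[of x "f (g x)" y] tri[of "f (g x)" "f (g y)" y] g(1) fM that by fastforce
    have b: "d (f (g x)) (f (g y)) \<le> d (f (g x)) x + d x y + d y (f (g y))"
      using tri[of "f (g x)" x "f (g y)"] tri[of x y "f (g y)"] g(1) fM that by fastforce
    have "d x y \<le> L * d (g x) (g y) + 3 * C"
      using a g[OF that(1)] g[OF that(2)] f(4)[of "g x" "g y"] by linarith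
    then have "d x y / L \<le> (L * d (g x) (g y) + 3 * C) / L" using f(2) by (intro divide_right_mono) auto
    also have "\<dots> = d (g x) (g y) + 3 * C / L" using f(2) by (simp add: field_simps)
    also have "3 * C / L \<le> ?E" 
      using f(2,3) LC divide_left_mono[of 1 L "3*C"] by simp
    finally show "d x y / L - ?E \<le> d (g x) (g y)" by simp
    have "d (g x) (g y) / L \<le> d x y + 3 * C"
      using b g[OF that(1)] g[OF that(2)] f(4)[of "g x" "g y"] by linarith
    then show "d (g x) (g y) \<le> L * d x y + ?E" using f(2) by (simp add: field_simps)
  qed
  have 2: "\<exists>x\<in>M. d z (g x) \<le> ?E" if "z \<in> M" for z
    using inv[OF that] fM[OF that] LC Metric_space.commute[OF P, of z] by (intro bexI[of _ "f z"]) auto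
  have "g \<in> extensional M" by (simp add: g_def)
  then have "g \<in> self_QIs M d"
    using 1 2 f(2) LC g(1) by (intro self_QIsI[of _ _ L ?E]) (auto simp: mult.commute)
  then show ?thesis using inv by blast
qed

lemma equiv_bounded_dist:
  assumes P: "Metric_space M d"
  shows "equiv (self_QIs M d) (bounded_dist M d)"
proof (rule equivI)
  show "bounded_dist M d \<subseteq> self_QIs M d \<times> self_QIs M d" by (auto simp: bounded_dist_def)
  have im: "f x \<in> M" if "f \<in> self_QIs M d" "x \<in> M" for f x
    using that by (auto simp: self_QIs_iff)
  show "refl_on (self_QIs M d) (bounded_dist M d)"
    using Metric_space.mdist_zero[OF P] im
    by (auto simp: refl_on_def bounded_dist_def intro!: exI[of _ 0])
  show "sym (bounded_dist M d)"
    unfolding sym_def bounded_dist_def using Metric_space.commute[OF P] by auto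
  show "trans (bounded_dist M d)"
  proof (rule transI)
    fix f g h assume fg: "(f, g) \<in> bounded_dist M d" and gh: "(g, h) \<in> bounded_dist M d"
    obtain C where C: "\<forall>x\<in>M. d (f x) (g x) \<le> C" using fg by (auto simp: bounded_dist_def)
    obtain D where D: "\<forall>x\<in>M. d (g x) (h x) \<le> D" using gh by (auto simp: bounded_dist_def)
    have "d (f x) (h x) \<le> C + D" if "x \<in> M" for x
    proof -
      have "d (f x) (h x) \<le> d (f x) (g x) + d (g x) (h x)"
        using Metric_space.triangle[OF P] fg gh im that by (auto simp: bounded_dist_def)
      then show ?thesis using C D that by force
    qed
    then show "(f, h) \<in> bounded_dist M d" using fg gh by (auto simp: bounded_dist_def)
  qed
qed

lemma group_QI:
  assumes P: "Metric_space M d"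
  shows "group (QI M d)"
  unfolding QI_def
proof (rule group_quotient_monoid[OF equiv_bounded_dist[OF P]])
  have im: "f x \<in> M" if "f \<in> self_QIs M d" "x \<in> M" for f x
    using that by (auto simp: self_QIs_iff)
  show id: "(\<lambda>x\<in>M. x) \<in> self_QIs M d"
    using Metric_space.mdist_zero[OF P] by (intro self_QIsI[of _ _ 1 0]) (auto intro!: bexI)
  show "compose M f g \<in> self_QIs M d" if "f \<in> self_QIs M d" "g \<in> self_QIs M d" for f g
    by (rule self_QI_compose[OF P that])
  have refl: "(f, f) \<in> bounded_dist M d" if "f \<in> self_QIs M d" for f
    using that equiv_bounded_dist[OF P] by (simp add: equiv_def refl_on_def)
  show "(compose M (compose M f g) h, compose M f (compose M g h)) \<in> bounded_dist M d"
    if "f \<in> self_QIs M d" "g \<in> self_QIs M d" "h \<in> self_QIs M d" for f g h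
  proof -
    have "h \<in> M \<rightarrow> M" using im[OF that(3)] by (rule funcsetI)
    then have "compose M (compose M f g) h = compose M f (compose M g h)"
      by (auto simp: compose_def fun_eq_iff restrict_def dest: funcset_mem)
    then show ?thesis using refl self_QI_compose[OF P] that by simp
  qed
  show "(compose M (\<lambda>x\<in>M. x) f, f) \<in> bounded_dist M d" if "f \<in> self_QIs M d" for f
  proof -
    have "compose M (\<lambda>x\<in>M. x) f = f"
    proof (rule Id_compose)
      show "f \<in> M \<rightarrow> M" using im[OF that] by (rule funcsetI)
      show "f \<in> extensional M" using that by (simp add: self_QIs_def)
    qed
    then show ?thesis using refl that by simp
  qed
  show "\<exists>g\<in>self_QIs M d. (compose M g f, \<lambda>x\<in>M. x) \<in> bounded_dist M d" if f: "f \<in> self_QIs M d" for f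
  proof -
    obtain g C where g: "g \<in> self_QIs M d" "\<forall>x\<in>M. d (g (f x)) x \<le> C"
      using QI_inverse[OF P f] by blast
    then show ?thesis
      using f id self_QI_compose[OF P g(1) f]
      by (intro bexI[of _ g]) (auto simp: bounded_dist_def compose_eq)
  qed
  fix f f' g g' assume ff: "(f, f') \<in> bounded_dist M d" and gg: "(g, g') \<in> bounded_dist M d"
  then have q: "f \<in> self_QIs M d" "f' \<in> self_QIs M d" "g \<in> self_QIs M d" "g' \<in> self_QIs M d"
    by (auto simp: bounded_dist_def)
  obtain D where D: "\<forall>x\<in>M. d (f x) (f' x) \<le> D" using ff by (auto simp: bounded_dist_def)
  obtain E where E: "\<forall>x\<in>M. d (g x) (g' x) \<le> E" using gg by (auto simp: bounded_dist_def)
  obtain L C where L: "L \<ge> 1" "\<And>x y. x \<in> M \<Longrightarrow> y \<in> M \<Longrightarrow> d (f x) (f y) \<le> L * d x y + C"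
    using q(1) unfolding self_QIs_iff by blast
  have "d (f (g x)) (f' (g' x)) \<le> L * E + C + D" if "x \<in> M" for x
  proof -
    have "d (f (g x)) (f' (g' x)) \<le> d (f (g x)) (f (g' x)) + d (f (g' x)) (f' (g' x))"
      by (rule Metric_space.triangle[OF P]) (use im q that in simp_all)
    also have "d (f (g x)) (f (g' x)) \<le> L * d (g x) (g' x) + C"
      by (rule L(2)) (use im q that in simp_all)
    also have "L * d (g x) (g' x) \<le> L * E" using L E that by (intro mult_left_mono) auto
    finally show ?thesis using bspec[OF D im[OF q(4) that]] by simp
  qed
  then show "(compose M f g, compose M f' g') \<in> bounded_dist M d"
    using self_QI_compose[OF P q(1,3)] self_QI_compose[OF P q(2,4)]
    by (auto simp: bounded_dist_def compose_eq)
qed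

context group
begin

definition is_word :: "'a set \<Rightarrow> 'a list \<Rightarrow> bool" where
  "is_word S xs \<longleftrightarrow> set xs \<subseteq> S \<union> m_inv G ` S"

lemma is_word_carrier: "S \<subseteq> carrier G \<Longrightarrow> is_word S xs \<Longrightarrow> set xs \<subseteq> carrier G"
  by (auto simp: is_word_def)

lemma foldr_mult_closed: "set xs \<subseteq> carrier G \<Longrightarrow> foldr (\<otimes>) xs \<one> \<in> carrier G"
  by (induction xs) auto

lemma foldr_mult_append:
  "set xs \<subseteq> carrier G \<Longrightarrow> set ys \<subseteq> carrier G \<Longrightarrow>
   foldr (\<otimes>) (xs @ ys) \<one> = foldr (\<otimes>) xs \<one> \<otimes> foldr (\<otimes>) ys \<one>"
  by (induction xs) (auto simp: m_assoc foldr_mult_closed simp del: foldr_append)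

lemma foldr_mult_inv:
  "set xs \<subseteq> carrier G \<Longrightarrow> foldr (\<otimes>) (rev (map (m_inv G) xs)) \<one> = inv (foldr (\<otimes>) xs \<one>)"
proof (induction xs)
  case (Cons x xs)
  have "foldr (\<otimes>) (rev (map (m_inv G) (x # xs))) \<one> = foldr (\<otimes>) (rev (map (m_inv G) xs) @ [inv x]) \<one>"
    by simp
  also have "\<dots> = foldr (\<otimes>) (rev (map (m_inv G) xs)) \<one> \<otimes> inv x"
    using Cons.prems by (subst foldr_mult_append) auto
  finally show ?case
    using Cons by (simp add: inv_mult_group foldr_mult_closed)
qed simp

lemma ex_word_if_generate:
  assumes S: "S \<subseteq> carrier G" and g: "g \<in> generate G S"
  shows "\<exists>xs. is_word S xs \<and> foldr (\<otimes>) xs \<one> = g"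
  using g
proof (induction rule: generate.induct)
  case one
  then show ?case by (intro exI[of _ "[]"]) (simp add: is_word_def)
next
  case (incl h)
  then show ?case using S by (intro exI[of _ "[h]"]) (auto simp: is_word_def)
next
  case (inv h)
  then show ?case using S by (intro exI[of _ "[inv h]"]) (auto simp: is_word_def)
next
  case (eng h1 h2)
  then obtain xs ys where "is_word S xs" "foldr (\<otimes>) xs \<one> = h1" "is_word S ys" "foldr (\<otimes>) ys \<one> = h2"
    by blast
  then show ?case
    using is_word_carrier[OF S] by (intro exI[of _ "xs @ ys"]) (simp add: is_word_def foldr_mult_append del: foldr_append)
qed

lemma word_length_le: "is_word S xs \<Longrightarrow> word_length G S (foldr (\<otimes>) xs \<one>) \<le> length xs"
  unfolding word_length_def is_word_def by (rule Least_le) blast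

lemma word_length_attained:
  assumes "S \<subseteq> carrier G" "g \<in> generate G S"
  shows "\<exists>xs. is_word S xs \<and> foldr (\<otimes>) xs \<one> = g \<and> length xs = word_length G S g"
proof -
  have "\<exists>n xs. length xs = n \<and> set xs \<subseteq> S \<union> m_inv G ` S \<and> foldr (\<otimes>) xs \<one> = g"
    using ex_word_if_generate[OF assms] by (auto simp: is_word_def)
  from LeastI_ex[OF this] show ?thesis
    unfolding word_length_def is_word_def by blast
qed

lemma Metric_space_word_metric:
  assumes S: "S \<subseteq> carrier G" and gen: "generate G S = carrier G"
  shows "Metric_space (carrier G) (word_metric G S)"
proof -
  note att = word_length_attained[OF S, unfolded gen]
  have inv_le: "word_length G S (inv g) \<le> word_length G S g" if g: "g \<in> carrier G" for g
  proof -
    obtain xs where xs: "is_word S xs" "foldr (\<otimes>) xs \<one> = g" "length xs = word_length G S g"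
      using att[OF g] by blast
    have "is_word S (rev (map (m_inv G) xs))"
      using xs(1) S by (force simp: is_word_def)
    from word_length_le[OF this] show ?thesis
      using xs foldr_mult_inv[OF is_word_carrier[OF S xs(1)]] by simp
  qed
  have inv_eq: "word_length G S (inv g) = word_length G S g" if "g \<in> carrier G" for g
    using inv_le[OF that] inv_le[of "inv g"] that by simp
  have mult_le: "word_length G S (g \<otimes> h) \<le> word_length G S g + word_length G S h"
    if gh: "g \<in> carrier G" "h \<in> carrier G" for g h
  proof -
    obtain xs where xs: "is_word S xs" "foldr (\<otimes>) xs \<one> = g" "length xs = word_length G S g"
      using att[OF gh(1)] by blast
    obtain ys where ys: "is_word S ys" "foldr (\<otimes>) ys \<one> = h" "length ys = word_length G S h"
      using att[OF gh(2)] by blast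
    have "is_word S (xs @ ys)"
      using xs(1) ys(1) by (simp add: is_word_def)
    from word_length_le[OF this] show ?thesis
      using xs ys is_word_carrier[OF S] by (simp add: foldr_mult_append del: foldr_append)
  qed
  have zero: "word_length G S g = 0 \<longleftrightarrow> g = \<one>" if "g \<in> carrier G" for g
    using att[OF that] word_length_le[of S "[]"] by (auto simp: is_word_def)
  show ?thesis
  proof
    show "word_metric G S x y = word_metric G S y x" for x y
      using inv_eq[of "inv x \<otimes> y"] by (auto simp: word_metric_def inv_mult_group)
    show "word_metric G S x y = 0 \<longleftrightarrow> x = y" if "x \<in> carrier G" "y \<in> carrier G" for x y
    proof -
      have "inv x \<otimes> y = \<one> \<longleftrightarrow> x = y"
        using that by (metis inv_closed inv_equality inv_inv l_inv)
      then show ?thesis using that zero[of "inv x \<otimes> y"] by (simp add: word_metric_def)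
    qed
    show "word_metric G S x z \<le> word_metric G S x y + word_metric G S y z"
      if "x \<in> carrier G" "y \<in> carrier G" "z \<in> carrier G" for x y z
    proof -
      have "(inv x \<otimes> y) \<otimes> (inv y \<otimes> z) = inv x \<otimes> z"
        using that by (metis inv_closed inv_solve_left m_assoc m_closed)
      then show ?thesis
        using mult_le[of "inv x \<otimes> y" "inv y \<otimes> z"] that by (simp add: word_metric_def)
    qed
  qed (simp add: word_metric_def)
qed

end

end

theory Submission
  imports Defs "HOL-Library.Function_Algebras"
begin

text \<open>
  Everything rests on two facts about \<open>G\<close>. First, roots in \<open>G\<close> are unique: \<open>G\<close> acts faithfully by
  unipotent operators on power series in partially commuting variables (the Magnus representation), and
  two unipotent operators with equal \<open>n\<close>-th powers agree. Second, there are non-adjacent vertices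
  \<open>v \<noteq> w\<close>, and nontrivial powers of \<open>v\<close> and \<open>w\<close> do not commute.

  Injectivity: some power of every \<open>g\<close> lies in a given finite index subgroup, so unique roots make an
  automorphism that is trivial there the identity. If a partial isomorphism \<open>\<phi>\<close> is at bounded
  distance from the identity, then \<open>\<phi>(g)\<^sup>-\<^sup>n g\<^sup>n\<close> takes finitely many values, so \<open>\<phi>(g)\<close> and \<open>g\<close>
  have a common power.

  Infinite index: \<open>G\<close> has the normal subgroup of elements of \<open>v\<close>-exponent zero, generated by the conjugates
  of the other vertices by \<open>v\<^sup>n\<close>. For a permutation \<open>\<pi>\<close> of the integers with bounded displacement,
  moving the conjugate by \<open>v\<^sup>n\<close> to that by \<open>v\<^sup>\<pi>\<^sup>(\<^sup>n\<^sup>)\<close> extends to a quasi-isometry of \<open>G\<close>.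
  It restricts to an automorphism of the subgroup of even exponent if \<open>\<pi>\<close> shifts the even integers by \<open>2j\<close>
  and fixes the odd ones, and this is an automorphism of \<open>G\<close> only for \<open>j = 0\<close>. It is at bounded
  distance from a commensuration only if its displacement is periodic, which excludes nontrivial
  permutations of finite support; the transpositions \<open>(0 c)\<close> give infinitely many cosets.
\<close>

section \<open>Words and actions\<close>

text \<open>A product of classes is a union of classes; once the quotient is known to be a group it is a class,
  so it is determined by any one of its elements.\<close>
lemma quotient_monoid_mult_class:
  assumes R: "equiv X R" and Q: "group (quotient_monoid X R f e)"
    and xy: "x \<in> X" "y \<in> X" "f x y \<in> X"
  shows "R `` {x} \<otimes>\<^bsub>quotient_monoid X R f e\<^esub> R `` {y} = R `` {f x y}" (is "?P = _")
proof -
  have "R `` {x} \<in> carrier (quotient_monoid X R f e)" "R `` {y} \<in> carrier (quotient_monoid X R f e)"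
    using xy by (simp_all add: quotient_monoid_def quotientI)
  then have "?P \<in> X // R"
    using monoid.m_closed[OF group.is_monoid[OF Q]] by (simp add: quotient_monoid_def)
  then obtain z where z: "z \<in> X" "?P = R `` {z}" by (rule quotientE)
  have "f x y \<in> ?P"
    using equiv_class_self[OF R] xy by (fastforce simp: quotient_monoid_def)
  then show ?thesis using equiv_class_eq[OF R] z(2) by simp
qed

definition word_class :: "'v pair_pre_digraph \<Rightarrow> ('v \<times> bool) list \<Rightarrow> ('v \<times> bool) list set" where
  "word_class \<Gamma> w = raag_rel \<Gamma> `` {w}"

abbreviation letter :: "'v pair_pre_digraph \<Rightarrow> 'v \<times> bool \<Rightarrow> ('v \<times> bool) list set" where
  "letter \<Gamma> l \<equiv> word_class \<Gamma> [l]"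

abbreviation gen :: "'v pair_pre_digraph \<Rightarrow> 'v \<Rightarrow> ('v \<times> bool) list set" where
  "gen \<Gamma> v \<equiv> letter \<Gamma> (v, True)"

locale artin_group =
  fixes \<Gamma> :: "'v pair_pre_digraph"
  assumes pair_graph_\<Gamma>: "pair_graph \<Gamma>"
begin

interpretation pair_graph \<Gamma> by (rule pair_graph_\<Gamma>)

lemma adj_sym: "(u, w) \<in> parcs \<Gamma> \<longleftrightarrow> (w, u) \<in> parcs \<Gamma>"
  using pair_sym_arcs by (auto simp: symmetric_def sym_def)

lemma adj_irrefl [simp]: "(u, u) \<notin> parcs \<Gamma>"
  using pair_no_loops by force

lemma adj_verts: "(u, w) \<in> parcs \<Gamma> \<Longrightarrow> u \<in> pverts \<Gamma> \<and> w \<in> pverts \<Gamma>"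
  using arc_fst_in_verts arc_snd_in_verts by force

sublocale group "raag \<Gamma>"
  by (rule group_raag)

abbreviation G where "G \<equiv> raag \<Gamma>"

lemma carrier_raag: "carrier G = word_class \<Gamma> ` raag_words \<Gamma>"
  by (auto simp: raag_def quotient_monoid_def quotient_def word_class_def)

lemma one_raag: "\<one>\<^bsub>G\<^esub> = word_class \<Gamma> []"
  by (simp add: raag_def quotient_monoid_def word_class_def)

lemma word_class_eq_iff:
  assumes "xs \<in> raag_words \<Gamma>" "ys \<in> raag_words \<Gamma>"
  shows "word_class \<Gamma> xs = word_class \<Gamma> ys \<longleftrightarrow> (xs, ys) \<in> raag_rel \<Gamma>"
  unfolding word_class_def using eq_equiv_class_iff[OF equiv_raag_rel assms] .

lemma word_class_append:
  assumes "xs \<in> raag_words \<Gamma>" "ys \<in> raag_words \<Gamma>"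
  shows "word_class \<Gamma> (xs @ ys) = word_class \<Gamma> xs \<otimes>\<^bsub>G\<^esub> word_class \<Gamma> ys"
  unfolding raag_def word_class_def
  using quotient_monoid_mult_class[OF equiv_raag_rel group_raag[unfolded raag_def] assms] assms
  by (simp add: raag_words_def)

lemma append_in_words: "xs \<in> raag_words \<Gamma> \<Longrightarrow> ys \<in> raag_words \<Gamma> \<Longrightarrow> xs @ ys \<in> raag_words \<Gamma>"
  by (simp add: raag_words_def)

lemma letter_closed [simp]: "fst l \<in> pverts \<Gamma> \<Longrightarrow> letter \<Gamma> l \<in> carrier G"
  by (cases l) (auto simp: carrier_raag raag_words_def)

lemma word_class_Cons:
  assumes "l # xs \<in> raag_words \<Gamma>"
  shows "word_class \<Gamma> (l # xs) = letter \<Gamma> l \<otimes>\<^bsub>G\<^esub> word_class \<Gamma> xs"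
  using word_class_append[of "[l]" xs] assms by (simp add: raag_words_def)

lemma letter_cancel:
  assumes "v \<in> pverts \<Gamma>"
  shows "letter \<Gamma> (v, b) \<otimes>\<^bsub>G\<^esub> letter \<Gamma> (v, \<not> b) = \<one>\<^bsub>G\<^esub>"
proof -
  have "([(v, b), (v, \<not> b)], []) \<in> raag_rel \<Gamma>"
    using raag_rel.raag_cancel[of "[]" \<Gamma> "[]" v b] assms by (simp add: raag_words_def)
  then have "word_class \<Gamma> [(v, b), (v, \<not> b)] = \<one>\<^bsub>G\<^esub>"
    by (subst one_raag, subst word_class_eq_iff) (use assms in \<open>auto simp: raag_words_def\<close>)
  then show ?thesis
    using assms by (subst (asm) word_class_Cons) (auto simp: raag_words_def)
qed

lemma letter_False:
  assumes "v \<in> pverts \<Gamma>"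
  shows "letter \<Gamma> (v, False) = inv\<^bsub>G\<^esub> gen \<Gamma> v"
  using letter_cancel[OF assms, of False] assms by (simp add: inv_equality)

lemma gen_commute:
  assumes "(u, w) \<in> parcs \<Gamma>"
  shows "gen \<Gamma> u \<otimes>\<^bsub>G\<^esub> gen \<Gamma> w = gen \<Gamma> w \<otimes>\<^bsub>G\<^esub> gen \<Gamma> u"
proof -
  have uw: "u \<in> pverts \<Gamma>" "w \<in> pverts \<Gamma>" using adj_verts[OF assms] by auto
  then have "([(u, True), (w, True)], [(w, True), (u, True)]) \<in> raag_rel \<Gamma>"
    using raag_rel.raag_commute[of "[]" \<Gamma> "[]" u w] assms by (simp add: raag_words_def)
  then have "word_class \<Gamma> [(u, True), (w, True)] = word_class \<Gamma> [(w, True), (u, True)]"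
    using uw by (subst word_class_eq_iff) (auto simp: raag_words_def)
  then show ?thesis
    using uw word_class_Cons[of "(u, True)" "[(w, True)]"] word_class_Cons[of "(w, True)" "[(u, True)]"]
    by (simp add: raag_words_def)
qed

lemma raag_induct [consumes 1, case_names one letter]:
  assumes "g \<in> carrier G" "P \<one>\<^bsub>G\<^esub>"
    and step: "\<And>l h. fst l \<in> pverts \<Gamma> \<Longrightarrow> h \<in> carrier G \<Longrightarrow> P h \<Longrightarrow> P (letter \<Gamma> l \<otimes>\<^bsub>G\<^esub> h)"
  shows "P g"
proof -
  have "P (word_class \<Gamma> xs)" if "xs \<in> raag_words \<Gamma>" for xs
    using that
  proof (induction xs)
    case (Cons l xs)
    then have "xs \<in> raag_words \<Gamma>" "fst l \<in> pverts \<Gamma>" by (auto simp: raag_words_def)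
    then show ?case using Cons step[of l "word_class \<Gamma> xs"] by (auto simp: word_class_Cons carrier_raag)
  qed (use assms(2) in \<open>simp add: one_raag\<close>)
  then show ?thesis using assms(1) by (auto simp: carrier_raag)
qed

end

text \<open>The choice of representative is harmless once \<open>foldr_L_cong\<close> holds. Folding
  from the right makes the last letter of a word act first, so that concatenation of words becomes
  composition.\<close>

definition raag_act :: "(('v \<times> bool) \<Rightarrow> 'x \<Rightarrow> 'x) \<Rightarrow> ('v \<times> bool) list set \<Rightarrow> 'x \<Rightarrow> 'x" where
  "raag_act L g x = foldr L (SOME w. w \<in> g) x"

text \<open>The universal property of the group: operators satisfying the defining relations give an
  action. The set \<open>X\<close> is explicit because one of the actions below lives on functions
  with values in the carrier only.\<close>

locale raag_action = artin_group \<Gamma> for \<Gamma> :: "'v pair_pre_digraph" +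
  fixes L :: "('v \<times> bool) \<Rightarrow> 'x \<Rightarrow> 'x" and X :: "'x set"
  assumes L_closed: "fst l \<in> pverts \<Gamma> \<Longrightarrow> x \<in> X \<Longrightarrow> L l x \<in> X"
    and L_cancel: "v \<in> pverts \<Gamma> \<Longrightarrow> x \<in> X \<Longrightarrow> L (v, b) (L (v, \<not> b) x) = x"
    and L_commute: "(u, w) \<in> parcs \<Gamma> \<Longrightarrow> x \<in> X \<Longrightarrow>
      L (u, True) (L (w, True) x) = L (w, True) (L (u, True) x)"
begin

lemma foldr_L_closed: "xs \<in> raag_words \<Gamma> \<Longrightarrow> x \<in> X \<Longrightarrow> foldr L xs x \<in> X"
  by (induction xs) (auto simp: raag_words_def L_closed)

lemma foldr_L_cong: "(xs, ys) \<in> raag_rel \<Gamma> \<Longrightarrow> x \<in> X \<Longrightarrow> foldr L xs x = foldr L ys x"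
proof (induction rule: raag_rel.induct)
  case (raag_commute xs ys u w)
  then show ?case by (simp add: L_commute[OF raag_commute(5) foldr_L_closed])
qed (simp_all add: L_cancel foldr_L_closed)

lemma act_word_class:
  assumes "xs \<in> raag_words \<Gamma>" "x \<in> X"
  shows "raag_act L (word_class \<Gamma> xs) x = foldr L xs x"
proof -
  have "(SOME w. w \<in> word_class \<Gamma> xs) \<in> word_class \<Gamma> xs"
    by (rule someI[of _ xs]) (use assms in \<open>auto simp: word_class_def intro: raag_rel.raag_refl\<close>)
  then have "(xs, SOME w. w \<in> word_class \<Gamma> xs) \<in> raag_rel \<Gamma>" by (simp add: word_class_def)
  from foldr_L_cong[OF this assms(2)] show ?thesis by (simp add: raag_act_def)
qed

lemma act_closed: "g \<in> carrier G \<Longrightarrow> x \<in> X \<Longrightarrow> raag_act L g x \<in> X"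
  by (auto simp: carrier_raag act_word_class foldr_L_closed)

lemma act_one: "x \<in> X \<Longrightarrow> raag_act L \<one>\<^bsub>G\<^esub> x = x"
  by (simp add: one_raag act_word_class raag_words_def)

lemma act_letter: "fst l \<in> pverts \<Gamma> \<Longrightarrow> x \<in> X \<Longrightarrow> raag_act L (letter \<Gamma> l) x = L l x"
  by (cases l) (simp add: act_word_class raag_words_def)

lemma act_mult:
  "g \<in> carrier G \<Longrightarrow> h \<in> carrier G \<Longrightarrow> x \<in> X \<Longrightarrow>
   raag_act L (g \<otimes>\<^bsub>G\<^esub> h) x = raag_act L g (raag_act L h x)"
  by (auto simp: carrier_raag word_class_append[symmetric] act_word_class foldr_L_closed append_in_words)

end

section \<open>Unipotent maps\<close>

text \<open>The sum of \<open>n\<close> copies of \<open>x\<close> is the multiple nx, so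
  \<open>V_torsion_free\<close> makes the quotients by the \<open>V d\<close> torsion-free;
  \<open>V_Inter\<close> makes the filtration separated.\<close>

locale filtration =
  fixes V :: "nat \<Rightarrow> 'a::ab_group_add set"
  assumes V_0: "V 0 = UNIV"
    and V_zero: "0 \<in> V d"
    and V_diff: "x \<in> V d \<Longrightarrow> y \<in> V d \<Longrightarrow> x - y \<in> V d"
    and V_Suc: "V (Suc d) \<subseteq> V d"
    and V_torsion_free: "0 < (n::nat) \<Longrightarrow> (\<Sum>i<n. x) \<in> V d \<Longrightarrow> x \<in> V d"
    and V_Inter: "(\<Inter>d. V d) = {0}"
begin

lemma V_minus: "x \<in> V d \<Longrightarrow> - x \<in> V d"
  using V_diff[OF V_zero, of x d] by simp

lemma V_add: "x \<in> V d \<Longrightarrow> y \<in> V d \<Longrightarrow> x + y \<in> V d"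
  using V_diff[OF _ V_minus, of x d y] by simp

text \<open>The second condition means that \<open>A\<close> induces the identity on each graded
  piece, the quotient of \<open>V d\<close> by \<open>V (Suc d)\<close>.\<close>

definition unipotent :: "('a \<Rightarrow> 'a) \<Rightarrow> bool" where
  "unipotent A \<longleftrightarrow> (\<forall>x y. A (x - y) = A x - A y) \<and> (\<forall>d. \<forall>x\<in>V d. A x - x \<in> V (Suc d))"

lemma unipotent_diff: "unipotent A \<Longrightarrow> A (x - y) = A x - A y"
  and unipotent_raise: "unipotent A \<Longrightarrow> x \<in> V d \<Longrightarrow> A x - x \<in> V (Suc d)"
  by (auto simp: unipotent_def)

lemma unipotent_closed: "unipotent A \<Longrightarrow> x \<in> V d \<Longrightarrow> A x \<in> V d"
  using V_add[of "A x - x" d x] unipotent_raise V_Suc by fastforce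

lemma unipotent_comp:
  assumes "unipotent A" "unipotent B"
  shows "unipotent (\<lambda>x. A (B x))"
proof -
  \<comment> \<open>Here AB - 1 is split as (A - 1)B + (B - 1).\<close>
  have "A (B x) - x \<in> V (Suc d)" if "x \<in> V d" for x d
    using V_add[OF unipotent_raise[OF assms(1) unipotent_closed[OF assms(2) that]]
        unipotent_raise[OF assms(2) that]] by simp
  then show ?thesis using assms by (auto simp: unipotent_def)
qed

lemma unipotent_id: "unipotent (\<lambda>x. x)"
  by (simp add: unipotent_def V_zero)

text \<open>If \<open>A - B\<close> raises the filtration by \<open>r\<close>, then modulo terms raising it by \<open>r + 1\<close> the difference
  of the \<open>n\<close>-th powers is \<open>n (A - B)\<close>; as the filtration has torsion-free quotients, \<open>A - B\<close>
  raises it by \<open>r + 1\<close>.\<close>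
lemma unipotent_roots:
  assumes A: "unipotent A" and B: "unipotent B" and n: "0 < n" and pow: "A ^^ n = B ^^ n"
  shows "A = B"
proof -
  have B_pow: "unipotent (B ^^ m)" for m
    by (induction m) (simp_all add: unipotent_id B unipotent_comp)
  have raise: "A x - B x \<in> V (d + r)" if "x \<in> V d" for x d r
    using that
  proof (induction r arbitrary: x d)
    case 0
    then show ?case using V_diff unipotent_closed A B by simp
  next
    case (Suc r)
    note IH = Suc.IH and x = Suc.prems
    have "(A ^^ m) x - (B ^^ m) x - (\<Sum>i<m. A x - B x) \<in> V (Suc (d + r))" for m
    proof (induction m)
      case 0
      then show ?case by (simp add: V_zero)
    next
      case (Suc m)
      let ?E = "(A ^^ m) x - (B ^^ m) x" and ?D = "\<Sum>i<m. A x - B x"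
      have D: "(\<Sum>i<k. A x - B x) \<in> V (d + r)" for k :: nat
        by (induction k) (auto simp: V_zero IH[OF x] intro!: V_add)
      have "?E \<in> V (d + r)"
        using V_add[OF subsetD[OF V_Suc Suc.IH] D[of m]] by simp
      then have 1: "A ?E - ?E \<in> V (Suc (d + r))"
        by (rule unipotent_raise[OF A])
      let ?y = "(B ^^ m) x - x"
      have "A ?y - B ?y \<in> V (Suc d + r)"
        by (rule IH) (rule unipotent_raise[OF B_pow x])
      then have 2: "A ?y - B ?y \<in> V (Suc (d + r))" by simp
      have eq: "(A ^^ Suc m) x - (B ^^ Suc m) x - (\<Sum>i<Suc m. A x - B x)
        = (A ?E - ?E) + (A ?y - B ?y) + (?E - ?D)"
        by (simp add: unipotent_diff[OF A] unipotent_diff[OF B])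
      show ?case unfolding eq by (rule V_add[OF V_add[OF 1 2] Suc.IH])
    qed
    from this[of n] have "(\<Sum>i<n. A x - B x) \<in> V (Suc (d + r))"
      using V_minus[of "- (\<Sum>i<n. A x - B x)"] by (simp add: pow)
    then show ?case using V_torsion_free[OF n] by simp
  qed
  have "A x = B x" for x
  proof -
    have "A x - B x \<in> V d" for d using raise[of x 0 d] by (simp add: V_0)
    then have "A x - B x \<in> (\<Inter>d. V d)" by blast
    then show ?thesis by (simp add: V_Inter)
  qed
  then show ?thesis by blast
qed

end

section \<open>The Magnus action\<close>

text \<open>A list of vertices stands for a monomial in partially commuting variables, and an integer-valued
  function on lists for a formal power series; \<open>shift v\<close> is multiplication by the variable \<open>v\<close> from the
  left, and the generator \<open>v\<close> acts as multiplication by \<open>1 + v\<close>.\<close>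

fun peel :: "'v pair_pre_digraph \<Rightarrow> 'v \<Rightarrow> 'v list \<Rightarrow> 'v list option" where
  "peel \<Gamma> v [] = None"
| "peel \<Gamma> v (x # xs) =
     (if x = v then Some xs
      else if (x, v) \<in> parcs \<Gamma> then map_option ((#) x) (peel \<Gamma> v xs) else None)"

text \<open>\<open>peel\<close> divides a monomial by \<open>v\<close> from the left, so the
  coefficient of vF at a monomial is that of F at the quotient. Coefficients are indexed by plain
  lists, with no invariance under commutation imposed on \<open>F\<close>; commutation enters only
  through \<open>peel\<close>.\<close>

definition shift :: "'v pair_pre_digraph \<Rightarrow> 'v \<Rightarrow> ('v list \<Rightarrow> int) \<Rightarrow> 'v list \<Rightarrow> int" where
  "shift \<Gamma> v F xs = (case peel \<Gamma> v xs of None \<Rightarrow> 0 | Some ys \<Rightarrow> F ys)"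

lemma length_peel: "peel \<Gamma> v xs = Some ys \<Longrightarrow> length xs = Suc (length ys)"
  by (induction xs arbitrary: ys) (auto split: if_splits)

text \<open>The inverse of 1 + v, that is, the alternating geometric series in \<open>v\<close>; its
  value at a list is a finite sum because peeling shortens the list.\<close>

function unshift :: "'v pair_pre_digraph \<Rightarrow> 'v \<Rightarrow> ('v list \<Rightarrow> int) \<Rightarrow> 'v list \<Rightarrow> int" where
  "unshift \<Gamma> v F xs =
     F xs - (case peel \<Gamma> v xs of None \<Rightarrow> 0 | Some ys \<Rightarrow> unshift \<Gamma> v F ys)"
  by auto
termination
  by (relation "measure (\<lambda>(\<Gamma>, v, F, xs). length xs)") (auto dest: length_peel)

declare unshift.simps [simp del]

lemma unshift_eq: "unshift \<Gamma> v F = F - shift \<Gamma> v (unshift \<Gamma> v F)"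
  by (rule ext, subst unshift.simps) (simp add: shift_def)

lemma shift_unshift_cancel: "unshift \<Gamma> v F + shift \<Gamma> v (unshift \<Gamma> v F) = F"
  using unshift_eq[of \<Gamma> v F] by (simp add: eq_diff_eq)

lemma shift_diff: "shift \<Gamma> v (F - F') = shift \<Gamma> v F - shift \<Gamma> v F'"
  by (rule ext) (simp add: shift_def split: option.split)

lemma shift_add: "shift \<Gamma> v (F + F') = shift \<Gamma> v F + shift \<Gamma> v F'"
  by (rule ext) (simp add: shift_def split: option.split)

lemma unshift_shift_cancel: "unshift \<Gamma> v (F + shift \<Gamma> v F) = F"
proof
  show "unshift \<Gamma> v (F + shift \<Gamma> v F) xs = F xs" for xs
  proof (induction "length xs" arbitrary: xs rule: less_induct)
    case less
    then show ?case
      by (subst unshift.simps) (auto simp: shift_def length_peel split: option.split)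
  qed
qed

text \<open>The inverse of an additive bijection is additive: both sides solve X + vX = F -
  F'.\<close>

lemma unshift_diff: "unshift \<Gamma> v (F - F') = unshift \<Gamma> v F - unshift \<Gamma> v F'"
proof -
  let ?U = "unshift \<Gamma> v F - unshift \<Gamma> v F'"
  have "F - F' = ?U + shift \<Gamma> v ?U"
    using shift_unshift_cancel[of \<Gamma> v F] shift_unshift_cancel[of \<Gamma> v F']
    by (metis add_diff_add shift_diff)
  then show ?thesis by (simp add: unshift_shift_cancel)
qed

definition magnus :: "'v pair_pre_digraph \<Rightarrow> 'v \<times> bool \<Rightarrow> ('v list \<Rightarrow> int) \<Rightarrow> 'v list \<Rightarrow> int" where
  "magnus \<Gamma> l F = (if snd l then F + shift \<Gamma> (fst l) F else unshift \<Gamma> (fst l) F)"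

lemma magnus_simps:
  "magnus \<Gamma> (v, True) F = F + shift \<Gamma> v F" "magnus \<Gamma> (v, False) F = unshift \<Gamma> v F"
  by (simp_all add: magnus_def)

definition vanishing :: "nat \<Rightarrow> ('v list \<Rightarrow> int) set" where
  "vanishing d = {F. \<forall>xs. length xs < d \<longrightarrow> F xs = 0}"

interpretation filtration "vanishing :: nat \<Rightarrow> ('v list \<Rightarrow> int) set"
proof
  show "(\<Inter>d. vanishing d) = {0 :: 'v list \<Rightarrow> int}"
    by (fastforce simp: vanishing_def fun_eq_iff)
next
  fix n d :: nat and F :: "'v list \<Rightarrow> int"
  assume "0 < n" "(\<Sum>i<n. F) \<in> vanishing d"
  moreover have "(\<Sum>i<m. F) xs = int m * F xs" for xs m
    by (induction m) (simp_all add: algebra_simps)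
  ultimately show "F \<in> vanishing d" by (simp add: vanishing_def)
qed (auto simp: vanishing_def)

lemma shift_vanishing: "F \<in> vanishing d \<Longrightarrow> shift \<Gamma> v F \<in> vanishing (Suc d)"
  by (auto simp: vanishing_def shift_def dest: length_peel split: option.split)

lemma unshift_vanishing:
  assumes "F \<in> vanishing d"
  shows "unshift \<Gamma> v F \<in> vanishing d"
proof -
  have "length xs < d \<longrightarrow> unshift \<Gamma> v F xs = 0" for xs
  proof (induction "length xs" arbitrary: xs rule: less_induct)
    case less
    then show ?case
      using assms by (subst unshift.simps) (auto simp: vanishing_def length_peel split: option.split)
  qed
  then show ?thesis by (simp add: vanishing_def)
qed

text \<open>Subtracting 1 from 1 + v leaves multiplication by \<open>v\<close>, which raises the
  degree. For the inverse, \<open>unshift_eq\<close> gives the difference as minus \<open>v\<close>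
  times a series that vanishes to the same order.\<close>

lemma unipotent_magnus: "unipotent (magnus \<Gamma> l)"
proof (cases "snd l")
  case True
  then show ?thesis by (auto simp: unipotent_def magnus_def shift_diff shift_vanishing)
next
  case False
  have "unshift \<Gamma> v F - F \<in> vanishing (Suc d)" if "F \<in> vanishing d" for v and F :: "'a list \<Rightarrow> int" and d
    using V_minus[OF shift_vanishing[OF unshift_vanishing[OF that], of \<Gamma> v \<Gamma> v]]
    by (subst unshift_eq) simp
  with False show ?thesis by (auto simp: unipotent_def magnus_def unshift_diff)
qed

text \<open>Two copies of \<open>v\<close> separated only by neighbours of \<open>v\<close> could be
  brought together. So these are the monomials in which commutations never produce a square of a
  variable.\<close>

definition square_free :: "'v pair_pre_digraph \<Rightarrow> 'v list \<Rightarrow> bool" where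
  "square_free \<Gamma> xs \<longleftrightarrow>
     (\<nexists>as v bs cs. xs = as @ v # bs @ v # cs \<and> (\<forall>u\<in>set bs. (u, v) \<in> parcs \<Gamma>))"

lemma (in group) commutes_int_pow:
  assumes "x \<otimes> y = y \<otimes> x" "x \<in> carrier G" "y \<in> carrier G"
  shows "x [^] (i::int) \<otimes> y = y \<otimes> x [^] i"
proof (cases i rule: int_cases2)
  case (nonneg n)
  then show ?thesis using group_commutes_pow[OF assms] by (simp add: int_pow_int)
next
  case (nonpos n)
  have "x [^] n \<otimes> y = y \<otimes> x [^] n" by (rule group_commutes_pow[OF assms])
  then have "inv (x [^] n) \<otimes> y = y \<otimes> inv (x [^] n)"
    using assms(2,3) by (metis inv_closed inv_solve_left inv_solve_right m_assoc m_closed nat_pow_closed)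
  then show ?thesis using nonpos assms by (simp add: int_pow_neg_int)
qed

context artin_group
begin

text \<open>The two quotients agree even as lists. A first letter equal to \<open>u\<close> or
  \<open>w\<close> is passed over by the other division because \<open>u\<close> and
  \<open>w\<close> are adjacent; a different first letter is kept by both divisions or makes both
  sides \<open>None\<close>.\<close>

lemma peel_commute:
  "(u, w) \<in> parcs \<Gamma> \<Longrightarrow>
   Option.bind (peel \<Gamma> u xs) (peel \<Gamma> w) = Option.bind (peel \<Gamma> w xs) (peel \<Gamma> u)"
proof (induction xs)
  case (Cons x xs)
  have neq: "u \<noteq> w" "(w, u) \<in> parcs \<Gamma>" using Cons.prems adj_sym by auto
  have *: "Option.bind (map_option ((#) x) a) (\<lambda>ys. peel \<Gamma> v ys)
    = map_option ((#) x) (Option.bind a (peel \<Gamma> v))" if "x \<noteq> v" "(x, v) \<in> parcs \<Gamma>" for a v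
    using that by (cases a) auto
  have **: "Option.bind (map_option ((#) x) a) (\<lambda>ys. peel \<Gamma> v ys) = None"
    if "x \<noteq> v" "(x, v) \<notin> parcs \<Gamma>" for a v
    using that by (cases a) auto
  have ***: "Option.bind (map_option ((#) v) a) (\<lambda>ys. peel \<Gamma> v ys) = a" for a v
    by (cases a) auto
  show ?case
    using Cons neq by (auto simp: * ** ***)
qed simp

lemma shift_shift:
  "shift \<Gamma> u (shift \<Gamma> w F) xs =
   (case Option.bind (peel \<Gamma> u xs) (peel \<Gamma> w) of None \<Rightarrow> 0 | Some ys \<Rightarrow> F ys)"
  by (auto simp: shift_def split: option.split)

sublocale magnus: raag_action \<Gamma> "magnus \<Gamma>" UNIV
proof
  fix u w and F :: "'v list \<Rightarrow> int" assume "(u, w) \<in> parcs \<Gamma>"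
  then have "shift \<Gamma> u (shift \<Gamma> w F) = shift \<Gamma> w (shift \<Gamma> u F)"
    by (intro ext) (simp add: shift_shift peel_commute[of u w])
  then show "magnus \<Gamma> (u, True) (magnus \<Gamma> (w, True) F) = magnus \<Gamma> (w, True) (magnus \<Gamma> (u, True) F)"
    by (simp add: magnus_simps shift_add algebra_simps)
next
  fix v b and F :: "'v list \<Rightarrow> int"
  show "magnus \<Gamma> (v, b) (magnus \<Gamma> (v, \<not> b) F) = F"
    by (cases b) (simp_all add: magnus_simps unshift_shift_cancel shift_unshift_cancel)
qed auto

abbreviation M where "M \<equiv> raag_act (magnus \<Gamma>)"

lemma M_unipotent: "g \<in> carrier G \<Longrightarrow> unipotent (M g)"
proof (induction rule: raag_induct)
  case one
  have "M \<one>\<^bsub>G\<^esub> = (\<lambda>x. x)" by (rule ext) (simp add: magnus.act_one)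
  then show ?case by (simp add: unipotent_id)
next
  case (letter l h)
  have "M (letter \<Gamma> l \<otimes>\<^bsub>G\<^esub> h) = (\<lambda>x. magnus \<Gamma> l (M h x))"
    by (rule ext) (use letter in \<open>simp add: magnus.act_mult magnus.act_letter\<close>)
  then show ?case by (simp add: unipotent_comp[OF unipotent_magnus letter(3)])
qed

lemma M_nat_pow: "g \<in> carrier G \<Longrightarrow> M (g [^]\<^bsub>G\<^esub> (n::nat)) = M g ^^ n"
proof (induction n)
  case 0
  show ?case by (rule ext) (simp add: magnus.act_one)
next
  case (Suc n)
  have "M (g [^]\<^bsub>G\<^esub> n \<otimes>\<^bsub>G\<^esub> g) = M g ^^ n \<circ> M g"
    by (rule ext) (use Suc in \<open>simp add: magnus.act_mult\<close>)
  then show ?case by (simp add: funpow_Suc_right del: funpow.simps)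
qed

section \<open>Square-free monomials and syllable forms\<close>

lemma peel_SomeD:
  "peel \<Gamma> v xs = Some ys \<Longrightarrow> \<exists>p q. xs = p @ v # q \<and> ys = p @ q \<and> (\<forall>u\<in>set p. (u, v) \<in> parcs \<Gamma>)"
proof (induction xs arbitrary: ys)
  case (Cons x xs)
  show ?case
  proof (cases "x = v")
    case True
    then show ?thesis using Cons.prems by (intro exI[of _ "[]"] exI[of _ xs]) auto
  next
    case False
    then obtain zs where zs: "(x, v) \<in> parcs \<Gamma>" "peel \<Gamma> v xs = Some zs" "ys = x # zs"
      using Cons.prems by (auto split: if_splits)
    obtain p q where "xs = p @ v # q" "zs = p @ q" "\<forall>u\<in>set p. (u, v) \<in> parcs \<Gamma>"
      using Cons.IH[OF zs(2)] by blast
    then show ?thesis using zs by (intro exI[of _ "x # p"] exI[of _ q]) auto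
  qed
qed simp

lemma square_freeD:
  "square_free \<Gamma> (as @ v # bs @ v # cs) \<Longrightarrow> \<exists>u\<in>set bs. (u, v) \<notin> parcs \<Gamma>"
  unfolding square_free_def by blast

text \<open>Putting \<open>v\<close> back into \<open>ys\<close> turns a violation there into one in
  \<open>xs\<close>; when \<open>v\<close> lands between the two copies of \<open>x\<close>, the
  first copy lies in \<open>p\<close>, hence is adjacent to \<open>v\<close>. A second division by
  \<open>v\<close> would exhibit two copies of \<open>v\<close> with only neighbours of
  \<open>v\<close> between them.\<close>

lemma square_free_peel:
  assumes sf: "square_free \<Gamma> xs" and ys: "peel \<Gamma> v xs = Some ys"
  shows "square_free \<Gamma> ys" and "peel \<Gamma> v ys = None"
proof -
  obtain p q where pq: "xs = p @ v # q" "ys = p @ q" "\<forall>u\<in>set p. (u, v) \<in> parcs \<Gamma>"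
    using peel_SomeD[OF ys] by blast
  show "peel \<Gamma> v ys = None"
  proof (rule ccontr)
    assume "peel \<Gamma> v ys \<noteq> None"
    then obtain zs where "peel \<Gamma> v ys = Some zs" by blast
    then obtain p' q' where p': "p @ q = p' @ v # q'" "\<forall>u\<in>set p'. (u, v) \<in> parcs \<Gamma>"
      using peel_SomeD[of v ys zs] pq by auto
    have "v \<notin> set p" using pq(3) by auto
    then obtain p'' where "p' = p @ p''" "q = p'' @ v # q'"
      using p'(1) by (auto simp: append_eq_append_conv2 append_eq_Cons_conv)
    then show False
      using square_freeD[of p v p'' q'] sf pq p'(2) by auto
  qed
  show "square_free \<Gamma> ys"
    unfolding square_free_def
  proof clarify
    fix as x bs cs
    assume eq: "ys = as @ x # bs @ x # cs" and bs: "\<forall>u\<in>set bs. (u, x) \<in> parcs \<Gamma>"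
    have "p @ q = as @ x # bs @ x # cs" using eq pq by simp
    then consider (1) q' where "p = as @ x # bs @ x # q'" "cs = q' @ q"
      | (2) b1 b2 where "p = as @ x # b1" "bs = b1 @ b2" "q = b2 @ x # cs"
      | (3) a2 where "as = p @ a2" "q = a2 @ x # bs @ x # cs"
      by (auto simp: append_eq_append_conv2 append_eq_Cons_conv Cons_eq_append_conv)
    then show False
    proof cases
      case 1
      then show False using square_freeD[of as x bs "q' @ v # q"] sf pq bs by auto
    next
      case 2
      then have "(v, x) \<in> parcs \<Gamma>" using pq(3) adj_sym by auto
      then show False using square_freeD[of as x "b1 @ v # b2" cs] sf pq bs 2 by auto
    next
      case 3
      then show False using square_freeD[of "p @ v # a2" x bs cs] sf pq bs by auto
    qed
  qed
qed

text \<open>These are the terms of degree at most one of (1 + v)^e = 1 + ev + ..., for negative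
  \<open>e\<close> as well; the higher terms contribute nothing at a monomial that is not divisible
  by the square of \<open>v\<close>.\<close>

lemma M_gen_pow:
  fixes e :: int
  assumes v: "v \<in> pverts \<Gamma>"
  shows "peel \<Gamma> v xs = None \<Longrightarrow> M (gen \<Gamma> v [^]\<^bsub>G\<^esub> e) F xs = F xs"
    and "peel \<Gamma> v xs = Some ys \<Longrightarrow> peel \<Gamma> v ys = None \<Longrightarrow>
      M (gen \<Gamma> v [^]\<^bsub>G\<^esub> e) F xs = F xs + e * F ys"
proof -
  let ?P = "\<lambda>e. M (gen \<Gamma> v [^]\<^bsub>G\<^esub> (e::int))"
  have cl: "gen \<Gamma> v \<in> carrier G" using v by simp
  have up: "?P (e + 1) F = magnus \<Gamma> (v, True) (?P e F)" for e F
  proof -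
    have "gen \<Gamma> v [^]\<^bsub>G\<^esub> (e + 1) = gen \<Gamma> v \<otimes>\<^bsub>G\<^esub> gen \<Gamma> v [^]\<^bsub>G\<^esub> e"
      using int_pow_mult[OF cl, of 1 e] cl by (simp add: add.commute)
    then show ?thesis using cl v by (simp add: magnus.act_mult magnus.act_letter)
  qed
  have down: "?P (e - 1) F = magnus \<Gamma> (v, False) (?P e F)" for e F
    using up[of "e - 1" F] by (simp add: magnus_simps unshift_shift_cancel)
  have none: "?P e F xs = F xs" if "peel \<Gamma> v xs = None" for xs F e
  proof (induction e rule: int_induct[where k = 0])
    case base
    show ?case by (simp add: magnus.act_one)
  next
    case (step1 e)
    then show ?case using that by (simp add: up magnus_simps shift_def)
  next
    case (step2 e)
    then show ?case using that by (simp add: down magnus_simps unshift.simps[of _ _ _ xs])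
  qed
  have some: "?P e F xs = F xs + e * F ys" if "peel \<Gamma> v xs = Some ys" "peel \<Gamma> v ys = None" for ys e
  proof (induction e rule: int_induct[where k = 0])
    case base
    show ?case by (simp add: magnus.act_one)
  next
    case (step1 e)
    have "?P e F ys = F ys" by (rule none[OF that(2)])
    then show ?case using that step1 by (simp add: up magnus_simps shift_def distrib_right)
  next
    case (step2 e)
    have "?P e F ys = F ys" by (rule none[OF that(2)])
    then show ?case
      using that step2
      by (simp add: down magnus_simps unshift.simps[of _ _ _ xs] unshift.simps[of _ _ _ ys] left_diff_distrib)
  qed
  show "peel \<Gamma> v xs = None \<Longrightarrow> ?P e F xs = F xs"
    by (rule none)
  show "peel \<Gamma> v xs = Some ys \<Longrightarrow> peel \<Gamma> v ys = None \<Longrightarrow> ?P e F xs = F xs + e * F ys"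
    by (rule some)
qed


definition syllables :: "('v \<times> int) list \<Rightarrow> ('v \<times> bool) list set" where
  "syllables ss = foldr (\<lambda>(v, e) g. gen \<Gamma> v [^]\<^bsub>G\<^esub> e \<otimes>\<^bsub>G\<^esub> g) ss \<one>\<^bsub>G\<^esub>"

lemma syllables_simps [simp]:
  "syllables [] = \<one>\<^bsub>G\<^esub>"
  "syllables ((v, e) # ss) = gen \<Gamma> v [^]\<^bsub>G\<^esub> e \<otimes>\<^bsub>G\<^esub> syllables ss"
  by (simp_all add: syllables_def)

lemma syllables_closed [simp]: "fst ` set ss \<subseteq> pverts \<Gamma> \<Longrightarrow> syllables ss \<in> carrier G"
  by (induction ss) auto

lemma syllables_append:
  "fst ` set (ss @ ts) \<subseteq> pverts \<Gamma> \<Longrightarrow> syllables (ss @ ts) = syllables ss \<otimes>\<^bsub>G\<^esub> syllables ts"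
proof (induction ss)
  case (Cons s ss)
  then show ?case by (cases s) (simp add: m_assoc image_Un)
qed (simp add: image_Un)

definition monomial_one :: "'v list \<Rightarrow> int" where
  "monomial_one xs = (if xs = [] then 1 else 0)"

text \<open>By \<open>M_gen_pow\<close> each syllable accounts for at most one letter of a
  square-free monomial.\<close>

lemma M_syllables_long:
  "fst ` set ss \<subseteq> pverts \<Gamma> \<Longrightarrow> square_free \<Gamma> xs \<Longrightarrow> length ss < length xs \<Longrightarrow>
   M (syllables ss) monomial_one xs = 0"
proof (induction ss arbitrary: xs)
  case Nil
  then show ?case by (simp add: magnus.act_one monomial_one_def)
next
  case (Cons s ss)
  obtain v e where s: "s = (v, e)" by (cases s)
  have cl: "v \<in> pverts \<Gamma>" "fst ` set ss \<subseteq> pverts \<Gamma>" using Cons.prems s by auto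
  have IH: "M (syllables ss) monomial_one xs = 0"
    by (rule Cons.IH) (use Cons.prems cl in auto)
  have IH': "M (syllables ss) monomial_one ys = 0" if "peel \<Gamma> v xs = Some ys" for ys
    by (rule Cons.IH)
      (use Cons.prems cl that square_free_peel(1) in \<open>auto dest: length_peel\<close>)
  show ?case
    using cl IH IH' square_free_peel(2)[OF Cons.prems(2)]
    by (cases "peel \<Gamma> v xs") (simp_all add: s magnus.act_mult M_gen_pow)
qed

lemma square_free_tl: "square_free \<Gamma> (v # xs) \<Longrightarrow> square_free \<Gamma> xs"
  using square_free_peel(1)[of "v # xs" v xs] by simp

text \<open>Now every syllable must account for exactly one letter and contributes its exponent as a
  factor. The term in which the first syllable contributes no letter is killed by
  \<open>M_syllables_long\<close>.\<close>

lemma M_syllables_square_free: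
  "fst ` set ss \<subseteq> pverts \<Gamma> \<Longrightarrow> square_free \<Gamma> (map fst ss) \<Longrightarrow>
   M (syllables ss) monomial_one (map fst ss) = prod_list (map snd ss)"
proof (induction ss)
  case Nil
  then show ?case by (simp add: magnus.act_one monomial_one_def)
next
  case (Cons s ss)
  obtain v e where s: "s = (v, e)" by (cases s)
  have cl: "v \<in> pverts \<Gamma>" "fst ` set ss \<subseteq> pverts \<Gamma>" using Cons.prems s by auto
  have "M (syllables ss) monomial_one (v # map fst ss) = 0"
    by (rule M_syllables_long) (use Cons.prems s cl in auto)
  moreover have "peel \<Gamma> v (map fst ss) = None"
    using square_free_peel(2)[OF Cons.prems(2), of v] s by simp
  ultimately show ?case
    using Cons cl square_free_tl[of v "map fst ss"] by (simp add: s magnus.act_mult M_gen_pow)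
qed

lemma ex_syllables:
  assumes "g \<in> carrier G"
  shows "\<exists>ss. fst ` set ss \<subseteq> pverts \<Gamma> \<and> syllables ss = g"
  using assms
proof (induction rule: raag_induct)
  case one
  show ?case by (intro exI[of _ "[]"]) simp
next
  case (letter l h)
  obtain v b where l: "l = (v, b)" by (cases l)
  obtain ss where ss: "fst ` set ss \<subseteq> pverts \<Gamma>" "syllables ss = h" using letter by blast
  have "letter \<Gamma> l = gen \<Gamma> v [^]\<^bsub>G\<^esub> (if b then 1 else - 1 :: int)"
    using letter(1) by (simp add: l letter_False int_pow_neg)
  then show ?case
    using ss letter(1) by (intro exI[of _ "(v, if b then 1 else - 1) # ss"]) (auto simp: l)
qed

lemma gen_pow_commute_syllables:
  assumes v: "v \<in> pverts \<Gamma>" and ss: "\<forall>u\<in>fst ` set ss. (u, v) \<in> parcs \<Gamma>"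
  shows "gen \<Gamma> v [^]\<^bsub>G\<^esub> (e::int) \<otimes>\<^bsub>G\<^esub> syllables ss = syllables ss \<otimes>\<^bsub>G\<^esub> gen \<Gamma> v [^]\<^bsub>G\<^esub> e"
  using ss
proof (induction ss)
  case Nil
  then show ?case using v by simp
next
  case (Cons s ss)
  obtain u f where s: "s = (u, f)" by (cases s)
  have uv: "(u, v) \<in> parcs \<Gamma>" "u \<in> pverts \<Gamma>" and cl: "syllables ss \<in> carrier G"
    using Cons.prems adj_verts by (auto simp: s intro!: syllables_closed)
  let ?u = "gen \<Gamma> u [^]\<^bsub>G\<^esub> f" and ?v = "gen \<Gamma> v [^]\<^bsub>G\<^esub> e"
  have "?v \<otimes>\<^bsub>G\<^esub> ?u = ?u \<otimes>\<^bsub>G\<^esub> ?v"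
    using commutes_int_pow[OF commutes_int_pow[OF gen_commute[OF uv(1)], symmetric]] uv v by simp
  then have "?v \<otimes>\<^bsub>G\<^esub> (?u \<otimes>\<^bsub>G\<^esub> syllables ss) = ?u \<otimes>\<^bsub>G\<^esub> (?v \<otimes>\<^bsub>G\<^esub> syllables ss)"
    using uv v cl by (simp flip: m_assoc)
  then show ?case
    using Cons uv v cl by (simp add: s m_assoc)
qed

text \<open>A shortest syllable form has square-free support, and the coefficient of its support in the
  Magnus expansion is the product of its exponents.\<close>
lemma M_faithful:
  assumes g: "g \<in> carrier G" and id: "\<And>F. M g F = F"
  shows "g = \<one>\<^bsub>G\<^esub>"
proof -
  define Q where "Q ss \<longleftrightarrow> fst ` set ss \<subseteq> pverts \<Gamma> \<and> syllables ss = g" for ss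
  obtain ss where ss: "Q ss" and min: "\<And>ts. Q ts \<Longrightarrow> length ss \<le> length ts"
    using ex_syllables[OF g] ex_has_least_nat[of Q _ length] unfolding Q_def by metis
  have nz: "e \<noteq> 0" if in_ss: "(v, e) \<in> set ss" for v e
  proof
    assume e: "e = 0"
    obtain as bs where eq: "ss = as @ (v, e) # bs" using split_list[OF in_ss] by blast
    have "v \<in> pverts \<Gamma>" "fst ` set as \<subseteq> pverts \<Gamma>" "fst ` set bs \<subseteq> pverts \<Gamma>"
      using ss by (auto simp: Q_def eq)
    then have "Q (as @ bs)" using ss by (simp add: Q_def eq e syllables_append image_Un)
    from min[OF this] show False by (simp add: eq)
  qed
  have "square_free \<Gamma> (map fst ss)"
    unfolding square_free_def
  proof clarify
    fix as v bs cs
    assume "map fst ss = as @ v # bs @ v # cs" and bs: "\<forall>u\<in>set bs. (u, v) \<in> parcs \<Gamma>"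
    then obtain as' e bs' f cs' where eq: "ss = as' @ (v, e) # bs' @ (v, f) # cs'" "map fst bs' = bs"
      by (clarsimp simp: map_eq_append_conv map_eq_Cons_conv append_eq_map_conv Cons_eq_map_conv)
    have cl: "v \<in> pverts \<Gamma>" "fst ` set as' \<subseteq> pverts \<Gamma>" "fst ` set bs' \<subseteq> pverts \<Gamma>"
      "fst ` set cs' \<subseteq> pverts \<Gamma>"
      using ss by (auto simp: Q_def eq)
    have "gen \<Gamma> v [^]\<^bsub>G\<^esub> f \<otimes>\<^bsub>G\<^esub> syllables bs' = syllables bs' \<otimes>\<^bsub>G\<^esub> gen \<Gamma> v [^]\<^bsub>G\<^esub> f"
      by (rule gen_pow_commute_syllables[OF cl(1)]) (use bs eq(2) in force)
    \<comment> \<open>The second power of \<open>v\<close> moves up to the first and merges with it,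
      which saves a syllable.\<close>
    then have "syllables (bs' @ (v, f) # cs') = syllables ((v, f) # bs' @ cs')"
      using cl by (simp add: syllables_append image_Un flip: m_assoc)
    then have "syllables ((v, e) # bs' @ (v, f) # cs') = syllables ((v, e + f) # bs' @ cs')"
      using cl by (simp add: int_pow_mult m_assoc image_Un)
    then have "Q (as' @ (v, e + f) # bs' @ cs')"
      using ss cl by (simp add: Q_def eq syllables_append[of as'] image_Un)
    from min[OF this] show False by (simp add: eq)
  qed
  then have "M g monomial_one (map fst ss) = prod_list (map snd ss)"
    using M_syllables_square_free ss by (auto simp: Q_def)
  moreover have "prod_list (map snd ss) \<noteq> 0"
    using nz by (auto simp: prod_list_zero_iff)
  ultimately have "ss = []"
    by (auto simp: id monomial_one_def split: if_splits)
  then show ?thesis using ss by (simp add: Q_def)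
qed

theorem raag_unique_roots:
  assumes xy: "x \<in> carrier G" "y \<in> carrier G" and n: "0 < n"
    and pow: "x [^]\<^bsub>G\<^esub> (n::nat) = y [^]\<^bsub>G\<^esub> n"
  shows "x = y"
proof -
  have "M x ^^ n = M y ^^ n"
    using M_nat_pow[OF xy(1), of n] M_nat_pow[OF xy(2), of n] pow by simp
  then have eq: "M x = M y"
    by (rule unipotent_roots[OF M_unipotent[OF xy(1)] M_unipotent[OF xy(2)] n])
  have "M (x \<otimes>\<^bsub>G\<^esub> inv\<^bsub>G\<^esub> y) F = F" for F
    using xy eq by (simp add: magnus.act_mult) (simp add: magnus.act_one flip: magnus.act_mult)
  then have "x \<otimes>\<^bsub>G\<^esub> inv\<^bsub>G\<^esub> y = \<one>\<^bsub>G\<^esub>"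
    using M_faithful xy by simp
  then show ?thesis using xy by (metis inv_closed inv_equality inv_inv)
qed

text \<open>The monomial vw has coefficient ab in the expansion of v^a w^b, and 0 in that of w^b v^a
  because non-adjacency prevents a left division of vw by \<open>w\<close>.\<close>

lemma gen_pow_commute_iff:
  assumes vw: "v \<in> pverts \<Gamma>" "w \<in> pverts \<Gamma>" "v \<noteq> w" "(v, w) \<notin> parcs \<Gamma>"
    and comm: "gen \<Gamma> v [^]\<^bsub>G\<^esub> (a::int) \<otimes>\<^bsub>G\<^esub> gen \<Gamma> w [^]\<^bsub>G\<^esub> (b::int) =
      gen \<Gamma> w [^]\<^bsub>G\<^esub> b \<otimes>\<^bsub>G\<^esub> gen \<Gamma> v [^]\<^bsub>G\<^esub> a"
  shows "a = 0 \<or> b = 0"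
proof -
  have sf: "square_free \<Gamma> [v, w]"
    using vw by (auto simp: square_free_def Cons_eq_append_conv)
  have "M (syllables [(v, a), (w, b)]) monomial_one [v, w] = a * b"
    using M_syllables_square_free[of "[(v, a), (w, b)]"] sf vw by simp
  moreover have "M (syllables [(w, b), (v, a)]) monomial_one [v, w] = 0"
    using vw M_syllables_long[of "[(v, a)]" "[v, w]"] sf
    by (simp add: magnus.act_mult M_gen_pow)
  ultimately show ?thesis using comm vw by simp
qed

end

section \<open>Commensurations and quasi-isometries of a finitely generated group\<close>

context group
begin

text \<open>Used for both images: infinite index is reduced to an infinite family lying in distinct
  right cosets. The unit in \<open>I\<close> places each \<open>q i\<close> in its own
  coset.\<close>

lemma infinite_rcosets:
  assumes I: "\<one> \<in> I" and A: "infinite A" and q: "\<And>i. i \<in> A \<Longrightarrow> q i \<in> carrier G"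
    and sep: "\<And>i j a. i \<in> A \<Longrightarrow> j \<in> A \<Longrightarrow> a \<in> I \<Longrightarrow> q i = a \<otimes> q j \<Longrightarrow> i = j"
  shows "infinite (rcosets I)"
proof
  have "inj_on (\<lambda>i. I #> q i) A"
  proof (rule inj_onI)
    fix i j assume ij: "i \<in> A" "j \<in> A" and eq: "I #> q i = I #> q j"
    have "q i \<in> I #> q i" using I q[OF ij(1)] by (force simp: r_coset_def)
    then obtain a where "a \<in> I" "q i = a \<otimes> q j" using eq by (auto simp: r_coset_def)
    then show "i = j" using sep ij by blast
  qed
  moreover assume "finite (rcosets I)"
  moreover have "(\<lambda>i. I #> q i) ` A \<subseteq> rcosets I" using q by (auto simp: RCOSETS_def)
  ultimately show False using A by (meson finite_subset finite_imageD)
qed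

text \<open>Two powers of \<open>g\<close> lie in the same coset by the pigeonhole principle, and
  their quotient is the required power.\<close>

lemma pow_in_finite_index:
  assumes L: "finite_index_subgroup L G" and g: "g \<in> carrier G"
  shows "\<exists>n>0. g [^] (n::nat) \<in> L"
proof -
  have sL: "subgroup L G" and fin: "finite (rcosets L)"
    using L by (auto simp: finite_index_subgroup_def)
  have "finite (range (\<lambda>n::nat. L #> g [^] n))"
    using g by (intro finite_subset[OF _ fin]) (auto simp: RCOSETS_def)
  then have "\<not> inj (\<lambda>n::nat. L #> g [^] n)"
    by (auto dest: finite_imageD)
  then obtain m n :: nat where "L #> g [^] m = L #> g [^] n" "m \<noteq> n"
    unfolding inj_def by blast
  then obtain m n :: nat where mn: "L #> g [^] m = L #> g [^] n" "m < n"
    by (metis nat_neq_iff)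
  have "g [^] n \<in> L #> g [^] m" using rcos_self[OF _ sL, of "g [^] n"] g mn by simp
  then obtain l where l: "l \<in> L" "g [^] n = l \<otimes> g [^] m" by (auto simp: r_coset_def)
  have "g [^] (n - m) \<otimes> g [^] m = g [^] n" using mn(2) g by (simp add: nat_pow_mult)
  then have "g [^] (n - m) = l"
    using l g subgroup.mem_carrier[OF sL] by (metis nat_pow_closed right_cancel)
  then show ?thesis using l(1) mn(2) by (intro exI[of _ "n - m"]) auto
qed

lemma Comm_mult:
  assumes "p \<in> partial_isos G" "q \<in> partial_isos G"
  shows "commensurate G `` {p} \<otimes>\<^bsub>Comm G\<^esub> commensurate G `` {q} = commensurate G `` {partial_comp p q}"
  unfolding Comm_def
  by (rule quotient_monoid_mult_class[where f = partial_comp, OF equiv_commensurate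
        group_Comm[unfolded Comm_def] assms partial_comp_closed[OF assms]])

lemma partial_iso_pow:
  assumes p: "(H, \<phi>) \<in> partial_isos G" and x: "x \<in> H"
  shows "x [^] (n::nat) \<in> H \<and> \<phi> (x [^] n) = \<phi> x [^] n"
proof (induction n)
  case 0
  have sH: "subgroup H G" and m: "\<And>x y. x \<in> H \<Longrightarrow> y \<in> H \<Longrightarrow> \<phi> (x \<otimes> y) = \<phi> x \<otimes> \<phi> y"
    using p by (auto simp: partial_isos_iff finite_index_subgroup_def)
  have one: "\<one> \<in> H" by (rule subgroup.one_closed[OF sH])
  then have "\<phi> \<one> \<otimes> \<phi> \<one> = \<phi> \<one>" using m[of \<one> \<one>] by simp
  then show ?case using one partial_iso_closed(2)[OF p one] by (simp add: r_cancel_one')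
next
  case (Suc n)
  then show ?case
    using p x by (auto simp: partial_isos_iff finite_index_subgroup_def intro: subgroup.m_closed)
qed

lemma auto_partial_iso: "\<alpha> \<in> auto G \<Longrightarrow> (carrier G, \<alpha>) \<in> partial_isos G"
  using finite_index_carrier by (auto simp: partial_isos_iff auto_def Bij_def bij_betw_def hom_def)

lemma Aut_to_Comm_hom: "Aut_to_Comm G \<in> hom (AutoGroup G) (Comm G)"
proof (rule homI)
  note iso = auto_partial_iso
  show "Aut_to_Comm G \<alpha> \<in> carrier (Comm G)" if "\<alpha> \<in> carrier (AutoGroup G)" for \<alpha>
    using that iso by (auto simp: Aut_to_Comm_def Comm_def quotient_monoid_def AutoGroup_def quotientI)
  fix \<alpha> \<beta> assume "\<alpha> \<in> carrier (AutoGroup G)" "\<beta> \<in> carrier (AutoGroup G)"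
  then have ab: "\<alpha> \<in> auto G" "\<beta> \<in> auto G" by (auto simp: AutoGroup_def)
  then have "\<alpha> \<otimes>\<^bsub>AutoGroup G\<^esub> \<beta> = compose (carrier G) \<alpha> \<beta>"
    by (simp add: AutoGroup_def BijGroup_def auto_def)
  moreover have "partial_comp (carrier G, \<alpha>) (carrier G, \<beta>) = (carrier G, compose (carrier G) \<alpha> \<beta>)"
  proof -
    have "{x \<in> carrier G. \<beta> x \<in> carrier G} = carrier G"
      using ab by (auto simp: auto_def hom_def)
    then show ?thesis by (simp add: compose_def)
  qed
  moreover note Comm_mult[OF iso[OF ab(1)] iso[OF ab(2)]]
  ultimately show "Aut_to_Comm G (\<alpha> \<otimes>\<^bsub>AutoGroup G\<^esub> \<beta>) = Aut_to_Comm G \<alpha> \<otimes>\<^bsub>Comm G\<^esub> Aut_to_Comm G \<beta>"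
    by (simp only: Aut_to_Comm_def)
qed

end

lemma QI_mult:
  assumes P: "Metric_space M d" and fg: "f \<in> self_QIs M d" "g \<in> self_QIs M d"
  shows "bounded_dist M d `` {f} \<otimes>\<^bsub>QI M d\<^esub> bounded_dist M d `` {g} = bounded_dist M d `` {compose M f g}"
  unfolding QI_def
  by (rule quotient_monoid_mult_class[where f = "compose M", OF equiv_bounded_dist[OF P]
        group_QI[OF P, unfolded QI_def] fg self_QI_compose[OF P fg]])

section \<open>The word metric of a finitely generated group\<close>

locale generated_group = group G for G (structure) +
  fixes S :: "'a set"
  assumes finite_S: "finite S" and S_carrier: "S \<subseteq> carrier G" and generate_S: "generate G S = carrier G"
begin

abbreviation d where "d \<equiv> word_metric G S"

lemma Metric_space_d: "Metric_space (carrier G) d"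
  by (rule Metric_space_word_metric[OF S_carrier generate_S])

lemma d_nonneg: "0 \<le> d x y" and d_commute: "d x y = d y x"
  using Metric_space.nonneg[OF Metric_space_d] Metric_space.commute[OF Metric_space_d] by auto

lemma d_refl: "x \<in> carrier G \<Longrightarrow> d x x = 0"
  using Metric_space.mdist_zero[OF Metric_space_d] by auto

lemma d_triangle:
  "x \<in> carrier G \<Longrightarrow> y \<in> carrier G \<Longrightarrow> z \<in> carrier G \<Longrightarrow> d x z \<le> d x y + d y z"
  using Metric_space.triangle[OF Metric_space_d] by auto

lemma d_translate:
  assumes "g \<in> carrier G" "x \<in> carrier G" "y \<in> carrier G"
  shows "d (g \<otimes> x) (g \<otimes> y) = d x y"
proof -
  have "inv (g \<otimes> x) \<otimes> (g \<otimes> y) = inv x \<otimes> (inv g \<otimes> (g \<otimes> y))"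
    using assms by (simp add: inv_mult_group m_assoc)
  also have "\<dots> = inv x \<otimes> y" using assms by (simp flip: m_assoc)
  finally show ?thesis using assms by (simp add: word_metric_def)
qed

lemma d_quotient: "x \<in> carrier G \<Longrightarrow> y \<in> carrier G \<Longrightarrow> d \<one> (inv x \<otimes> y) = d x y"
  using d_translate[of x \<one> "inv x \<otimes> y"] by (simp flip: m_assoc)

text \<open>Over a finite alphabet there are finitely many words of bounded length. This finiteness
  later gives uniform constants and pigeonhole arguments.\<close>

lemma finite_ball: "finite {g \<in> carrier G. d \<one> g \<le> C}"
proof -
  let ?T = "S \<union> m_inv G ` S"
  have "{g \<in> carrier G. d \<one> g \<le> C} \<subseteq>
    (\<lambda>xs. foldr (\<otimes>) xs \<one>) ` {xs. set xs \<subseteq> ?T \<and> length xs \<le> nat \<lfloor>C\<rfloor>}"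
  proof
    fix g assume g: "g \<in> {g \<in> carrier G. d \<one> g \<le> C}"
    then obtain xs where xs: "is_word S xs" "foldr (\<otimes>) xs \<one> = g" "length xs = word_length G S g"
      using word_length_attained[OF S_carrier, of g] generate_S by auto
    have "real (length xs) \<le> C" using g xs(3) by (auto simp: word_metric_def)
    then have "length xs \<le> nat \<lfloor>C\<rfloor>" by (simp add: le_nat_floor)
    then show "g \<in> (\<lambda>xs. foldr (\<otimes>) xs \<one>) ` {xs. set xs \<subseteq> ?T \<and> length xs \<le> nat \<lfloor>C\<rfloor>}"
      using xs by (auto simp: is_word_def)
  qed
  moreover have "finite {xs. set xs \<subseteq> ?T \<and> length xs \<le> nat \<lfloor>C\<rfloor>}"
    using finite_S by (intro finite_lists_length_le) auto
  ultimately show ?thesis by (meson finite_subset finite_imageI)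
qed

lemma finite_imp_bounded:
  assumes "finite A"
  shows "\<exists>C\<ge>0. \<forall>a\<in>A. d x a \<le> C"
  using assms
proof (induction A)
  case (insert a A)
  then obtain C where "0 \<le> C" "\<forall>a\<in>A. d x a \<le> C" by blast
  then show ?case by (intro exI[of _ "max C (d x a)"]) auto
qed auto

text \<open>The path from \<open>x\<close> to \<open>y\<close> spelled by a shortest word for
  \<open>inv x \<otimes> y\<close> is followed one letter at a time.\<close>

lemma lipschitz_if_local:
  assumes f: "\<And>x. x \<in> carrier G \<Longrightarrow> f x \<in> carrier G"
    and loc: "\<And>x s. x \<in> carrier G \<Longrightarrow> s \<in> carrier G \<Longrightarrow> d \<one> s \<le> 1 \<Longrightarrow> d (f x) (f (x \<otimes> s)) \<le> L"
    and xy: "x \<in> carrier G" "y \<in> carrier G"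
  shows "d (f x) (f y) \<le> L * d x y"
proof -
  have L: "0 \<le> L" using order_trans[OF d_nonneg loc[of \<one> \<one>]] by (simp add: d_refl)
  have word: "d (f x) (f (x \<otimes> foldr (\<otimes>) xs \<one>)) \<le> L * length xs"
    if "is_word S xs" "x \<in> carrier G" for xs x
    using that
  proof (induction xs arbitrary: x)
    case Nil
    then show ?case by (simp add: d_refl f)
  next
    case (Cons s xs)
    have w: "is_word S [s]" "is_word S xs" using Cons.prems(1) by (auto simp: is_word_def)
    have s: "s \<in> carrier G" and xs: "foldr (\<otimes>) xs \<one> \<in> carrier G"
      using is_word_carrier[OF S_carrier w(1)] foldr_mult_closed[OF is_word_carrier[OF S_carrier w(2)]]
      by auto
    have "d \<one> s \<le> 1" using word_length_le[OF w(1)] s by (simp add: word_metric_def)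
    then have 1: "d (f x) (f (x \<otimes> s)) \<le> L" using loc s Cons.prems(2) by blast
    have 2: "d (f (x \<otimes> s)) (f ((x \<otimes> s) \<otimes> foldr (\<otimes>) xs \<one>)) \<le> L * length xs"
      using Cons.IH[OF w(2)] Cons.prems(2) s by simp
    have "d (f x) (f (x \<otimes> (s \<otimes> foldr (\<otimes>) xs \<one>)))
        \<le> d (f x) (f (x \<otimes> s)) + d (f (x \<otimes> s)) (f (x \<otimes> (s \<otimes> foldr (\<otimes>) xs \<one>)))"
      using Cons.prems(2) s xs by (intro d_triangle f) auto
    then show ?case using 1 2 Cons.prems(2) s xs by (simp add: m_assoc algebra_simps)
  qed
  obtain xs where xs: "is_word S xs" "foldr (\<otimes>) xs \<one> = inv x \<otimes> y"
      "length xs = word_length G S (inv x \<otimes> y)"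
    using word_length_attained[OF S_carrier, of "inv x \<otimes> y"] generate_S xy by auto
  have "x \<otimes> (inv x \<otimes> y) = y" using xy by (simp flip: m_assoc)
  then show ?thesis using word[OF xs(1) xy(1)] xs xy by (simp add: word_metric_def)
qed

text \<open>The lower bound comes from applying \<open>g\<close> to the images and correcting by
  \<open>C\<close> at both ends; \<open>g\<close> also supplies coarse preimages. The maximum with 1
  is taken because the multiplicative constant of a quasi-isometry has to be at least 1.\<close>

lemma self_QI_if_inverse:
  assumes f: "\<And>x. x \<in> carrier G \<Longrightarrow> f x \<in> carrier G" and g: "\<And>x. x \<in> carrier G \<Longrightarrow> g x \<in> carrier G"
    and f_lip: "\<And>x y. x \<in> carrier G \<Longrightarrow> y \<in> carrier G \<Longrightarrow> d (f x) (f y) \<le> K * d x y"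
    and g_lip: "\<And>x y. x \<in> carrier G \<Longrightarrow> y \<in> carrier G \<Longrightarrow> d (g x) (g y) \<le> K' * d x y"
    and gf: "\<And>x. x \<in> carrier G \<Longrightarrow> d (g (f x)) x \<le> C"
    and fg: "\<And>x. x \<in> carrier G \<Longrightarrow> d (f (g x)) x \<le> C"
  shows "restrict f (carrier G) \<in> self_QIs (carrier G) d"
proof (rule self_QIsI[where L = "max 1 (max K K')" and C = "2 * C"])
  let ?L = "max 1 (max K K')"
  have C: "0 \<le> C" using order_trans[OF d_nonneg gf[of \<one>]] by simp
  show "0 \<le> 2 * C" using C by simp
  show "d x y / ?L - 2 * C \<le> d (restrict f (carrier G) x) (restrict f (carrier G) y) \<and>
      d (restrict f (carrier G) x) (restrict f (carrier G) y) \<le> ?L * d x y + 2 * C"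
    if xy: "x \<in> carrier G" "y \<in> carrier G" for x y
  proof
    have "d x y \<le> d x (g (f x)) + d (g (f x)) (g (f y)) + d (g (f y)) y"
      using d_triangle[of x "g (f x)" y] d_triangle[of "g (f x)" "g (f y)" y] f g xy by fastforce
    also have "\<dots> \<le> C + K' * d (f x) (f y) + C"
      using gf[OF xy(1)] gf[OF xy(2)] g_lip[OF f[OF xy(1)] f[OF xy(2)]] by (simp add: d_commute[of x])
    also have "K' * d (f x) (f y) \<le> ?L * d (f x) (f y)"
      by (intro mult_right_mono d_nonneg) auto
    finally have "d x y \<le> ?L * d (f x) (f y) + 2 * C" by simp
    also have "2 * C \<le> ?L * (2 * C)" using C mult_right_mono[of 1 ?L "2 * C"] by simp
    finally have "d x y \<le> ?L * (d (f x) (f y) + 2 * C)" by (simp add: distrib_left)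
    then have "d x y / ?L \<le> d (f x) (f y) + 2 * C" by (subst pos_divide_le_eq) (auto simp: mult.commute)
    then show "d x y / ?L - 2 * C \<le> d (restrict f (carrier G) x) (restrict f (carrier G) y)"
      using xy by simp
    have "d (f x) (f y) \<le> ?L * d x y"
      by (rule order_trans[OF f_lip[OF xy]], rule mult_right_mono[OF _ d_nonneg]) simp
    then show "d (restrict f (carrier G) x) (restrict f (carrier G) y) \<le> ?L * d x y + 2 * C"
      using xy C by simp
  qed
  show "\<exists>x\<in>carrier G. d z (restrict f (carrier G) x) \<le> 2 * C" if z: "z \<in> carrier G" for z
    using fg[OF z] g[OF z] C by (intro bexI[of _ "g z"]) (auto simp: d_commute[of z])
qed (use f in auto)

section \<open>Coarse retractions and induced quasi-isometries\<close>

lemma ex_coarse_retraction: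
  assumes H: "finite_index_subgroup H G"
  shows "\<exists>r\<in>coarse_retractions G S H. \<forall>h\<in>H. r h = h"
proof -
  obtain F where F: "finite F" "F \<subseteq> carrier G" "carrier G \<subseteq> (\<Union>f\<in>F. H #> f)" and sH: "subgroup H G"
    using H unfolding finite_index_subgroup_iff_cover by blast
  obtain C where C: "0 \<le> C" "\<forall>f\<in>F. d \<one> f \<le> C" using finite_imp_bounded[OF F(1)] by blast
  have near: "\<exists>h\<in>H. d x h \<le> C" if x: "x \<in> carrier G" for x
  proof -
    obtain f h where fh: "f \<in> F" "h \<in> H" "x = h \<otimes> f" using F(3) x by (force simp: r_coset_def)
    \<comment> \<open>Right cosets fit the left-invariant metric: multiplying by \<open>f\<close> on
      the right moves every point by the same distance.\<close>
    have "d h (h \<otimes> f) = d \<one> f"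
      using d_translate[of h \<one> f] fh F(2) subgroup.mem_carrier[OF sH] by auto
    then show ?thesis using fh C(2) by (intro bexI[of _ h]) (auto simp: d_commute[of _ h])
  qed
  \<comment> \<open>Fixing the points of \<open>H\<close> makes the map induced by a partial
    isomorphism an extension of it.\<close>
  define r where "r x = (if x \<in> H then x else SOME h. h \<in> H \<and> d x h \<le> C)" for x
  have "r x \<in> H \<and> d x (r x) \<le> C" if x: "x \<in> carrier G" for x
  proof (cases "x \<in> H")
    case True
    then show ?thesis using x C(1) by (simp add: r_def d_refl)
  next
    case False
    have "\<exists>h. h \<in> H \<and> d x h \<le> C" using near[OF x] by blast
    from someI_ex[OF this] show ?thesis using False by (simp add: r_def)
  qed
  then have "r \<in> coarse_retractions G S H" by (auto simp: coarse_retractions_def)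
  then show ?thesis by (rule bexI[rotated]) (simp add: r_def)
qed

lemma coarse_retractionD:
  assumes "r \<in> coarse_retractions G S H"
  shows "\<exists>C\<ge>0. \<forall>x\<in>carrier G. r x \<in> H \<and> d x (r x) \<le> C"
proof -
  obtain C where C: "\<forall>x\<in>carrier G. d x (r x) \<le> C" "r ` carrier G \<subseteq> H"
    using assms by (auto simp: coarse_retractions_def)
  then have "0 \<le> C" using order_trans[OF d_nonneg, of \<one> "r \<one>" C] by auto
  then show ?thesis using C by (intro exI[of _ C]) auto
qed

lemma coarse_retraction_mono: "r \<in> coarse_retractions G S L \<Longrightarrow> L \<subseteq> H \<Longrightarrow> r \<in> coarse_retractions G S H"
  by (auto simp: coarse_retractions_def)

text \<open>Right multiplication of \<open>x\<close> by a short element changes \<open>r x\<close>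
  by an element of a fixed ball, and this ball is finite, so \<phi> is bounded on it.\<close>

lemma partial_iso_retraction_lipschitz:
  assumes p: "(H, \<phi>) \<in> partial_isos G" and r: "r \<in> coarse_retractions G S H"
  shows "\<exists>K\<ge>0. \<forall>x\<in>carrier G. \<forall>y\<in>carrier G. d (\<phi> (r x)) (\<phi> (r y)) \<le> K * d x y"
proof -
  have sH: "subgroup H G" and m: "\<And>x y. x \<in> H \<Longrightarrow> y \<in> H \<Longrightarrow> \<phi> (x \<otimes> y) = \<phi> x \<otimes> \<phi> y"
    using p by (auto simp: partial_isos_iff finite_index_subgroup_def)
  note cl = partial_iso_closed[OF p]
  obtain C where C: "0 \<le> C" "\<And>x. x \<in> carrier G \<Longrightarrow> r x \<in> H" "\<And>x. x \<in> carrier G \<Longrightarrow> d x (r x) \<le> C"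
    using coarse_retractionD[OF r] by blast
  \<comment> \<open>The ball may leave \<open>H\<close>, where \<phi> takes its default value; the
    image is finite all the same.\<close>
  have "finite (\<phi> ` {g \<in> carrier G. d \<one> g \<le> 2 * C + 1})" by (intro finite_imageI finite_ball)
  then obtain K where K: "0 \<le> K" "\<forall>a\<in>\<phi> ` {g \<in> carrier G. d \<one> g \<le> 2 * C + 1}. d \<one> a \<le> K"
    using finite_imp_bounded by blast
  have loc: "d (\<phi> (r x)) (\<phi> (r (x \<otimes> s))) \<le> K"
    if xs: "x \<in> carrier G" "s \<in> carrier G" "d \<one> s \<le> 1" for x s
  proof -
    let ?x = "r x" and ?y = "r (x \<otimes> s)"
    have H: "?x \<in> H" "?y \<in> H" using C(2) xs by auto
    have "d ?x ?y \<le> d ?x x + d x (x \<otimes> s) + d (x \<otimes> s) ?y"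
      using d_triangle[of ?x x ?y] d_triangle[of x "x \<otimes> s" ?y] cl H xs by fastforce
    also have "d x (x \<otimes> s) \<le> 1" using d_translate[of x \<one> s] xs by simp
    also have "d ?x x \<le> C" using C(3)[OF xs(1)] by (simp add: d_commute)
    also have "d (x \<otimes> s) ?y \<le> C" using C(3) xs by simp
    finally have "d \<one> (inv ?x \<otimes> ?y) \<le> 2 * C + 1" using d_quotient cl(1) H by simp
    then have K': "d \<one> (\<phi> (inv ?x \<otimes> ?y)) \<le> K" using K(2) cl(1) H by auto
    have iH: "inv ?x \<otimes> ?y \<in> H" using subgroup.m_inv_closed[OF sH] subgroup.m_closed[OF sH] H by blast
    have "?x \<otimes> (inv ?x \<otimes> ?y) = ?y" using cl(1) H by (simp flip: m_assoc)
    then have "\<phi> ?y = \<phi> ?x \<otimes> \<phi> (inv ?x \<otimes> ?y)" using m[OF H(1) iH] by simp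
    then show ?thesis using d_translate[of "\<phi> ?x" \<one> "\<phi> (inv ?x \<otimes> ?y)"] K' cl(2) H(1) iH by simp
  qed
  have "d (\<phi> (r x)) (\<phi> (r y)) \<le> K * d x y" if "x \<in> carrier G" "y \<in> carrier G" for x y
    by (rule lipschitz_if_local[where f = "\<lambda>x. \<phi> (r x)"]) (use loc cl(2) C(2) that in auto)
  then show ?thesis using K(1) by blast
qed

lemma partial_iso_lipschitz:
  assumes p: "(H, \<phi>) \<in> partial_isos G"
  shows "\<exists>K\<ge>0. \<forall>x\<in>H. \<forall>y\<in>H. d (\<phi> x) (\<phi> y) \<le> K * d x y"
proof -
  have "finite_index_subgroup H G" using p by (simp add: partial_isos_iff)
  then obtain r where r: "r \<in> coarse_retractions G S H" "\<forall>h\<in>H. r h = h"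
    using ex_coarse_retraction by blast
  obtain K where "0 \<le> K" "\<forall>x\<in>carrier G. \<forall>y\<in>carrier G. d (\<phi> (r x)) (\<phi> (r y)) \<le> K * d x y"
    using partial_iso_retraction_lipschitz[OF p r(1)] by blast
  then show ?thesis using r(2) partial_iso_closed(1)[OF p] by metis
qed

lemma partial_iso_near:
  assumes p: "(H, \<phi>) \<in> partial_isos G" and f: "f ` A \<subseteq> H" and g: "g ` A \<subseteq> H"
    and near: "\<And>x. x \<in> A \<Longrightarrow> d (f x) (g x) \<le> C"
  shows "\<exists>D. \<forall>x\<in>A. d (\<phi> (f x)) (\<phi> (g x)) \<le> D"
proof -
  obtain K where K: "0 \<le> K" "\<forall>x\<in>H. \<forall>y\<in>H. d (\<phi> x) (\<phi> y) \<le> K * d x y"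
    using partial_iso_lipschitz[OF p] by blast
  have "d (\<phi> (f x)) (\<phi> (g x)) \<le> K * C" if "x \<in> A" for x
    using order_trans[OF _ mult_left_mono[OF near[OF that] K(1)]] K(2) f g that by blast
  then show ?thesis by blast
qed

text \<open>The coarse inverse is induced by the inverse isomorphism. Its retraction
  \<open>r'\<close> is chosen to fix the image of \<phi>, so that one of the two compositions is off
  by the displacement of \<open>r\<close> alone.\<close>

lemma induced_self_QI:
  assumes p: "(H, \<phi>) \<in> partial_isos G" and r: "r \<in> coarse_retractions G S H"
  shows "(\<lambda>x\<in>carrier G. \<phi> (r x)) \<in> self_QIs (carrier G) d"
proof -
  let ?\<psi> = "restrict (inv_into H \<phi>) (\<phi> ` H)"
  have q: "(\<phi> ` H, ?\<psi>) \<in> partial_isos G" by (rule partial_iso_inverse[OF p])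
  then have fi: "finite_index_subgroup (\<phi> ` H) G" and inj: "inj_on \<phi> H"
    using p by (auto simp: partial_isos_iff)
  then obtain r' where r': "r' \<in> coarse_retractions G S (\<phi> ` H)" "\<forall>h\<in>\<phi> ` H. r' h = h"
    using ex_coarse_retraction by blast
  obtain C where C: "0 \<le> C" "\<And>x. x \<in> carrier G \<Longrightarrow> r x \<in> H" "\<And>x. x \<in> carrier G \<Longrightarrow> d x (r x) \<le> C"
    using coarse_retractionD[OF r] by blast
  obtain C' where C': "0 \<le> C'" "\<And>x. x \<in> carrier G \<Longrightarrow> r' x \<in> \<phi> ` H" "\<And>x. x \<in> carrier G \<Longrightarrow> d x (r' x) \<le> C'"
    using coarse_retractionD[OF r'(1)] by blast
  note cl = partial_iso_closed[OF p]
  have \<psi>: "?\<psi> y \<in> H" "\<phi> (?\<psi> y) = y" if "y \<in> \<phi> ` H" for y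
    using that by (auto simp: inv_into_into f_inv_into_f)
  have \<psi>\<phi>: "?\<psi> (\<phi> x) = x" if "x \<in> H" for x using that inj by simp
  obtain K where K: "\<forall>x\<in>carrier G. \<forall>y\<in>carrier G. d (\<phi> (r x)) (\<phi> (r y)) \<le> K * d x y"
    using partial_iso_retraction_lipschitz[OF p r] by blast
  obtain K' where K': "\<forall>x\<in>carrier G. \<forall>y\<in>carrier G. d (?\<psi> (r' x)) (?\<psi> (r' y)) \<le> K' * d x y"
    using partial_iso_retraction_lipschitz[OF q r'(1)] by blast
  have near1: "d (\<phi> (r (?\<psi> (r' x)))) x \<le> K2 * C + C'"
    if K2: "0 \<le> K2" "\<forall>x\<in>H. \<forall>y\<in>H. d (\<phi> x) (\<phi> y) \<le> K2 * d x y" and x: "x \<in> carrier G" for x K2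
  proof -
    let ?y = "?\<psi> (r' x)"
    have y: "?y \<in> H" "\<phi> ?y = r' x" using \<psi>[OF C'(2)[OF x]] .
    have yc: "?y \<in> carrier G" using cl(1) y(1) .
    have "d (\<phi> (r ?y)) x \<le> d (\<phi> (r ?y)) (\<phi> ?y) + d (\<phi> ?y) x"
      by (intro d_triangle cl(2) C(2) y(1) yc x)
    moreover have "d (\<phi> (r ?y)) (\<phi> ?y) \<le> K2 * d (r ?y) ?y" using K2(2) C(2)[OF yc] y(1) by blast
    moreover have "d (r ?y) ?y \<le> C"
      using C(3)[OF yc] by (subst d_commute)
    then have "K2 * d (r ?y) ?y \<le> K2 * C" by (rule mult_left_mono[OF _ K2(1)])
    moreover have "d (\<phi> ?y) x \<le> C'" unfolding y(2) using C'(3)[OF x] by (subst d_commute)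
    ultimately show ?thesis by linarith
  qed
  obtain K2 where K2: "0 \<le> K2" "\<forall>x\<in>H. \<forall>y\<in>H. d (\<phi> x) (\<phi> y) \<le> K2 * d x y"
    using partial_iso_lipschitz[OF p] by blast
  have near2: "d (?\<psi> (r' (\<phi> (r x)))) x \<le> C" if "x \<in> carrier G" for x
    using C(2,3)[OF that] r'(2) \<psi>\<phi> by (simp add: d_commute)
  show ?thesis
  proof (rule self_QI_if_inverse[where g = "\<lambda>x. ?\<psi> (r' x)" and K = K and K' = K' and C = "K2 * C + C' + C"])
    show "\<phi> (r x) \<in> carrier G" if "x \<in> carrier G" for x using cl(2) C(2) that by blast
    show "?\<psi> (r' x) \<in> carrier G" if "x \<in> carrier G" for x using cl(1) \<psi>(1) C'(2) that by blast
    show "d (\<phi> (r (?\<psi> (r' x)))) x \<le> K2 * C + C' + C" if "x \<in> carrier G" for x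
      using near1[OF K2 that] C(1) by linarith
    show "d (?\<psi> (r' (\<phi> (r x)))) x \<le> K2 * C + C' + C" if "x \<in> carrier G" for x
      using near2[OF that] C'(1) C(1) K2(1) mult_nonneg_nonneg[OF K2(1) C(1)] by linarith
  qed (use K K' in auto)
qed

lemma equiv_bounded_dist_d: "equiv (self_QIs (carrier G) d) (bounded_dist (carrier G) d)"
  by (rule equiv_bounded_dist[OF Metric_space_d])

text \<open>Both maps are compared through a retraction \<open>t\<close> onto a finite index
  subgroup on which \<phi> and \<psi> agree. Replacing a retraction by \<open>t\<close> costs a
  bounded amount since partial isomorphisms are Lipschitz.\<close>

lemma induced_bounded_dist:
  assumes pq: "((H, \<phi>), (K, \<psi>)) \<in> commensurate G"
    and r: "r \<in> coarse_retractions G S H" and r': "r' \<in> coarse_retractions G S K"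
  shows "((\<lambda>x\<in>carrier G. \<phi> (r x)), (\<lambda>x\<in>carrier G. \<psi> (r' x))) \<in> bounded_dist (carrier G) d"
proof -
  have p: "(H, \<phi>) \<in> partial_isos G" and q: "(K, \<psi>) \<in> partial_isos G"
    using pq by (auto simp: commensurate_def)
  obtain L where L: "finite_index_subgroup L G" "L \<subseteq> H \<inter> K" "\<forall>x\<in>L. \<phi> x = \<psi> x"
    using pq by (auto simp: commensurate_def)
  obtain t where t: "t \<in> coarse_retractions G S L" using ex_coarse_retraction[OF L(1)] by blast
  have move: "\<exists>D. \<forall>x\<in>carrier G. d (\<phi> (r x)) (\<phi> (t x)) \<le> D"
    if p: "(H, \<phi>) \<in> partial_isos G" and r: "r \<in> coarse_retractions G S H" and LH: "L \<subseteq> H" for H \<phi> r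
  proof -
    obtain C where C: "\<And>x. x \<in> carrier G \<Longrightarrow> r x \<in> H" "\<And>x. x \<in> carrier G \<Longrightarrow> d x (r x) \<le> C"
      using coarse_retractionD[OF r] by blast
    obtain C' where C': "\<And>x. x \<in> carrier G \<Longrightarrow> t x \<in> L" "\<And>x. x \<in> carrier G \<Longrightarrow> d x (t x) \<le> C'"
      using coarse_retractionD[OF t] by blast
    show ?thesis
    proof (rule partial_iso_near[OF p])
      show "d (r x) (t x) \<le> C + C'" if x: "x \<in> carrier G" for x
      proof -
        have "d (r x) (t x) \<le> d (r x) x + d x (t x)"
          using partial_iso_closed(1)[OF p] C(1)[OF x] C'(1)[OF x] LH x by (intro d_triangle) auto
        then show ?thesis using C(2)[OF x] C'(2)[OF x] by (simp add: d_commute[of "r x"])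
      qed
    qed (use C C' LH in auto)
  qed
  obtain D where D: "\<forall>x\<in>carrier G. d (\<phi> (r x)) (\<phi> (t x)) \<le> D" using move[OF p r] L(2) by blast
  obtain E where E: "\<forall>x\<in>carrier G. d (\<psi> (r' x)) (\<psi> (t x)) \<le> E" using move[OF q r'] L(2) by blast
  have mem: "r x \<in> H" "r' x \<in> K" "t x \<in> L" if "x \<in> carrier G" for x
    using r r' t that by (auto simp: coarse_retractions_def)
  have "d (\<phi> (r x)) (\<psi> (r' x)) \<le> D + E" if x: "x \<in> carrier G" for x
  proof -
    have eq: "\<phi> (t x) = \<psi> (t x)" using L(3) mem(3)[OF x] by blast
    have "d (\<phi> (r x)) (\<psi> (r' x)) \<le> d (\<phi> (r x)) (\<psi> (t x)) + d (\<psi> (t x)) (\<psi> (r' x))"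
      using partial_iso_closed(2)[OF p] partial_iso_closed(2)[OF q] mem[OF x] L(2)
      by (intro d_triangle) auto
    also have "d (\<phi> (r x)) (\<psi> (t x)) \<le> D" using bspec[OF D x] by (simp add: eq)
    also have "d (\<psi> (t x)) (\<psi> (r' x)) \<le> E" using bspec[OF E x] by (simp add: d_commute)
    finally show ?thesis by simp
  qed
  then show ?thesis
    using induced_self_QI[OF p r] induced_self_QI[OF q r'] by (auto simp: bounded_dist_def)
qed

text \<open>All terms of the union defining \<open>Comm_to_QI\<close> are the same class, by
  \<open>induced_bounded_dist\<close>, so any representative and any retraction may be used to
  compute it.\<close>

lemma Comm_to_QI_class:
  assumes p: "(H, \<phi>) \<in> partial_isos G" and r: "r \<in> coarse_retractions G S H"
  shows "Comm_to_QI G S (commensurate G `` {(H, \<phi>)}) =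
    bounded_dist (carrier G) d `` {\<lambda>x\<in>carrier G. \<phi> (r x)}" (is "?L = ?R")
proof -
  have eq: "bounded_dist (carrier G) d `` {\<lambda>x\<in>carrier G. \<psi> (r' x)} = ?R"
    if "((H, \<phi>), (K, \<psi>)) \<in> commensurate G" "r' \<in> coarse_retractions G S K" for K \<psi> r'
    using equiv_class_eq[OF equiv_bounded_dist_d induced_bounded_dist[OF that(1) r that(2)]] by simp
  have "?L \<subseteq> ?R" unfolding Comm_to_QI_def using eq by fastforce
  moreover have "((H, \<phi>), (H, \<phi>)) \<in> commensurate G"
    using equiv_commensurate p by (simp add: equiv_def refl_on_def)
  then have "?R \<subseteq> ?L" unfolding Comm_to_QI_def using r by fastforce
  ultimately show ?thesis by blast
qed

lemma Comm_to_QI_hom: "Comm_to_QI G S \<in> hom (Comm G) (QI (carrier G) d)"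
proof (rule homI)
  have obt: "\<exists>H \<phi>. (H, \<phi>) \<in> partial_isos G \<and> A = commensurate G `` {(H, \<phi>)}" if "A \<in> carrier (Comm G)" for A
    using that by (auto simp: Comm_def quotient_monoid_def quotient_def)
  have fi: "finite_index_subgroup H G" if "(H, \<phi>) \<in> partial_isos G" for H \<phi>
    using that by (simp add: partial_isos_iff)
  show "Comm_to_QI G S A \<in> carrier (QI (carrier G) d)" if A: "A \<in> carrier (Comm G)" for A
  proof -
    obtain H \<phi> where p: "(H, \<phi>) \<in> partial_isos G" "A = commensurate G `` {(H, \<phi>)}" using obt[OF A] by blast
    obtain r where r: "r \<in> coarse_retractions G S H" using ex_coarse_retraction[OF fi[OF p(1)]] by blast
    show ?thesis
      using induced_self_QI[OF p(1) r]
      by (auto simp: p(2) Comm_to_QI_class[OF p(1) r] QI_def quotient_monoid_def quotientI)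
  qed
  fix A B assume A: "A \<in> carrier (Comm G)" and B: "B \<in> carrier (Comm G)"
  obtain K \<psi> where p: "(K, \<psi>) \<in> partial_isos G" "A = commensurate G `` {(K, \<psi>)}" using obt[OF A] by blast
  obtain H \<phi> where q: "(H, \<phi>) \<in> partial_isos G" "B = commensurate G `` {(H, \<phi>)}" using obt[OF B] by blast
  let ?L = "{x \<in> H. \<phi> x \<in> K}"
  have pq: "partial_comp (K, \<psi>) (H, \<phi>) \<in> partial_isos G" by (rule partial_comp_closed[OF p(1) q(1)])
  then have pq': "(?L, \<lambda>x\<in>?L. \<psi> (\<phi> x)) \<in> partial_isos G" by simp
  \<comment> \<open>A retraction onto the domain of the composite serves for \<phi> too. The two
    maps to be compared then differ only by \<open>r'\<close>, inserted between \<phi> and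
    \<psi>.\<close>
  obtain r where r: "r \<in> coarse_retractions G S ?L" using ex_coarse_retraction[OF fi[OF pq']] by blast
  have rH: "r \<in> coarse_retractions G S H" by (rule coarse_retraction_mono[OF r]) auto
  obtain r' where r': "r' \<in> coarse_retractions G S K" using ex_coarse_retraction[OF fi[OF p(1)]] by blast
  obtain C' where C': "\<And>x. x \<in> carrier G \<Longrightarrow> r' x \<in> K" "\<And>x. x \<in> carrier G \<Longrightarrow> d x (r' x) \<le> C'"
    using coarse_retractionD[OF r'] by blast
  have rL: "r x \<in> ?L" if "x \<in> carrier G" for x using r that by (auto simp: coarse_retractions_def)
  have \<phi>r: "\<phi> (r x) \<in> carrier G" "\<phi> (r x) \<in> K" if "x \<in> carrier G" for x
    using rL[OF that] partial_iso_closed(2)[OF q(1)] by auto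
  let ?f = "\<lambda>x\<in>carrier G. \<psi> (r' x)" and ?g = "\<lambda>x\<in>carrier G. \<phi> (r x)"
  let ?h = "\<lambda>x\<in>carrier G. (\<lambda>x\<in>?L. \<psi> (\<phi> x)) (r x)"
  have "\<exists>D. \<forall>x\<in>carrier G. d (\<psi> (r' (\<phi> (r x)))) (\<psi> (\<phi> (r x))) \<le> D"
    by (rule partial_iso_near[OF p(1), where C = C'])
      (use C' \<phi>r in \<open>auto simp: d_commute[of "r' _"]\<close>)
  then have "(compose (carrier G) ?f ?g, ?h) \<in> bounded_dist (carrier G) d"
    using self_QI_compose[OF Metric_space_d induced_self_QI[OF p(1) r'] induced_self_QI[OF q(1) rH]]
      induced_self_QI[OF pq' r] \<phi>r(1) rL
    by (auto simp: bounded_dist_def compose_eq)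
  then have "bounded_dist (carrier G) d `` {?h} = bounded_dist (carrier G) d `` {compose (carrier G) ?f ?g}"
    using equiv_class_eq[OF equiv_bounded_dist_d] by blast
  moreover have "Comm_to_QI G S (A \<otimes>\<^bsub>Comm G\<^esub> B) = bounded_dist (carrier G) d `` {?h}"
    using Comm_to_QI_class[OF pq' r] Comm_mult[OF p(1) q(1)] by (simp add: p(2) q(2))
  moreover have "Comm_to_QI G S A \<otimes>\<^bsub>QI (carrier G) d\<^esub> Comm_to_QI G S B =
      bounded_dist (carrier G) d `` {compose (carrier G) ?f ?g}"
    using QI_mult[OF Metric_space_d induced_self_QI[OF p(1) r'] induced_self_QI[OF q(1) rH]]
    by (simp add: p(2) q(2) Comm_to_QI_class[OF p(1) r'] Comm_to_QI_class[OF q(1) rH])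
  ultimately show "Comm_to_QI G S (A \<otimes>\<^bsub>Comm G\<^esub> B) =
      Comm_to_QI G S A \<otimes>\<^bsub>QI (carrier G) d\<^esub> Comm_to_QI G S B"
    by simp
qed

end

section \<open>Unique roots and injectivity\<close>

locale unique_root_group = group G for G (structure) +
  assumes unique_roots: "x \<in> carrier G \<Longrightarrow> y \<in> carrier G \<Longrightarrow> 0 < n \<Longrightarrow> x [^] (n::nat) = y [^] n \<Longrightarrow> x = y"
begin

text \<open>Applied with powers at which \<alpha> is known through a finite index subgroup.\<close>

lemma auto_determined:
  assumes \<alpha>: "\<alpha> \<in> auto G" and g: "g \<in> carrier G" and h: "h \<in> carrier G" and n: "0 < n"
    and pow: "\<alpha> (g [^] (n::nat)) = h [^] n"
  shows "\<alpha> g = h"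
proof -
  note iso = auto_partial_iso[OF \<alpha>]
  show ?thesis
    by (rule unique_roots[OF _ h n])
      (use partial_iso_pow[OF iso g, of n] partial_iso_closed(2)[OF iso g] pow in auto)
qed

lemma Aut_to_Comm_inj: "inj_on (Aut_to_Comm G) (carrier (AutoGroup G))"
proof (rule inj_onI)
  fix \<alpha> \<beta> assume "\<alpha> \<in> carrier (AutoGroup G)" "\<beta> \<in> carrier (AutoGroup G)"
    and eq: "Aut_to_Comm G \<alpha> = Aut_to_Comm G \<beta>"
  then have ab: "\<alpha> \<in> auto G" "\<beta> \<in> auto G" by (auto simp: AutoGroup_def)
  note iso = auto_partial_iso[OF ab(1)] auto_partial_iso[OF ab(2)]
  have "((carrier G, \<alpha>), (carrier G, \<beta>)) \<in> commensurate G"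
    using eq_equiv_class[OF _ equiv_commensurate iso(2)] eq by (simp add: Aut_to_Comm_def)
  then obtain L where L: "finite_index_subgroup L G" "\<forall>x\<in>L. \<alpha> x = \<beta> x"
    by (auto simp: commensurate_def)
  have "\<alpha> g = \<beta> g" if g: "g \<in> carrier G" for g
  proof -
    obtain n :: nat where n: "0 < n" "g [^] n \<in> L" using pow_in_finite_index[OF L(1) g] by blast
    show ?thesis
      by (rule auto_determined[OF ab(1) g _ n(1)])
        (use L(2) n partial_iso_pow[OF iso(2) g, of n] partial_iso_closed(2)[OF iso(2) g] in auto)
  qed
  then show "\<alpha> = \<beta>"
    using ab by (intro extensionalityI[of _ "carrier G"]) (auto simp: auto_def Bij_def)
qed

end

locale generated_unique_root_group = generated_group + unique_root_group
begin

text \<open>The elements \<open>p\<^sup>-\<^sup>n q\<^sup>n\<close> take finitely many values; when the values at \<open>m < n\<close> agree,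
  \<open>p\<close> and \<open>q\<close> have the same power of exponent \<open>n - m\<close>.\<close>
lemma powers_near_imp_eq:
  assumes p: "p \<in> carrier G" and q: "q \<in> carrier G"
    and near: "\<And>n::nat. d (p [^] n) (q [^] n) \<le> C"
  shows "p = q"
proof -
  let ?t = "\<lambda>n::nat. inv (p [^] n) \<otimes> q [^] n"
  have "range ?t \<subseteq> {g \<in> carrier G. d \<one> g \<le> C}"
    using near p q by (auto simp: d_quotient)
  then have "finite (range ?t)" using finite_ball finite_subset by blast
  then have "\<not> inj ?t" by (auto dest: finite_imageD)
  then obtain m n :: nat where "?t m = ?t n" "m \<noteq> n" unfolding inj_def by blast
  then obtain m n :: nat where mn: "?t m = ?t n" "m < n" by (metis nat_neq_iff)
  have "p [^] n = p [^] (n - m) \<otimes> p [^] m" "q [^] n = q [^] (n - m) \<otimes> q [^] m"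
    using mn(2) p q by (simp_all add: nat_pow_mult)
  moreover have "q [^] n = p [^] n \<otimes> (inv (p [^] m) \<otimes> q [^] m)"
    unfolding mn(1)
    using p q by (simp flip: m_assoc)
  ultimately have "q [^] (n - m) \<otimes> q [^] m = p [^] (n - m) \<otimes> p [^] m \<otimes> (inv (p [^] m) \<otimes> q [^] m)"
    by simp
  also have "\<dots> = p [^] (n - m) \<otimes> (p [^] m \<otimes> (inv (p [^] m) \<otimes> q [^] m))"
    using p q by (simp add: m_assoc)
  also have "p [^] m \<otimes> (inv (p [^] m) \<otimes> q [^] m) = q [^] m"
    using p q by (simp flip: m_assoc)
  finally have "q [^] (n - m) = p [^] (n - m)" using p q by simp
  then show ?thesis using unique_roots[of p q "n - m"] p q mn(2) by simp
qed

lemma Comm_to_QI_inj: "inj_on (Comm_to_QI G S) (carrier (Comm G))"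
proof -
  have C: "group (Comm G)" and Q: "group (QI (carrier G) d)"
    by (rule group_Comm, rule group_QI[OF Metric_space_d])
  interpret hom: group_hom "Comm G" "QI (carrier G) d" "Comm_to_QI G S"
    using C Q Comm_to_QI_hom by (simp add: group_hom_def group_hom_axioms_def)
  have id: "(carrier G, \<lambda>x\<in>carrier G. x) \<in> partial_isos G"
    using finite_index_carrier by (auto simp: partial_isos_iff inj_on_def)
  have "A = \<one>\<^bsub>Comm G\<^esub>" if A: "A \<in> carrier (Comm G)" and one: "Comm_to_QI G S A = \<one>\<^bsub>QI (carrier G) d\<^esub>" for A
  proof -
    obtain H \<phi> where p: "(H, \<phi>) \<in> partial_isos G" "A = commensurate G `` {(H, \<phi>)}"
      using A by (auto simp: Comm_def quotient_monoid_def quotient_def)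
    then have fi: "finite_index_subgroup H G" by (simp add: partial_isos_iff)
    then have sH: "subgroup H G" by (simp add: finite_index_subgroup_def)
    obtain r where r: "r \<in> coarse_retractions G S H" "\<forall>h\<in>H. r h = h" using ex_coarse_retraction[OF fi] by blast
    have "bounded_dist (carrier G) d `` {\<lambda>x\<in>carrier G. \<phi> (r x)} = bounded_dist (carrier G) d `` {\<lambda>x\<in>carrier G. x}"
      using one by (simp add: p(2) Comm_to_QI_class[OF p(1) r(1)] QI_def quotient_monoid_def)
    moreover have "(\<lambda>x\<in>carrier G. x) \<in> self_QIs (carrier G) d"
      by (rule self_QI_if_inverse[where g = "\<lambda>x. x" and K = 1 and K' = 1 and C = 0]) (auto simp: d_refl)
    ultimately have "((\<lambda>x\<in>carrier G. \<phi> (r x)), \<lambda>x\<in>carrier G. x) \<in> bounded_dist (carrier G) d"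
      using eq_equiv_class[OF _ equiv_bounded_dist_d] by blast
    then obtain D where D: "\<forall>x\<in>carrier G. d (\<phi> (r x)) x \<le> D" by (auto simp: bounded_dist_def)
    have near: "d (\<phi> x) x \<le> D" if "x \<in> H" for x
      using D r(2) that partial_iso_closed(1)[OF p(1) that] by metis
    \<comment> \<open>The powers of \<open>\<phi> x\<close> are the images of the powers of
      \<open>x\<close>, hence stay within \<open>D\<close> of them.\<close>
    have fix_H: "\<phi> x = x" if x: "x \<in> H" for x
    proof (rule powers_near_imp_eq[where C = D])
      show "\<phi> x \<in> carrier G" "x \<in> carrier G"
        using partial_iso_closed[OF p(1) x] by auto
      show "d (\<phi> x [^] n) (x [^] n) \<le> D" for n :: nat
        using near[of "x [^] n"] partial_iso_pow[OF p(1) x, of n] by simp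
    qed
    have "((H, \<phi>), (carrier G, \<lambda>x\<in>carrier G. x)) \<in> commensurate G"
      by (rule commensurateI[OF p(1) id fi]) (use fix_H partial_iso_closed(1)[OF p(1)] in auto)
    then show ?thesis
      using equiv_class_eq[OF equiv_commensurate] by (simp add: p(2) Comm_def quotient_monoid_def)
  qed
  then have "kernel (Comm G) (QI (carrier G) d) (Comm_to_QI G S) = {\<one>\<^bsub>Comm G\<^esub>}"
    by (auto simp: kernel_def)
  then show ?thesis by (simp add: hom.inj_iff_trivial_ker)
qed

end

section \<open>Permuting the cosets of a vertex group\<close>

sublocale artin_group \<subseteq> unique_root_group "raag \<Gamma>"
  by unfold_locales (rule raag_unique_roots)

locale artin_vertex = artin_group +
  fixes v assumes v_vertex: "v \<in> pverts \<Gamma>"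
begin

abbreviation t :: "int \<Rightarrow> ('a \<times> bool) list set" where
  "t a \<equiv> gen \<Gamma> v [^]\<^bsub>G\<^esub> a"

definition conj_by :: "int \<Rightarrow> ('a \<times> bool) list set \<Rightarrow> ('a \<times> bool) list set" where
  "conj_by a g = t a \<otimes>\<^bsub>G\<^esub> g \<otimes>\<^bsub>G\<^esub> t (- a)"

lemma t_closed [simp]: "t a \<in> carrier G"
  using v_vertex by simp

lemma t_add: "t (a + b) = t a \<otimes>\<^bsub>G\<^esub> t b"
  using v_vertex by (simp add: int_pow_mult)

lemma t_cancel: "t a \<otimes>\<^bsub>G\<^esub> t (- a) = \<one>\<^bsub>G\<^esub>" "t (- a) \<otimes>\<^bsub>G\<^esub> t a = \<one>\<^bsub>G\<^esub>"
  using t_add[of a "- a"] t_add[of "- a" a] by simp_all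

lemma t_cancel_mult:
  assumes "g \<in> carrier G"
  shows "t a \<otimes>\<^bsub>G\<^esub> (t (- a) \<otimes>\<^bsub>G\<^esub> g) = g" "t (- a) \<otimes>\<^bsub>G\<^esub> (t a \<otimes>\<^bsub>G\<^esub> g) = g"
  using assms t_cancel[of a] by (simp_all flip: m_assoc)

lemma conj_closed [simp]: "g \<in> carrier G \<Longrightarrow> conj_by a g \<in> carrier G"
  by (simp add: conj_by_def)

lemma conj_mult:
  assumes "g \<in> carrier G" "h \<in> carrier G"
  shows "conj_by a (g \<otimes>\<^bsub>G\<^esub> h) = conj_by a g \<otimes>\<^bsub>G\<^esub> conj_by a h"
  using assms t_cancel_mult(2)[of "h \<otimes>\<^bsub>G\<^esub> t (- a)" a] by (simp add: conj_by_def m_assoc)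

lemma conj_conj:
  assumes "g \<in> carrier G"
  shows "conj_by a (conj_by b g) = conj_by (a + b) g"
proof -
  have "- (a + b) = - b + - a" by simp
  then have "t (- (a + b)) = t (- b) \<otimes>\<^bsub>G\<^esub> t (- a)" by (simp only: t_add)
  then show ?thesis using assms by (simp add: conj_by_def m_assoc t_add)
qed

lemma conj_0: "g \<in> carrier G \<Longrightarrow> conj_by 0 g = g"
  by (simp add: conj_by_def)

lemma conj_one: "conj_by a \<one>\<^bsub>G\<^esub> = \<one>\<^bsub>G\<^esub>"
  using t_cancel by (simp add: conj_by_def)

lemma conj_pow: "g \<in> carrier G \<Longrightarrow> conj_by a (g [^]\<^bsub>G\<^esub> (n::nat)) = conj_by a g [^]\<^bsub>G\<^esub> n"
  by (induction n) (simp_all add: conj_mult conj_one)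

lemma conj_inj:
  assumes "g \<in> carrier G" "h \<in> carrier G" and eq: "conj_by a g = conj_by a h"
  shows "g = h"
proof -
  have "conj_by (- a) (conj_by a g) = conj_by (- a) (conj_by a h)" by (simp only: eq)
  then show ?thesis using assms(1,2) by (simp add: conj_conj conj_0)
qed

lemma conj_commuting:
  assumes "gen \<Gamma> v \<otimes>\<^bsub>G\<^esub> g = g \<otimes>\<^bsub>G\<^esub> gen \<Gamma> v" "g \<in> carrier G"
  shows "conj_by a g = g"
proof -
  have "t a \<otimes>\<^bsub>G\<^esub> g = g \<otimes>\<^bsub>G\<^esub> t a"
    using commutes_int_pow[OF assms(1)] assms(2) v_vertex by simp
  then show ?thesis using assms(2) t_cancel by (simp add: conj_by_def m_assoc)
qed

lemma conj_star:
  assumes "x = v \<or> (x, v) \<in> parcs \<Gamma>" "x \<in> pverts \<Gamma>"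
  shows "conj_by a (letter \<Gamma> (x, b)) = letter \<Gamma> (x, b)"
proof -
  have gx: "gen \<Gamma> v \<otimes>\<^bsub>G\<^esub> gen \<Gamma> x = gen \<Gamma> x \<otimes>\<^bsub>G\<^esub> gen \<Gamma> v"
    using assms gen_commute[of x v] by auto
  have "conj_by a (gen \<Gamma> x) = gen \<Gamma> x"
    using gx assms by (intro conj_commuting) simp_all
  moreover have "conj_by a (inv\<^bsub>G\<^esub> gen \<Gamma> x) = inv\<^bsub>G\<^esub> gen \<Gamma> x"
  proof -
    have "gen \<Gamma> v \<otimes>\<^bsub>G\<^esub> gen \<Gamma> x [^]\<^bsub>G\<^esub> (- 1 :: int) = gen \<Gamma> x [^]\<^bsub>G\<^esub> (- 1 :: int) \<otimes>\<^bsub>G\<^esub> gen \<Gamma> v"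
      using commutes_int_pow[OF gx[symmetric]] assms(2) v_vertex by simp
    then show ?thesis
      using assms(2) by (intro conj_commuting) (simp_all add: int_pow_neg)
  qed
  ultimately show ?thesis using letter_False[OF assms(2)] by (cases b) auto
qed

text \<open>If the conjugation fixes \<open>w\<close>, then v^a commutes with \<open>w\<close>.
  Hence conjugates of \<open>w\<close> by different powers of \<open>v\<close> are distinct, which
  is how permutations of the exponents are recognised.\<close>

lemma conj_gen_eq_iff:
  assumes w: "w \<in> pverts \<Gamma>" "w \<noteq> v" "(v, w) \<notin> parcs \<Gamma>" and eq: "conj_by a (gen \<Gamma> w) = gen \<Gamma> w"
  shows "a = 0"
proof -
  have "conj_by a (gen \<Gamma> w) \<otimes>\<^bsub>G\<^esub> t a = t a \<otimes>\<^bsub>G\<^esub> gen \<Gamma> w"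
    using w t_cancel by (simp add: conj_by_def m_assoc)
  then have "t a \<otimes>\<^bsub>G\<^esub> gen \<Gamma> w [^]\<^bsub>G\<^esub> (1::int) = gen \<Gamma> w [^]\<^bsub>G\<^esub> (1::int) \<otimes>\<^bsub>G\<^esub> t a"
    using eq w by simp
  from gen_pow_commute_iff[OF v_vertex w(1) w(2)[symmetric] w(3) this] show ?thesis by simp
qed

section \<open>The exponent of \<open>v\<close> and the twist by a permutation of the
  integers\<close>

definition expo_letter :: "'a \<times> bool \<Rightarrow> int" where
  "expo_letter l = (if fst l = v then if snd l then 1 else - 1 else 0)"

definition emit :: "(int \<Rightarrow> int) \<Rightarrow> int \<Rightarrow> 'a \<times> bool \<Rightarrow> ('a \<times> bool) list set" where
  "emit \<pi> s l = conj_by (\<pi> s - s) (letter \<Gamma> l)"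

lemma emit_closed [simp]: "fst l \<in> pverts \<Gamma> \<Longrightarrow> emit \<pi> s l \<in> carrier G"
  by (simp add: emit_def)

lemma emit_star: "x = v \<or> (x, v) \<in> parcs \<Gamma> \<Longrightarrow> x \<in> pverts \<Gamma> \<Longrightarrow> emit \<pi> s (x, b) = letter \<Gamma> (x, b)"
  by (simp add: emit_def conj_star)

text \<open>The state \<Phi> is the output for the remaining letters as a function of the exponent
  at which reading resumes. This lets a left-to-right reading be computed by folding from the right,
  where the starting exponent is not yet known.\<close>

definition emit_step ::
    "(int \<Rightarrow> int) \<Rightarrow> 'a \<times> bool \<Rightarrow> (int \<Rightarrow> ('a \<times> bool) list set) \<Rightarrow> int \<Rightarrow> ('a \<times> bool) list set" where
  "emit_step \<pi> l \<Phi> s = emit \<pi> s l \<otimes>\<^bsub>G\<^esub> \<Phi> (s + expo_letter l)"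

sublocale expo: raag_action \<Gamma> "\<lambda>l n. expo_letter l + n" "UNIV :: int set"
  by unfold_locales (auto simp: expo_letter_def)

text \<open>A relation involving \<open>v\<close> has all its letters in the closed star of
  \<open>v\<close>, and these are emitted unchanged. In the other relations no letter changes the
  exponent, so all letters are conjugated by the same power of \<open>v\<close>.\<close>

sublocale twist: raag_action \<Gamma> "emit_step \<pi>" "{\<Phi>. \<forall>s. \<Phi> s \<in> carrier G}" for \<pi>
proof
  show "emit_step \<pi> l \<Phi> \<in> {\<Phi>. \<forall>s. \<Phi> s \<in> carrier G}"
    if "fst l \<in> pverts \<Gamma>" "\<Phi> \<in> {\<Phi>. \<forall>s. \<Phi> s \<in> carrier G}" for l \<Phi>
    using that by (simp add: emit_step_def)
next
  fix x b and \<Phi> :: "int \<Rightarrow> ('a \<times> bool) list set"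
  assume x: "x \<in> pverts \<Gamma>" and "\<Phi> \<in> {\<Phi>. \<forall>s. \<Phi> s \<in> carrier G}"
  then have \<Phi>: "\<Phi> s \<in> carrier G" for s by simp
  have sh: "expo_letter (x, b) + expo_letter (x, \<not> b) = 0" by (simp add: expo_letter_def)
  have "emit \<pi> s (x, b) \<otimes>\<^bsub>G\<^esub> emit \<pi> (s + expo_letter (x, b)) (x, \<not> b) = \<one>\<^bsub>G\<^esub>" for s
  proof (cases "x = v")
    case True
    then show ?thesis using x letter_cancel by (simp add: emit_star)
  next
    case False
    then show ?thesis
      using x by (simp add: emit_def expo_letter_def letter_cancel conj_one flip: conj_mult)
  qed
  then show "emit_step \<pi> (x, b) (emit_step \<pi> (x, \<not> b) \<Phi>) = \<Phi>"
    using \<Phi> x sh by (intro ext) (simp add: emit_step_def add.assoc flip: m_assoc)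
next
  fix u w and \<Phi> :: "int \<Rightarrow> ('a \<times> bool) list set"
  assume uw: "(u, w) \<in> parcs \<Gamma>" and "\<Phi> \<in> {\<Phi>. \<forall>s. \<Phi> s \<in> carrier G}"
  then have \<Phi>: "\<Phi> s \<in> carrier G" for s by simp
  have V: "u \<in> pverts \<Gamma>" "w \<in> pverts \<Gamma>" using adj_verts[OF uw] by auto
  have uw': "(w, u) \<in> parcs \<Gamma>" using uw adj_sym by blast
  have "emit \<pi> s (u, True) \<otimes>\<^bsub>G\<^esub> emit \<pi> (s + expo_letter (u, True)) (w, True) =
      emit \<pi> s (w, True) \<otimes>\<^bsub>G\<^esub> emit \<pi> (s + expo_letter (w, True)) (u, True)" for s
  proof (cases "u = v \<or> w = v")
    case True
    then show ?thesis using V uw uw' gen_commute[OF uw] by (auto simp: emit_star)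
  next
    case False
    then show ?thesis
      using V gen_commute[OF uw] by (simp add: emit_def expo_letter_def flip: conj_mult)
  qed
  then show "emit_step \<pi> (u, True) (emit_step \<pi> (w, True) \<Phi>) = emit_step \<pi> (w, True) (emit_step \<pi> (u, True) \<Phi>)"
    using \<Phi> V by (intro ext) (simp add: emit_step_def add_ac flip: m_assoc)
qed

definition expo :: "('a \<times> bool) list set \<Rightarrow> int" where
  "expo g = raag_act (\<lambda>l n. expo_letter l + n) g 0"

text \<open>The element \<open>g\<close> is read letter by letter, starting from the \<open>v\<close>-exponent \<open>s\<close>, and a letter \<open>x\<close> read
  at exponent \<open>n\<close> is replaced by its conjugate by \<open>v\<close> to the power \<open>\<pi> n - n\<close>.  Thus the conjugate of \<open>x\<close> by
  \<open>v\<^sup>n\<close> goes to its conjugate by \<open>v\<close> to the power \<open>\<pi> n\<close>.\<close>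
definition twist :: "(int \<Rightarrow> int) \<Rightarrow> int \<Rightarrow> ('a \<times> bool) list set \<Rightarrow> ('a \<times> bool) list set" where
  "twist \<pi> s g = raag_act (emit_step \<pi>) g (\<lambda>_. \<one>\<^bsub>G\<^esub>) s"

lemma expo_one: "expo \<one>\<^bsub>G\<^esub> = 0"
  by (simp add: expo_def expo.act_one)

lemma expo_letter_mult:
  "fst l \<in> pverts \<Gamma> \<Longrightarrow> g \<in> carrier G \<Longrightarrow> expo (letter \<Gamma> l \<otimes>\<^bsub>G\<^esub> g) = expo_letter l + expo g"
  by (simp add: expo_def expo.act_mult expo.act_letter)

lemma twist_one: "twist \<pi> s \<one>\<^bsub>G\<^esub> = \<one>\<^bsub>G\<^esub>"
  by (simp add: twist_def twist.act_one)

lemma twist_letter_mult: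
  "fst l \<in> pverts \<Gamma> \<Longrightarrow> g \<in> carrier G \<Longrightarrow>
   twist \<pi> s (letter \<Gamma> l \<otimes>\<^bsub>G\<^esub> g) = emit \<pi> s l \<otimes>\<^bsub>G\<^esub> twist \<pi> (s + expo_letter l) g"
  using twist.act_closed[of g "\<lambda>_. \<one>\<^bsub>G\<^esub>" \<pi>]
  by (simp add: twist_def twist.act_mult twist.act_letter) (simp add: emit_step_def)

lemma twist_closed [simp]: "g \<in> carrier G \<Longrightarrow> twist \<pi> s g \<in> carrier G"
  using twist.act_closed[of g "\<lambda>_. \<one>\<^bsub>G\<^esub>" \<pi>] by (simp add: twist_def)

lemma twist_letter: "fst l \<in> pverts \<Gamma> \<Longrightarrow> twist \<pi> s (letter \<Gamma> l) = emit \<pi> s l"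
  using twist_letter_mult[of l "\<one>\<^bsub>G\<^esub>" \<pi> s] by (simp add: twist_one)

lemma expo_of_letter: "fst l \<in> pverts \<Gamma> \<Longrightarrow> expo (letter \<Gamma> l) = expo_letter l"
  using expo_letter_mult[of l "\<one>\<^bsub>G\<^esub>"] by (simp add: expo_one)

lemma expo_mult:
  "g \<in> carrier G \<Longrightarrow> h \<in> carrier G \<Longrightarrow> expo (g \<otimes>\<^bsub>G\<^esub> h) = expo g + expo h"
  by (induction rule: raag_induct) (simp_all add: expo_one expo_letter_mult m_assoc)

text \<open>Reading \<open>g\<close> moves the exponent from \<open>s\<close> to
  \<open>s + expo g\<close>. On elements of exponent zero this makes the twist a
  homomorphism.\<close>

lemma twist_mult:
  "g \<in> carrier G \<Longrightarrow> h \<in> carrier G \<Longrightarrow>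
   twist \<pi> s (g \<otimes>\<^bsub>G\<^esub> h) = twist \<pi> s g \<otimes>\<^bsub>G\<^esub> twist \<pi> (s + expo g) h"
proof (induction arbitrary: s rule: raag_induct)
  case one
  then show ?case by (simp add: twist_one expo_one)
next
  case (letter l g)
  then show ?case by (simp add: twist_letter_mult expo_letter_mult m_assoc add.assoc)
qed

lemma expo_t: "expo (t a) = a"
proof (induction a rule: int_induct[where k = 0])
  case base
  show ?case by (simp add: expo_one)
next
  case (step1 a)
  then show ?case using v_vertex by (simp add: t_add expo_mult expo_of_letter expo_letter_def)
next
  case (step2 a)
  have "expo (t (a - 1 + 1)) = expo (t (a - 1)) + 1"
    using v_vertex by (subst t_add) (simp add: expo_mult expo_of_letter expo_letter_def)
  then show ?case using step2 by simp
qed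

lemma twist_t: "twist \<pi> s (t a) = t a"
proof (induction a arbitrary: s rule: int_induct[where k = 0])
  case base
  show ?case by (simp add: twist_one)
next
  case (step1 a)
  then show ?case
    using v_vertex by (simp add: t_add twist_mult twist_letter emit_star)
next
  case (step2 a)
  have "twist \<pi> s (t (a - 1 + 1)) = twist \<pi> s (t (a - 1)) \<otimes>\<^bsub>G\<^esub> gen \<Gamma> v"
    using v_vertex by (subst t_add) (simp add: twist_mult twist_letter emit_star)
  moreover have "t (a - 1 + 1) = t (a - 1) \<otimes>\<^bsub>G\<^esub> gen \<Gamma> v"
    using v_vertex by (subst t_add) simp
  ultimately show ?case using step2 v_vertex by simp
qed

lemma expo_conj: "g \<in> carrier G \<Longrightarrow> expo (conj_by a g) = expo g"
  by (simp add: conj_by_def expo_mult expo_t)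

lemma expo_emit: "fst l \<in> pverts \<Gamma> \<Longrightarrow> expo (emit \<pi> s l) = expo_letter l"
  by (simp add: emit_def expo_conj expo_of_letter)

lemma expo_twist: "g \<in> carrier G \<Longrightarrow> expo (twist \<pi> s g) = expo g"
  by (induction arbitrary: s rule: raag_induct)
    (simp_all add: twist_one twist_letter_mult expo_letter_mult expo_mult expo_emit expo_of_letter)

lemma twist_conj:
  assumes "g \<in> carrier G" "expo g = 0"
  shows "twist \<pi> s (conj_by a g) = conj_by a (twist \<pi> (s + a) g)"
  using assms by (simp add: conj_by_def twist_mult twist_t expo_mult expo_t)

lemma twist_pow:
  "g \<in> carrier G \<Longrightarrow> expo g = 0 \<Longrightarrow> twist \<pi> s (g [^]\<^bsub>G\<^esub> (n::nat)) = twist \<pi> s g [^]\<^bsub>G\<^esub> n"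
proof (induction n)
  case (Suc n)
  have "expo (g [^]\<^bsub>G\<^esub> n) = 0" using Suc.prems by (induction n) (simp_all add: expo_one expo_mult)
  then show ?case using Suc by (simp add: twist_mult)
qed (simp add: twist_one)

text \<open>Inside the conjugate the letter \<open>w\<close> is read at exponent \<open>a\<close>
  and gets conjugated by \<open>v\<close> to the power \<open>\<pi> a - a\<close>; the outer
  conjugation adds \<open>a\<close>.\<close>

lemma twist_conj_gen_pow:
  assumes w: "w \<in> pverts \<Gamma>" "w \<noteq> v"
  shows "twist \<pi> 0 (conj_by a (gen \<Gamma> w) [^]\<^bsub>G\<^esub> (n::nat)) = conj_by (\<pi> a) (gen \<Gamma> w) [^]\<^bsub>G\<^esub> n"
proof -
  have "expo (gen \<Gamma> w) = 0" using w by (simp add: expo_of_letter expo_letter_def)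
  then show ?thesis
    using w by (simp add: twist_pow expo_conj twist_conj twist_letter emit_def conj_conj)
qed

lemma twist_emit:
  assumes "fst l \<in> pverts \<Gamma>"
  shows "twist \<pi> s (emit \<rho> s l) = emit (\<pi> \<circ> \<rho>) s l"
proof (cases "fst l = v")
  case True
  then show ?thesis using assms by (cases l) (simp add: emit_star twist_letter)
next
  case False
  then have "expo (letter \<Gamma> l) = 0" using assms by (simp add: expo_of_letter expo_letter_def)
  then show ?thesis
    using assms by (simp add: emit_def[of \<rho>] twist_conj twist_letter) (simp add: emit_def conj_conj)
qed

text \<open>A twist preserves exponents, so the second pass meets the output for each letter at the
  exponent at which the first pass read that letter.\<close>

lemma twist_twist: "g \<in> carrier G \<Longrightarrow> twist \<pi> s (twist \<rho> s g) = twist (\<pi> \<circ> \<rho>) s g"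
  by (induction arbitrary: s rule: raag_induct)
    (simp_all add: twist_one twist_letter_mult twist_mult twist_emit expo_emit expo_of_letter twist_letter)

lemma twist_id: "g \<in> carrier G \<Longrightarrow> twist id s g = g"
  by (induction arbitrary: s rule: raag_induct)
    (simp_all add: twist_one twist_letter_mult emit_def conj_0)

text \<open>Only the displacements of \<pi> seen from the starting point enter. This is what turns a
  periodic displacement into a homomorphism on a finite index subgroup.\<close>

lemma twist_cong:
  assumes "g \<in> carrier G" "\<And>n. \<pi> (s + n) - (s + n) = \<pi> (s' + n) - (s' + n)"
  shows "twist \<pi> s g = twist \<pi> s' g"
  using assms
proof (induction arbitrary: s s' rule: raag_induct)
  case one
  then show ?case by (simp add: twist_one)
next
  case (letter l h)
  have "twist \<pi> (s + expo_letter l) h = twist \<pi> (s' + expo_letter l) h"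
    by (rule letter.IH) (use letter.prems[of "expo_letter l + _"] in \<open>simp add: add.assoc\<close>)
  moreover have "emit \<pi> s l = emit \<pi> s' l" using letter.prems[of 0] by (simp add: emit_def)
  ultimately show ?case using letter.hyps by (simp add: twist_letter_mult)
qed

text \<open>If \<pi> moves finitely many points, it has finitely many displacements, so each letter
  has finitely many outputs, and hence each word. The resulting bound, uniform in \<open>s\<close>,
  makes the twist Lipschitz.\<close>

lemma finite_range_twist:
  assumes fin: "finite {s. \<pi> s \<noteq> s}" and g: "g \<in> carrier G"
  shows "finite (range (\<lambda>s. twist \<pi> s g))"
  using g
proof (induction rule: raag_induct)
  case one
  then show ?case by (simp add: twist_one)
next
  case (letter l h)
  have "range (\<lambda>s. \<pi> s - s) \<subseteq> insert 0 ((\<lambda>s. \<pi> s - s) ` {s. \<pi> s \<noteq> s})" by auto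
  then have "finite (range (\<lambda>s. \<pi> s - s))" using fin by (meson finite_imageI finite_insert finite_subset)
  then have "finite ((\<lambda>(a, h). conj_by a (letter \<Gamma> l) \<otimes>\<^bsub>G\<^esub> h) `
      (range (\<lambda>s. \<pi> s - s) \<times> range (\<lambda>s. twist \<pi> s h)))"
    using letter.IH by blast
  moreover have "range (\<lambda>s. twist \<pi> s (letter \<Gamma> l \<otimes>\<^bsub>G\<^esub> h)) \<subseteq>
      (\<lambda>(a, h). conj_by a (letter \<Gamma> l) \<otimes>\<^bsub>G\<^esub> h) ` (range (\<lambda>s. \<pi> s - s) \<times> range (\<lambda>s. twist \<pi> s h))"
    using letter.hyps by (auto simp: twist_letter_mult emit_def)
  ultimately show ?case by (rule rev_finite_subset)
qed

end

section \<open>Infinite index\<close>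

context artin_vertex
begin

section \<open>Even shifts: infinite index in the commensurator\<close>

definition even_shift :: "int \<Rightarrow> int \<Rightarrow> int" where
  "even_shift j s = (if even s then s + 2 * j else s)"

definition even_subgroup :: "('a \<times> bool) list set set" where
  "even_subgroup = {g \<in> carrier G. even (expo g)}"

definition even_twist :: "int \<Rightarrow> ('a \<times> bool) list set set \<times> (('a \<times> bool) list set \<Rightarrow> ('a \<times> bool) list set)" where
  "even_twist j = (even_subgroup, restrict (twist (even_shift j) 0) even_subgroup)"

lemma even_shift_comp: "even_shift i \<circ> even_shift j = even_shift (i + j)"
  by (auto simp: even_shift_def fun_eq_iff)

lemma even_shift_0: "even_shift 0 = id"
  by (auto simp: even_shift_def fun_eq_iff)

lemma finite_index_even_subgroup: "finite_index_subgroup even_subgroup G"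
proof -
  have expo_inv: "expo (inv\<^bsub>G\<^esub> g) = - expo g" if "g \<in> carrier G" for g
    using expo_mult[of "inv\<^bsub>G\<^esub> g" g] that by (simp add: expo_one)
  have sub: "subgroup even_subgroup G"
    by (rule subgroupI) (auto simp: even_subgroup_def expo_inv expo_mult expo_one intro!: exI[of _ "\<one>\<^bsub>G\<^esub>"])
  have "g \<in> even_subgroup #>\<^bsub>G\<^esub> \<one>\<^bsub>G\<^esub> \<or> g \<in> even_subgroup #>\<^bsub>G\<^esub> t 1" if g: "g \<in> carrier G" for g
  proof (cases "even (expo g)")
    case True
    then show ?thesis using g by (auto simp: r_coset_def even_subgroup_def)
  next
    case False
    have "g \<otimes>\<^bsub>G\<^esub> t (- 1) \<in> even_subgroup" using g False by (simp add: even_subgroup_def expo_mult expo_t del: int_pow_1)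
    moreover have "g \<otimes>\<^bsub>G\<^esub> t (- 1) \<otimes>\<^bsub>G\<^esub> t 1 = g"
      using g t_cancel(2)[of 1] by (simp add: m_assoc del: int_pow_1)
    ultimately show ?thesis by (force simp: r_coset_def)
  qed
  then show ?thesis
    unfolding finite_index_subgroup_iff_cover
    using sub by (intro conjI exI[of _ "{\<one>\<^bsub>G\<^esub>, t 1}"]) auto
qed

text \<open>The displacement of \<open>even_shift j\<close> has period 2, so after an element of
  even exponent the reading of \<open>h\<close> continues as if from 0.\<close>

lemma twist_even_mult:
  assumes "g \<in> even_subgroup" "h \<in> carrier G"
  shows "twist (even_shift j) 0 (g \<otimes>\<^bsub>G\<^esub> h) = twist (even_shift j) 0 g \<otimes>\<^bsub>G\<^esub> twist (even_shift j) 0 h"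
proof -
  have "twist (even_shift j) (expo g) h = twist (even_shift j) 0 h"
    using assms by (intro twist_cong) (auto simp: even_subgroup_def even_shift_def)
  then show ?thesis using assms by (simp add: even_subgroup_def twist_mult)
qed

text \<open>The twist for \<open>- j\<close> is the inverse, and both preserve exponents, so the
  even subgroup is mapped onto itself.\<close>

lemma even_twist_partial_iso: "even_twist j \<in> partial_isos G"
proof -
  have cl: "twist (even_shift i) 0 g \<in> even_subgroup" if "g \<in> even_subgroup" for g i
    using that by (simp add: even_subgroup_def expo_twist)
  have inv: "twist (even_shift i) 0 (twist (even_shift (- i)) 0 g) = g" if "g \<in> even_subgroup" for g i
    using that by (simp add: even_subgroup_def twist_twist even_shift_comp even_shift_0 twist_id)
  have "restrict (twist (even_shift j) 0) even_subgroup ` even_subgroup = even_subgroup"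
  proof
    show "even_subgroup \<subseteq> restrict (twist (even_shift j) 0) even_subgroup ` even_subgroup"
    proof
      fix g assume g: "g \<in> even_subgroup"
      show "g \<in> restrict (twist (even_shift j) 0) even_subgroup ` even_subgroup"
        by (rule image_eqI[of _ _ "twist (even_shift (- j)) 0 g"]) (use g cl inv in simp_all)
    qed
  qed (use cl in auto)
  moreover have "inj_on (restrict (twist (even_shift j) 0) even_subgroup) even_subgroup"
    using inv[of _ "- j"] by (intro inj_on_inverseI[where g = "twist (even_shift (- j)) 0"]) simp
  moreover have "subgroup even_subgroup G"
    using finite_index_even_subgroup by (simp add: finite_index_subgroup_def)
  ultimately show ?thesis
    using finite_index_even_subgroup twist_even_mult
    by (auto simp: even_twist_def partial_isos_iff subgroup.m_closed subgroup.mem_carrier)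
qed

text \<open>Unique roots promote agreement on \<open>L\<close> to identities in the group: \<alpha>
  fixes the powers of \<open>v\<close> and carries conjugates of \<open>w\<close> as the two shifts
  prescribe. The odd exponent 1, fixed by both shifts, forces \<alpha> to fix \<open>w\<close>; the
  even exponent 0 then forces the shifts to coincide.\<close>

lemma even_twist_separated:
  assumes w: "w \<in> pverts \<Gamma>" "w \<noteq> v" "(v, w) \<notin> parcs \<Gamma>" and \<alpha>: "\<alpha> \<in> auto G"
    and eq: "commensurate G `` {even_twist i} = Aut_to_Comm G \<alpha> \<otimes>\<^bsub>Comm G\<^esub> commensurate G `` {even_twist j}"
  shows "i = j"
proof -
  note iso = auto_partial_iso[OF \<alpha>]
  have "Aut_to_Comm G \<alpha> \<otimes>\<^bsub>Comm G\<^esub> commensurate G `` {even_twist j} =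
      commensurate G `` {partial_comp (carrier G, \<alpha>) (even_twist j)}"
    unfolding Aut_to_Comm_def by (rule Comm_mult[OF iso even_twist_partial_iso])
  then have "(even_twist i, partial_comp (carrier G, \<alpha>) (even_twist j)) \<in> commensurate G"
    using eq eq_equiv_class[OF _ equiv_commensurate partial_comp_closed[OF iso even_twist_partial_iso]]
    by simp
  then obtain L where L: "finite_index_subgroup L G"
      "L \<subseteq> fst (even_twist i) \<inter> fst (partial_comp (carrier G, \<alpha>) (even_twist j))"
      "\<forall>x\<in>L. snd (even_twist i) x = snd (partial_comp (carrier G, \<alpha>) (even_twist j)) x"
    unfolding commensurate_def by fastforce
  have agree: "twist (even_shift i) 0 x = \<alpha> (twist (even_shift j) 0 x)" if x: "x \<in> L" for x
  proof -
    have "x \<in> even_subgroup" using L(2) x by (auto simp: even_twist_def)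
    then have "twist (even_shift j) 0 x \<in> carrier G" "x \<in> even_subgroup" by (simp_all add: even_subgroup_def)
    then show ?thesis using bspec[OF L(3) x] by (simp add: even_twist_def)
  qed
  have gw: "gen \<Gamma> w \<in> carrier G" using w by simp
  have \<alpha>_mult: "\<alpha> (x \<otimes>\<^bsub>G\<^esub> y) = \<alpha> x \<otimes>\<^bsub>G\<^esub> \<alpha> y" if "x \<in> carrier G" "y \<in> carrier G" for x y
    using \<alpha> that by (auto simp: auto_def hom_def)
  have \<alpha>_t: "\<alpha> (t a) = t a" for a
  proof -
    obtain n :: nat where n: "0 < n" "t a [^]\<^bsub>G\<^esub> n \<in> L" using pow_in_finite_index[OF L(1) t_closed] by blast
    have "t a [^]\<^bsub>G\<^esub> n = t (a * int n)" using v_vertex by (simp add: int_pow_pow flip: int_pow_int)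
    then have "\<alpha> (t a [^]\<^bsub>G\<^esub> n) = t a [^]\<^bsub>G\<^esub> n" using agree[OF n(2)] by (simp add: twist_t)
    then show ?thesis by (rule auto_determined[OF \<alpha> t_closed t_closed n(1)])
  qed
  have \<alpha>_conj: "\<alpha> (conj_by a g) = conj_by a (\<alpha> g)" if "g \<in> carrier G" for a g
    using that by (simp add: conj_by_def \<alpha>_mult \<alpha>_t)
  have \<alpha>_w: "\<alpha> (conj_by (even_shift j a) (gen \<Gamma> w)) = conj_by (even_shift i a) (gen \<Gamma> w)" for a
  proof -
    obtain n :: nat where n: "0 < n" "conj_by a (gen \<Gamma> w) [^]\<^bsub>G\<^esub> n \<in> L"
      using pow_in_finite_index[OF L(1) conj_closed[OF gw]] by blast
    show ?thesis
      by (rule auto_determined[OF \<alpha> conj_closed[OF gw] conj_closed[OF gw] n(1)])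
        (use agree[OF n(2)] w in \<open>simp add: twist_conj_gen_pow\<close>)
  qed
  have "conj_by 1 (\<alpha> (gen \<Gamma> w)) = conj_by 1 (gen \<Gamma> w)"
    using \<alpha>_w[of 1] gw by (simp add: \<alpha>_conj even_shift_def)
  then have "\<alpha> (gen \<Gamma> w) = gen \<Gamma> w"
    using conj_inj[of "\<alpha> (gen \<Gamma> w)" "gen \<Gamma> w" 1] partial_iso_closed(2)[OF iso gw] gw by simp
  then have "conj_by (2 * j) (gen \<Gamma> w) = conj_by (2 * i) (gen \<Gamma> w)"
    using \<alpha>_w[of 0] gw by (simp add: \<alpha>_conj even_shift_def)
  then have "conj_by (- (2 * i)) (conj_by (2 * j) (gen \<Gamma> w)) = gen \<Gamma> w"
    using gw by (simp add: conj_conj conj_0)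
  then have "conj_by (2 * j - 2 * i) (gen \<Gamma> w) = gen \<Gamma> w"
    using gw by (simp add: conj_conj)
  then show ?thesis using conj_gen_eq_iff[OF w] by fastforce
qed

lemma infinite_index_Aut:
  assumes w: "w \<in> pverts \<Gamma>" "w \<noteq> v" "(v, w) \<notin> parcs \<Gamma>"
  shows "infinite (rcosets\<^bsub>Comm G\<^esub> (Aut_to_Comm G ` carrier (AutoGroup G)))"
proof (rule group.infinite_rcosets[OF group_Comm])
  have "Aut_to_Comm G \<one>\<^bsub>AutoGroup G\<^esub> = \<one>\<^bsub>Comm G\<^esub>"
    by (rule hom_one[OF Aut_to_Comm_hom AutoGroup group_Comm])
  then show "\<one>\<^bsub>Comm G\<^esub> \<in> Aut_to_Comm G ` carrier (AutoGroup G)"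
    using group.is_monoid[OF AutoGroup] by (metis imageI monoid.one_closed)
  show "commensurate G `` {even_twist j} \<in> carrier (Comm G)" for j
    using even_twist_partial_iso by (auto simp: Comm_def quotient_monoid_def quotientI)
  show "i = j"
    if "a \<in> Aut_to_Comm G ` carrier (AutoGroup G)"
      "commensurate G `` {even_twist i} = a \<otimes>\<^bsub>Comm G\<^esub> commensurate G `` {even_twist j}" for i j a
    using that even_twist_separated[OF w] by (auto simp: AutoGroup_def)
qed (rule infinite_UNIV_int)

end

section \<open>Finitely supported permutations: infinite index in the quasi-isometry group\<close>

locale generated_artin_vertex = artin_vertex + generated_group "raag \<Gamma>" S for S
begin

sublocale generated_unique_root_group "raag \<Gamma>" S ..

lemma twist_lipschitz:
  assumes fin: "finite {s. \<pi> s \<noteq> s}"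
  shows "\<exists>K. \<forall>x\<in>carrier G. \<forall>y\<in>carrier G. d (twist \<pi> 0 x) (twist \<pi> 0 y) \<le> K * d x y"
proof -
  have "finite (\<Union>a\<in>{g \<in> carrier G. d \<one>\<^bsub>G\<^esub> g \<le> 1}. range (\<lambda>s. twist \<pi> s a))"
    using finite_range_twist[OF fin] by (intro finite_UN_I finite_ball) auto
  then obtain K where K: "\<And>s a. a \<in> carrier G \<Longrightarrow> d \<one>\<^bsub>G\<^esub> a \<le> 1 \<Longrightarrow> d \<one>\<^bsub>G\<^esub> (twist \<pi> s a) \<le> K"
    using finite_imp_bounded[of _ "\<one>\<^bsub>G\<^esub>"] by fastforce
  have "d (twist \<pi> 0 x) (twist \<pi> 0 y) \<le> K * d x y" if "x \<in> carrier G" "y \<in> carrier G" for x y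
  proof (rule lipschitz_if_local)
    show "d (twist \<pi> 0 x) (twist \<pi> 0 (x \<otimes>\<^bsub>G\<^esub> a)) \<le> K"
      if "x \<in> carrier G" "a \<in> carrier G" "d \<one>\<^bsub>G\<^esub> a \<le> 1" for x a
      using that K d_translate[of "twist \<pi> 0 x" "\<one>\<^bsub>G\<^esub>" "twist \<pi> (expo x) a"] by (simp add: twist_mult)
  qed (use that in auto)
  then show ?thesis by blast
qed

lemma twist_self_QI:
  assumes fin: "finite {s. \<pi> s \<noteq> s}" and inv: "\<pi> \<circ> \<pi> = id"
  shows "restrict (twist \<pi> 0) (carrier G) \<in> self_QIs (carrier G) d"
proof -
  obtain K where K: "\<forall>x\<in>carrier G. \<forall>y\<in>carrier G. d (twist \<pi> 0 x) (twist \<pi> 0 y) \<le> K * d x y"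
    using twist_lipschitz[OF fin] by blast
  show ?thesis
    by (rule self_QI_if_inverse[where g = "twist \<pi> 0" and K = K and K' = K and C = 0])
      (use K in \<open>auto simp: twist_twist inv twist_id d_refl\<close>)
qed

text \<open>Being near the twist, \<phi> agrees with it on suitable powers. As a homomorphism fixing
  the powers of v^N, it commutes with conjugation by them, so \<rho> has the same displacement at 0
  as at multiples of \<open>N\<close>, and finite support makes one of these displacements
  zero.\<close>

lemma partial_iso_near_twist:
  assumes w: "w \<in> pverts \<Gamma>" "w \<noteq> v" "(v, w) \<notin> parcs \<Gamma>"
    and p: "(H, \<phi>) \<in> partial_isos G" and near: "\<And>y. y \<in> H \<Longrightarrow> d (\<phi> y) (twist \<rho> 0 y) \<le> D"
    and fin: "finite {s. \<rho> s \<noteq> s}"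
  shows "\<rho> 0 = 0"
proof -
  have fi: "finite_index_subgroup H G" using p by (simp add: partial_isos_iff)
  then have sH: "subgroup H G" by (simp add: finite_index_subgroup_def)
  have \<phi>_mult: "\<phi> (x \<otimes>\<^bsub>G\<^esub> y) = \<phi> x \<otimes>\<^bsub>G\<^esub> \<phi> y" if "x \<in> H" "y \<in> H" for x y
    using p that by (auto simp: partial_isos_iff)
  \<comment> \<open>The twist need not be a homomorphism, so its values on all powers of
    \<open>y\<close> have to be known.\<close>
  have det: "\<phi> y = z"
    if y: "y \<in> H" and z: "z \<in> carrier G" and pow: "\<And>m::nat. twist \<rho> 0 (y [^]\<^bsub>G\<^esub> m) = z [^]\<^bsub>G\<^esub> m" for y z
  proof (rule powers_near_imp_eq[where C = D])
    show "\<phi> y \<in> carrier G" "z \<in> carrier G" using partial_iso_closed(2)[OF p y] z by auto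
    show "d (\<phi> y [^]\<^bsub>G\<^esub> m) (z [^]\<^bsub>G\<^esub> m) \<le> D" for m :: nat
      using near[of "y [^]\<^bsub>G\<^esub> m"] partial_iso_pow[OF p y, of m] pow[of m] by simp
  qed
  have t_pow: "t a [^]\<^bsub>G\<^esub> m = t (a * int m)" for a and m :: nat
    using v_vertex by (simp add: int_pow_pow flip: int_pow_int)
  have gw: "gen \<Gamma> w \<in> carrier G" using w by simp
  obtain N :: nat where N: "0 < N" "t 1 [^]\<^bsub>G\<^esub> N \<in> H" using pow_in_finite_index[OF fi t_closed] by blast
  obtain M :: nat where M: "0 < M" "gen \<Gamma> w [^]\<^bsub>G\<^esub> M \<in> H" using pow_in_finite_index[OF fi gw] by blast
  have tH: "t (int N * k) \<in> H" for k
    using subgroup_int_pow_closed[OF sH N(2), of k] v_vertex by (simp add: t_pow int_pow_pow del: int_pow_1)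
  have \<phi>_t: "\<phi> (t (int N * k)) = t (int N * k)" for k
    by (rule det[OF tH]) (simp_all add: t_pow twist_t)
  have \<phi>_w: "\<phi> (conj_by a (gen \<Gamma> w) [^]\<^bsub>G\<^esub> M) = conj_by (\<rho> a) (gen \<Gamma> w) [^]\<^bsub>G\<^esub> M"
    if "conj_by a (gen \<Gamma> w) [^]\<^bsub>G\<^esub> M \<in> H" for a
    by (rule det[OF that]) (use w in \<open>simp_all add: nat_pow_pow twist_conj_gen_pow\<close>)
  \<comment> \<open>Infinitely many multiples of \<open>N\<close> cannot all lie in the finite
    support of \<rho>.\<close>
  have "infinite (range (\<lambda>k. int N * int k))"
    by (rule range_inj_infinite) (use N(1) in \<open>auto simp: inj_def\<close>)
  then have "\<not> range (\<lambda>k. int N * int k) \<subseteq> {s. \<rho> s \<noteq> s}"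
    using fin finite_subset by blast
  then obtain k where k: "\<rho> (int N * k) = int N * k" by blast
  let ?a = "int N * k"
  have x: "conj_by 0 (gen \<Gamma> w) [^]\<^bsub>G\<^esub> M \<in> H" using M(2) gw by (simp add: conj_0)
  have y: "conj_by ?a (gen \<Gamma> w) [^]\<^bsub>G\<^esub> M = conj_by ?a (conj_by 0 (gen \<Gamma> w) [^]\<^bsub>G\<^esub> M)"
    using gw by (simp add: conj_0 conj_pow)
  have tH': "t (- ?a) \<in> H" using tH[of "- k"] by simp
  have yH: "conj_by ?a (gen \<Gamma> w) [^]\<^bsub>G\<^esub> M \<in> H"
    unfolding y unfolding conj_by_def[of ?a] by (intro subgroup.m_closed[OF sH] tH tH' x)
  have "\<phi> (conj_by ?a (conj_by 0 (gen \<Gamma> w) [^]\<^bsub>G\<^esub> M)) = conj_by ?a (\<phi> (conj_by 0 (gen \<Gamma> w) [^]\<^bsub>G\<^esub> M))"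
    unfolding conj_by_def[of ?a] using \<phi>_t[of k] \<phi>_t[of "- k"] x tH tH'
    by (simp add: \<phi>_mult subgroup.m_closed[OF sH])
  then have "conj_by ?a (conj_by (\<rho> 0) (gen \<Gamma> w) [^]\<^bsub>G\<^esub> M) = conj_by ?a (gen \<Gamma> w) [^]\<^bsub>G\<^esub> M"
    using \<phi>_w[OF x] \<phi>_w[OF yH] y k by simp
  then have "conj_by ?a (conj_by (\<rho> 0) (gen \<Gamma> w) [^]\<^bsub>G\<^esub> M) = conj_by ?a (gen \<Gamma> w [^]\<^bsub>G\<^esub> M)"
    using gw by (simp add: conj_pow)
  then have "conj_by (\<rho> 0) (gen \<Gamma> w) [^]\<^bsub>G\<^esub> M = gen \<Gamma> w [^]\<^bsub>G\<^esub> M"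
    by (rule conj_inj[rotated 2]) (use gw in simp_all)
  then have "conj_by (\<rho> 0) (gen \<Gamma> w) = gen \<Gamma> w"
    by (rule raag_unique_roots[OF _ gw M(1), rotated]) (use gw in simp_all)
  then show ?thesis by (rule conj_gen_eq_iff[OF w])
qed

lemma infinite_index_Comm:
  assumes w: "w \<in> pverts \<Gamma>" "w \<noteq> v" "(v, w) \<notin> parcs \<Gamma>"
  shows "infinite (rcosets\<^bsub>QI (carrier G) d\<^esub> (Comm_to_QI G S ` carrier (Comm G)))"
proof -
  have Q: "group (QI (carrier G) d)" by (rule group_QI[OF Metric_space_d])
  let ?\<pi> = "\<lambda>c::int. Transposition.transpose 0 c"
  have fin: "finite {s. ?\<pi> c s \<noteq> s}" for c
    by (rule finite_subset[of _ "{0, c}"]) (auto simp: Transposition.transpose_def)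
  let ?f = "\<lambda>c. restrict (twist (?\<pi> c) 0) (carrier G)"
  have f: "?f c \<in> self_QIs (carrier G) d" for c
    by (rule twist_self_QI[OF fin]) simp
  show ?thesis
  proof (rule group.infinite_rcosets[OF Q, where A = "{0<..}" and q = "\<lambda>c. bounded_dist (carrier G) d `` {?f c}"])
    have "Comm_to_QI G S \<one>\<^bsub>Comm G\<^esub> = \<one>\<^bsub>QI (carrier G) d\<^esub>"
      by (rule hom_one[OF Comm_to_QI_hom group_Comm Q])
    then show "\<one>\<^bsub>QI (carrier G) d\<^esub> \<in> Comm_to_QI G S ` carrier (Comm G)"
      using group.is_monoid[OF group_Comm] by (metis imageI monoid.one_closed)
    show "infinite {0::int<..}" by (rule infinite_Ioi)
    show "bounded_dist (carrier G) d `` {?f c} \<in> carrier (QI (carrier G) d)" for c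
      using f by (auto simp: QI_def quotient_monoid_def intro!: quotientI)
    fix b c :: int and A assume bc: "b \<in> {0<..}" "c \<in> {0<..}" and A: "A \<in> Comm_to_QI G S ` carrier (Comm G)"
      and eq: "bounded_dist (carrier G) d `` {?f b} =
        A \<otimes>\<^bsub>QI (carrier G) d\<^esub> bounded_dist (carrier G) d `` {?f c}"
    obtain H \<phi> where p: "(H, \<phi>) \<in> partial_isos G" "A = Comm_to_QI G S (commensurate G `` {(H, \<phi>)})"
      using A by (auto simp: Comm_def quotient_monoid_def quotient_def)
    then have fi: "finite_index_subgroup H G" by (simp add: partial_isos_iff)
    obtain r where r: "r \<in> coarse_retractions G S H" "\<forall>h\<in>H. r h = h" using ex_coarse_retraction[OF fi] by blast
    let ?g = "\<lambda>x\<in>carrier G. \<phi> (r x)"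
    have g: "?g \<in> self_QIs (carrier G) d" by (rule induced_self_QI[OF p(1) r(1)])
    have "bounded_dist (carrier G) d `` {?f b} = bounded_dist (carrier G) d `` {compose (carrier G) ?g (?f c)}"
      using eq QI_mult[OF Metric_space_d g f] by (simp add: p(2) Comm_to_QI_class[OF p(1) r(1)])
    then have "(?f b, compose (carrier G) ?g (?f c)) \<in> bounded_dist (carrier G) d"
      using eq_equiv_class[OF _ equiv_bounded_dist_d self_QI_compose[OF Metric_space_d g f]] by blast
    then obtain D where "\<forall>x\<in>carrier G. d (?f b x) (compose (carrier G) ?g (?f c) x) \<le> D"
      by (auto simp: bounded_dist_def)
    then have D: "d (twist (?\<pi> b) 0 x) (\<phi> (r (twist (?\<pi> c) 0 x))) \<le> D" if "x \<in> carrier G" for x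
      using that by (auto simp: compose_eq)
    \<comment> \<open>The first transposition sends 0 to the positive number \<open>c\<close>, which
      the second one fixes unless \<open>b = c\<close>. So fixing 0 forces
      \<open>b = c\<close>.\<close>
    have "(?\<pi> b \<circ> ?\<pi> c) 0 = 0"
    proof (rule partial_iso_near_twist[OF w p(1), where D = D and \<rho> = "?\<pi> b \<circ> ?\<pi> c"])
      fix y assume y: "y \<in> H"
      have yc: "y \<in> carrier G" by (rule partial_iso_closed(1)[OF p(1) y])
      \<comment> \<open>Evaluating at the \<open>?\<pi> c\<close>-twist of \<open>y\<close> undoes
        the inner twist, since a transposition is its own inverse.\<close>
      show "d (\<phi> y) (twist (?\<pi> b \<circ> ?\<pi> c) 0 y) \<le> D"
        using D[of "twist (?\<pi> c) 0 y"] yc y r(2) by (simp add: twist_twist twist_id d_commute[of "\<phi> y"])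
    next
      have "{s. (?\<pi> b \<circ> ?\<pi> c) s \<noteq> s} \<subseteq> {s. ?\<pi> b s \<noteq> s} \<union> {s. ?\<pi> c s \<noteq> s}" by auto
      then show "finite {s. (?\<pi> b \<circ> ?\<pi> c) s \<noteq> s}"
        using fin by (meson finite_UnI finite_subset)
    qed
    then show "b = c" using bc by (auto simp: Transposition.transpose_def split: if_splits)
  qed
qed

end

text \<open>A vertex \<open>v\<close> adjacent to all others would lie in a triangle: a neighbour
  \<open>a\<close> has valence at least two, hence a further neighbour \<open>b\<close>, which is
  again adjacent to \<open>v\<close>.\<close>

lemma atomic_graph_nonadjacent:
  assumes "atomic_graph \<Gamma>"
  obtains v w where "v \<in> pverts \<Gamma>" "w \<in> pverts \<Gamma>" "w \<noteq> v" "(v, w) \<notin> parcs \<Gamma>"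
proof -
  interpret pair_graph \<Gamma> using assms by (simp add: atomic_graph_def)
  have deg: "2 \<le> card {e \<in> parcs \<Gamma>. fst e = v}" if "v \<in> pverts \<Gamma>" for v
    using assms that by (force simp: atomic_graph_def out_degree_def out_arcs_def)
  have no_triangle: False if "(a, b) \<in> parcs \<Gamma>" "(b, c) \<in> parcs \<Gamma>" "(c, a) \<in> parcs \<Gamma>" for a b c
  proof -
    have "a \<noteq> b" "b \<noteq> c" "c \<noteq> a" using that pair_no_loops by force+
    then have "cycle [(a, b), (b, c), (c, a)]"
      using that arc_fst_in_verts[OF that(1)] by (auto simp: cycle_def awalk_def)
    then show False using assms unfolding atomic_graph_def by fastforce
  qed
  have "pverts \<Gamma> \<noteq> {}"
    using assms by (auto simp: atomic_graph_def connected_def strongly_connected_def mk_symmetric_def)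
  then obtain v where v: "v \<in> pverts \<Gamma>" by blast
  have "\<exists>w\<in>pverts \<Gamma>. w \<noteq> v \<and> (v, w) \<notin> parcs \<Gamma>"
  proof (rule ccontr)
    assume "\<not> ?thesis"
    then have all: "w = v \<or> (v, w) \<in> parcs \<Gamma>" if "w \<in> pverts \<Gamma>" for w using that by blast
    have nbr: "\<exists>b. (a, b) \<in> parcs \<Gamma> \<and> b \<noteq> c" if "a \<in> pverts \<Gamma>" for a c
    proof (rule ccontr)
      assume "\<not> ?thesis"
      then have "{e \<in> parcs \<Gamma>. fst e = a} \<subseteq> {(a, c)}" by auto
      then have "card {e \<in> parcs \<Gamma>. fst e = a} \<le> 1" using card_mono[of "{(a, c)}"] by fastforce
      then show False using deg[OF that] by simp
    qed
    obtain a where a: "(v, a) \<in> parcs \<Gamma>" using nbr[OF v] by blast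
    then have "a \<in> pverts \<Gamma>" using arc_snd_in_verts by force
    then obtain b where b: "(a, b) \<in> parcs \<Gamma>" "b \<noteq> v" using nbr by blast
    then have "(v, b) \<in> parcs \<Gamma>" using all arc_snd_in_verts by force
    then have "(b, v) \<in> parcs \<Gamma>" using pair_sym_arcs by (auto simp: symmetric_def sym_def)
    then show False using no_triangle a b by blast
  qed
  then show thesis using that v by blast
qed

theorem theorem1p10:
  fixes \<Gamma> :: "'v pair_pre_digraph" and S :: "('v \<times> bool) list set set"
  assumes "atomic_graph \<Gamma>"
    and "finite S" and "S \<subseteq> carrier (raag \<Gamma>)" and "generate (raag \<Gamma>) S = carrier (raag \<Gamma>)"
  shows "Aut_to_Comm (raag \<Gamma>) \<in> mon (AutoGroup (raag \<Gamma>)) (Comm (raag \<Gamma>)) \<and>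
    infinite (rcosets\<^bsub>Comm (raag \<Gamma>)\<^esub> (Aut_to_Comm (raag \<Gamma>) ` carrier (AutoGroup (raag \<Gamma>)))) \<and>
    Comm_to_QI (raag \<Gamma>) S \<in>
      mon (Comm (raag \<Gamma>)) (QI (carrier (raag \<Gamma>)) (word_metric (raag \<Gamma>) S)) \<and>
    infinite (rcosets\<^bsub>QI (carrier (raag \<Gamma>)) (word_metric (raag \<Gamma>) S)\<^esub>
      (Comm_to_QI (raag \<Gamma>) S ` carrier (Comm (raag \<Gamma>))))"
proof -
  obtain v w where vw: "v \<in> pverts \<Gamma>" "w \<in> pverts \<Gamma>" "w \<noteq> v" "(v, w) \<notin> parcs \<Gamma>"
    using atomic_graph_nonadjacent[OF assms(1)] by blast
  interpret artin_group \<Gamma>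
    using assms(1) by (simp add: artin_group_def atomic_graph_def)
  interpret generated_artin_vertex \<Gamma> v S
    using assms(2-4) vw(1) by unfold_locales
  show ?thesis
    unfolding mon_def
    using Aut_to_Comm_hom Aut_to_Comm_inj infinite_index_Aut[OF vw(2-4)]
      Comm_to_QI_hom Comm_to_QI_inj infinite_index_Comm[OF vw(2-4)]
    by blast
qed

end
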